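(* Let $d,s,t\in\mathbb N$, $F\in L^1(\mathbb T^d;\mathbb H^{s\times t})$, and $\tau\in\{L,R,(S_L,S_R)\}$. Then there exist finite sets $\mathcal S_m\subset\mathbb Z^d$ with $\mathcal S_m\uparrow\mathbb Z^d$ such that, with $$B_{\boldsymbol n,m}:=\sum_{\boldsymbol q\in\mathcal S_m}P^{(\boldsymbol q)}_{\boldsymbol n}\otimes\widehat F^{(\tau)}(\boldsymbol q),$$ the class $\{\{B_{\boldsymbol n,m}\}_{\boldsymbol n}:m\}$ is an approximating class of sequences (a.c.s.) for $\{T^{(\tau)}_{\boldsymbol n}(F)\}_{\boldsymbol n}$.
   Context: $\mathbb H$ is the quaternion algebra with units $\mathbf i,\mathbf j,\mathbf k=\mathbf i\mathbf j$. $\mathbb T^d=[-\pi,\pi)^d$; $S_L\dot\cup S_R=\{1,\dots,d\}$ is an ordered partition, $\tau=L$ means $S_L=\{1,\dots,d\}$, $\tau=R$ means $S_R=\{1,\dots,d\}$. $\widehat F^{(S_L,S_R)}(\boldsymbol q)=(2\pi)^{-d}\int_{\mathbb T^d}e^{-\mathbf i\langle\boldsymbol q,\boldsymbol\theta\rangle_{S_L}}F(\boldsymbol\theta)e^{-\mathbf i\langle\boldsymbol q,\boldsymbol\theta\rangle_{S_R}}d\boldsymbol\theta$ with $\langle\boldsymbol q,\boldsymbol\theta\rangle_S=\sum_{j\in S}q_j\theta_j$. $T^{(\tau)}_{\boldsymbol n}(F)=[\widehat F^{(\tau)}(\alpha-\beta)]_{\alpha,\beta\in\Lambda_{\boldsymbol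 n}}\in\mathbb H^{N_{\boldsymbol n}s\times N_{\boldsymbol n}t}$, $\Lambda_{\boldsymbol n}=\prod_\ell\{0,\dots,n_\ell-1\}$ (lexicographic), $N_{\boldsymbol n}=\prod n_\ell$. Periodic shifts: $[P^{(q)}_n]_{ij}=1$ if $i\equiv j+q\pmod n$, else $0$; $P^{(\boldsymbol q)}_{\boldsymbol n}=\bigotimes_\ell P^{(q_\ell)}_{n_\ell}$. A.c.s.: with $r_{\boldsymbol n}=N_{\boldsymbol n}\min\{s,t\}$, $\{\{B_{\boldsymbol n,m}\}_{\boldsymbol n}:m\}$ is an a.c.s. for $\{A_{\boldsymbol n}\}$ if for each $m$ there is a threshold such that for all $\boldsymbol n$ beyond it (i.e. $\min_jn_j$ large enough) $A_{\boldsymbol n}=B_{\boldsymbol n,m}+R_{\boldsymbol n,m}+N_{\boldsymbol n,m}$ with $\operatorname{rank}_{\mathbb H}(R_{\boldsymbol n,m})/r_{\boldsymbol n}\le c(m)$ and $\|N_{\boldsymbol n,m}\|\le\omega(m)$ (spectral norm), where $c(m),\omega(m)\to0$ as $m\to\infty$. *)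

theory Defs
  imports "HOL-Analysis.Analysis"
begin

section \<open>Quaternions, realised as real^4 (components 0,1,2,3 = 1, i, j, k)\<close>

type_synonym quat = "real^4"

definition qmk :: "real \<Rightarrow> real \<Rightarrow> real \<Rightarrow> real \<Rightarrow> quat" where
  "qmk a b c e = (\<chi> i. if i = 0 then a else if i = 1 then b else if i = 2 then c else e)"

definition qmul :: "quat \<Rightarrow> quat \<Rightarrow> quat" where
  "qmul x y = qmk
     (x$0*y$0 - x$1*y$1 - x$2*y$2 - x$3*y$3)
     (x$0*y$1 + x$1*y$0 + x$2*y$3 - x$3*y$2)
     (x$0*y$2 - x$1*y$3 + x$2*y$0 + x$3*y$1)
     (x$0*y$3 + x$1*y$2 - x$2*y$1 + x$3*y$0)"

definition qexpi :: "real \<Rightarrow> quat" where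
  "qexpi x = qmk (cos x) (sin x) 0 0"

text \<open>Quaternion matrices: entries indexed by (row, column); dimensions carried separately.\<close>
type_synonym qmat = "nat \<Rightarrow> nat \<Rightarrow> quat"

definition torus :: "nat \<Rightarrow> (nat \<Rightarrow> real) set" where
  "torus d = PiE {..<d} (\<lambda>_. {-pi..<pi})"

definition torus_measure :: "nat \<Rightarrow> (nat \<Rightarrow> real) measure" where
  "torus_measure d = PiM {..<d} (\<lambda>_. lborel)"

definition Zd :: "nat \<Rightarrow> (nat \<Rightarrow> int) set" where
  "Zd d = {q. \<forall>j. d \<le> j \<longrightarrow> q j = 0}"

definition qL1 :: "nat \<Rightarrow> nat \<Rightarrow> nat \<Rightarrow> ((nat \<Rightarrow> real) \<Rightarrow> qmat) \<Rightarrow> bool" where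
  "qL1 d s t F \<longleftrightarrow> (\<forall>a<s. \<forall>b<t. set_integrable (torus_measure d) (torus d) (\<lambda>\<theta>. F \<theta> a b))"

definition ipS :: "nat set \<Rightarrow> (nat \<Rightarrow> int) \<Rightarrow> (nat \<Rightarrow> real) \<Rightarrow> real" where
  "ipS S q \<theta> = (\<Sum>j\<in>S. of_int (q j) * \<theta> j)"

text \<open>Fourier coefficient of type (S_L, S_R) with S_R = {..<d} - S_L
  (tau = L is S_L = {..<d}, tau = R is S_L = {}).\<close>
definition fourier_coeff :: "nat \<Rightarrow> nat set \<Rightarrow> ((nat \<Rightarrow> real) \<Rightarrow> qmat) \<Rightarrow> (nat \<Rightarrow> int) \<Rightarrow> qmat" where
  "fourier_coeff d SL F q = (\<lambda>a b. (1 / (2*pi)^d) *\<^sub>R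
     (LINT \<theta> : torus d | torus_measure d.
        qmul (qexpi (- ipS SL q \<theta>)) (qmul (F \<theta> a b) (qexpi (- ipS ({..<d} - SL) q \<theta>)))))"

definition Nsize :: "nat \<Rightarrow> (nat \<Rightarrow> nat) \<Rightarrow> nat" where
  "Nsize d n = (\<Prod>l<d. n l)"

text \<open>Linear index I (0 \<le> I < N_n) to multi-index alpha in Lambda_n, lexicographic
  (coordinate 0 most significant).\<close>
definition midx :: "nat \<Rightarrow> (nat \<Rightarrow> nat) \<Rightarrow> nat \<Rightarrow> nat \<Rightarrow> nat" where
  "midx d n I l = (I div (\<Prod>k\<in>{l<..<d}. n k)) mod n l"

definition toeplitz :: "nat \<Rightarrow> (nat \<Rightarrow> nat) \<Rightarrow> nat \<Rightarrow> nat \<Rightarrow> ((nat \<Rightarrow> int) \<Rightarrow> qmat) \<Rightarrow> qmat" where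
  "toeplitz d n s t Fh = (\<lambda>i j.
     Fh (\<lambda>l. if l < d then int (midx d n (i div s) l) - int (midx d n (j div t) l) else 0)
        (i mod s) (j mod t))"

definition kron_rr :: "nat \<Rightarrow> nat \<Rightarrow> (nat \<Rightarrow> nat \<Rightarrow> real) \<Rightarrow> (nat \<Rightarrow> nat \<Rightarrow> real) \<Rightarrow> nat \<Rightarrow> nat \<Rightarrow> real" where
  "kron_rr m2 n2 P Q = (\<lambda>i j. P (i div m2) (j div n2) * Q (i mod m2) (j mod n2))"

definition kron_rq :: "nat \<Rightarrow> nat \<Rightarrow> (nat \<Rightarrow> nat \<Rightarrow> real) \<Rightarrow> qmat \<Rightarrow> qmat" where
  "kron_rq m2 n2 P X = (\<lambda>i j. P (i div m2) (j div n2) *\<^sub>R X (i mod m2) (j mod n2))"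

definition shiftP :: "nat \<Rightarrow> int \<Rightarrow> nat \<Rightarrow> nat \<Rightarrow> real" where
  "shiftP n q = (\<lambda>i j. if (int i - int j - q) mod int n = 0 then 1 else 0)"

fun mshift :: "(nat \<Rightarrow> nat) \<Rightarrow> (nat \<Rightarrow> int) \<Rightarrow> nat \<Rightarrow> nat \<Rightarrow> nat \<Rightarrow> real" where
  "mshift n q 0 = (\<lambda>i j. 1)"
| "mshift n q (Suc l) = kron_rr (n l) (n l) (mshift n q l) (shiftP (n l) (q l))"

definition qrank :: "nat \<Rightarrow> nat \<Rightarrow> qmat \<Rightarrow> nat" where
  "qrank m n A = Max {card J | J. J \<subseteq> {..<n} \<and>
      (\<forall>c. (\<forall>i<m. (\<Sum>j\<in>J. qmul (A i j) (c j)) = 0) \<longrightarrow> (\<forall>j\<in>J. c j = 0))}"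

definition qvnorm :: "nat \<Rightarrow> (nat \<Rightarrow> quat) \<Rightarrow> real" where
  "qvnorm n x = sqrt (\<Sum>i<n. (norm (x i))\<^sup>2)"

definition qopnorm :: "nat \<Rightarrow> nat \<Rightarrow> qmat \<Rightarrow> real" where
  "qopnorm m n A = Sup {qvnorm m (\<lambda>i. \<Sum>j<n. qmul (A i j) (x j)) | x. qvnorm n x \<le> 1}"

definition is_acs :: "nat \<Rightarrow> nat \<Rightarrow> nat \<Rightarrow> ((nat \<Rightarrow> nat) \<Rightarrow> qmat) \<Rightarrow> (nat \<Rightarrow> (nat \<Rightarrow> nat) \<Rightarrow> qmat) \<Rightarrow> bool" where
  "is_acs d s t A B \<longleftrightarrow> (\<exists>c \<omega> :: nat \<Rightarrow> real. c \<longlonglongrightarrow> 0 \<and> \<omega> \<longlonglongrightarrow> 0 \<and>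
     (\<forall>m. \<exists>K. \<forall>n. (\<forall>j<d. K \<le> n j) \<longrightarrow>
        (\<exists>R N. (\<forall>i < Nsize d n * s. \<forall>j < Nsize d n * t. A n i j = B m n i j + R i j + N i j)
             \<and> real (qrank (Nsize d n * s) (Nsize d n * t) R) \<le> c m * real (Nsize d n * min s t)
             \<and> qopnorm (Nsize d n * s) (Nsize d n * t) N \<le> \<omega> m)))"

end

theory Submission
  imports Defs "HOL-Complex_Analysis.Complex_Analysis"
begin

text \<open>Writing F = f + g j with complex f and g, and since a right exponential moves past j with
  reversed sign, everything reduces to scalar coefficient functions c of integrable functions.
  Let p be a trigonometric polynomial close to f in the L1 norm, and split
  T(c) - C(S c) = T(c - p) + (T(p) - C(p)) + C(p - S c), where C denotes the circulant.
  The first term is a section of a larger circulant whose eigenvalues are the values of a de la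
  Vallee-Poussin mean of f - p on a grid, so that few of them are large; the second one has few
  nonzero rows. The third is a circulant whose eigenvalues are the grid values of p - S f, so S must be
  chosen such that p - S f is small in measure. For boxes S whose side lengths are chosen one after the
  other, this follows from Kolmogorov's inequality for partial sums in one variable, from L1 to
  L^(1/2): the Cauchy transform of a nonnegative function has positive real part, and
  the mean value property applies to its holomorphic square root.\<close>

section \<open>Quaternions\<close>

text \<open>The coefficients in \<open>B\<close> are those of F itself, without damping weights. So
  the approximating symbol is a plain partial sum, and partial sums of an integrable function need
  not converge in L1. The L^(1/2) mean controls their number, and the square root of the modulus is
  subadditive, so it can be used like a distance. The one-dimensional inequality cannot be iterated
  over the coordinates, because it starts from L1 and ends outside it; this forces the order of the
  choices, in which a new cut-off sees the earlier ones as fixed operators. Moreover, an integrable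
  function has no values on a grid. Its L1 norm therefore enters only through grid means of
  kernel-smoothed series (\<open>L1le\<close>), and a Fejer parameter N is carried along until the
  cut-offs and the polynomial are fixed; it can be removed then, because the sums that remain are
  finite. One set S must serve all matrix entries and both complex components, so finitely many
  coefficient functions are treated at once.\<close>

lemma qmk_nth [simp]:
  "qmk a b c e $ 0 = a" "qmk a b c e $ 1 = b" "qmk a b c e $ 2 = c" "qmk a b c e $ 3 = e"
  by (simp_all add: qmk_def)

lemma four_eq_0: "(4::4) = 0"
  by simp

lemma sum_UNIV_4: "(\<Sum>i\<in>(UNIV::4 set). f i) = f 0 + f 1 + f 2 + f 3"
  using sum_4[of f] by (simp add: four_eq_0 add_ac)

lemma quat_eq_iff: "x = y \<longleftrightarrow> x$0 = y$0 \<and> x$1 = y$1 \<and> x$2 = y$2 \<and> x$3 = y$3" for x y :: quat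
proof -
  have "x = y \<longleftrightarrow> (\<forall>i. x$i = y$i)" by (simp add: vec_eq_iff)
  also have "\<dots> \<longleftrightarrow> x$1 = y$1 \<and> x$2 = y$2 \<and> x$3 = y$3 \<and> x$4 = y$4" by (rule forall_4)
  finally show ?thesis unfolding four_eq_0 by auto
qed

lemma quat_norm_sq: "(norm x)\<^sup>2 = (x$0)\<^sup>2 + (x$1)\<^sup>2 + (x$2)\<^sup>2 + (x$3)\<^sup>2" for x :: quat
  unfolding power2_norm_eq_inner by (simp add: inner_vec_def sum_UNIV_4 power2_eq_square)

lemma qmul_nth [simp]:
  "qmul x y $ 0 = x$0*y$0 - x$1*y$1 - x$2*y$2 - x$3*y$3"
  "qmul x y $ 1 = x$0*y$1 + x$1*y$0 + x$2*y$3 - x$3*y$2"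
  "qmul x y $ 2 = x$0*y$2 - x$1*y$3 + x$2*y$0 + x$3*y$1"
  "qmul x y $ 3 = x$0*y$3 + x$1*y$2 - x$2*y$1 + x$3*y$0"
  unfolding qmul_def by simp_all

lemma qmul_assoc: "qmul (qmul x y) z = qmul x (qmul y z)"
  by (simp add: quat_eq_iff algebra_simps)

lemma qmul_add_left: "qmul (x + y) z = qmul x z + qmul y z"
  by (simp add: quat_eq_iff algebra_simps)

lemma qmul_add_right: "qmul x (y + z) = qmul x y + qmul x z"
  by (simp add: quat_eq_iff algebra_simps)

lemma qmul_minus_left: "qmul (- x) z = - qmul x z"
  by (simp add: quat_eq_iff algebra_simps)

lemma qmul_minus_right: "qmul x (- z) = - qmul x z"
  by (simp add: quat_eq_iff algebra_simps)

lemma qmul_zero_left [simp]: "qmul 0 z = 0"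
  by (simp add: quat_eq_iff)

lemma qmul_zero_right [simp]: "qmul z 0 = 0"
  by (simp add: quat_eq_iff)

lemma qmul_scaleR_right: "qmul x (r *\<^sub>R z) = r *\<^sub>R qmul x z"
  by (simp add: quat_eq_iff algebra_simps)

lemma qmul_sum_left: "qmul (\<Sum>i\<in>A. f i) z = (\<Sum>i\<in>A. qmul (f i) z)"
  by (induction A rule: infinite_finite_induct) (simp_all add: qmul_add_left)

lemma qmul_sum_right: "qmul z (\<Sum>i\<in>A. f i) = (\<Sum>i\<in>A. qmul z (f i))"
  by (induction A rule: infinite_finite_induct) (simp_all add: qmul_add_right)

lemma norm_qmul: "norm (qmul x y) = norm x * norm y"
proof -
  have "(norm (qmul x y))\<^sup>2 = (norm x * norm y)\<^sup>2"
    unfolding power_mult_distrib quat_norm_sq by (simp add: power2_eq_square algebra_simps)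
  then show ?thesis by simp
qed

definition qinv :: "quat \<Rightarrow> quat" where
  "qinv x = (1 / (norm x)\<^sup>2) *\<^sub>R qmk (x$0) (- x$1) (- x$2) (- x$3)"

definition qc :: "complex \<Rightarrow> quat" where
  "qc z = qmk (Re z) (Im z) 0 0"

definition qj :: quat where
  "qj = qmk 0 0 1 0"

lemma qc_nth [simp]: "qc z $ 0 = Re z" "qc z $ 1 = Im z" "qc z $ 2 = 0" "qc z $ 3 = 0"
  by (simp_all add: qc_def)

lemma qj_nth [simp]: "qj $ 0 = 0" "qj $ 1 = 0" "qj $ 2 = 1" "qj $ 3 = 0"
  by (simp_all add: qj_def)

lemma qmul_one_left [simp]: "qmul (qc 1) x = x"
  by (simp add: quat_eq_iff)

lemma qmul_one_right [simp]: "qmul x (qc 1) = x"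
  by (simp add: quat_eq_iff)

lemma qc_add: "qc (x + y) = qc x + qc y"
  by (simp add: quat_eq_iff)

lemma qc_mult: "qc (x * y) = qmul (qc x) (qc y)"
  by (simp add: quat_eq_iff)

lemma qc_0 [simp]: "qc 0 = 0"
  by (simp add: quat_eq_iff)

lemma qc_sum: "qc (\<Sum>i\<in>A. f i) = (\<Sum>i\<in>A. qc (f i))"
  by (induction A rule: infinite_finite_induct) (simp_all add: qc_add)

lemma qmul_qinv: "x \<noteq> 0 \<Longrightarrow> qmul x (qinv x) = qc 1"
proof -
  assume "x \<noteq> 0"
  then have n: "(norm x)\<^sup>2 \<noteq> 0" by simp
  have "(x$0)*(x$0) + (x$1)*(x$1) + (x$2)*(x$2) + (x$3)*(x$3) = (norm x)\<^sup>2"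
    unfolding quat_norm_sq by (simp add: power2_eq_square)
  then show ?thesis
    using n unfolding qinv_def qmul_scaleR_right by (simp add: quat_eq_iff field_simps)
qed

section \<open>Complex components of a quaternion\<close>

definition q1 :: "quat \<Rightarrow> complex" where "q1 x = Complex (x$0) (x$1)"
definition q2 :: "quat \<Rightarrow> complex" where "q2 x = Complex (x$2) (x$3)"

lemma quat_decomp: "x = qc (q1 x) + qmul (qc (q2 x)) qj"
  by (simp add: quat_eq_iff q1_def q2_def)

lemma norm_decomp: "(norm x)\<^sup>2 = (cmod (q1 x))\<^sup>2 + (cmod (q2 x))\<^sup>2"
  by (simp add: quat_norm_sq q1_def q2_def cmod_power2)

lemma norm_qj: "norm qj = 1"
proof -
  have "(norm qj)\<^sup>2 = 1" by (simp add: quat_norm_sq)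
  then show ?thesis by (metis norm_ge_zero one_power2 power2_eq_imp_eq zero_le_one)
qed

lemma norm_qc: "norm (qc z) = cmod z"
proof -
  have "(norm (qc z))\<^sup>2 = (cmod z)\<^sup>2" by (simp add: quat_norm_sq cmod_power2)
  then show ?thesis by simp
qed

text \<open>The complex coefficients in \<open>quat_decomp\<close> stand to the left of
  \<open>qj\<close>, so left multiplication by a complex number does not mix the components. A
  complex matrix acting from the left on a quaternion vector thus acts on two complex vectors
  separately.\<close>

lemma q1_qmul_qc: "q1 (qmul (qc z) x) = z * q1 x"
  by (simp add: q1_def complex_eq_iff)

lemma q2_qmul_qc: "q2 (qmul (qc z) x) = z * q2 x"
  by (simp add: q2_def complex_eq_iff)

lemma q1_add: "q1 (x + y) = q1 x + q1 y" by (simp add: q1_def complex_eq_iff)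
lemma q2_add: "q2 (x + y) = q2 x + q2 y" by (simp add: q2_def complex_eq_iff)
lemma q1_0 [simp]: "q1 0 = 0" by (simp add: q1_def complex_eq_iff)
lemma q2_0 [simp]: "q2 0 = 0" by (simp add: q2_def complex_eq_iff)

lemma q1_sum: "q1 (\<Sum>i\<in>A. f i) = (\<Sum>i\<in>A. q1 (f i))"
  by (induction A rule: infinite_finite_induct) (simp_all add: q1_add)

lemma q2_sum: "q2 (\<Sum>i\<in>A. f i) = (\<Sum>i\<in>A. q2 (f i))"
  by (induction A rule: infinite_finite_induct) (simp_all add: q2_add)

section \<open>Low rank plus small norm\<close>

text \<open>Elimination over a skew field. The pivot equation \<open>k\<close> is solved for the
  unknown \<open>i\<close> by means of a right inverse \<open>p\<close> of the pivot; substituting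
  the solution into row \<open>k'\<close> gives the coefficients \<open>w k'\<close> of a system
  with one equation and one unknown fewer.\<close>

lemma qmul_homogeneous_system:
  fixes v :: "'k \<Rightarrow> 'j \<Rightarrow> quat"
  assumes "finite K" "finite J" "card K < card J"
  shows "\<exists>c. (\<exists>j\<in>J. c j \<noteq> 0) \<and> (\<forall>k\<in>K. (\<Sum>j\<in>J. qmul (v k j) (c j)) = 0)"
  using assms
proof (induction K arbitrary: J v rule: finite_induct)
  case empty
  then obtain j where "j \<in> J" by fastforce
  have "qc 1 \<noteq> 0" by (simp add: quat_eq_iff)
  with \<open>j \<in> J\<close> show ?case by (intro exI[of _ "\<lambda>_. qc 1"]) auto
next
  case (insert k K)
  show ?case
  proof (cases "\<forall>j\<in>J. v k j = 0")
    case True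
    obtain c where "\<exists>j\<in>J. c j \<noteq> 0" "\<forall>k\<in>K. (\<Sum>j\<in>J. qmul (v k j) (c j)) = 0"
      using insert.IH[of J v] insert.prems insert.hyps by auto
    with True show ?thesis by (intro exI[of _ c]) auto
  next
    case False
    then obtain i where i: "i \<in> J" "v k i \<noteq> 0" by auto
    define J' where "J' = J - {i}"
    have J': "finite J'" "card K < card J'" "J = insert i J'" "i \<notin> J'"
      using insert.prems insert.hyps i by (auto simp: J'_def)
    define p where "p = qinv (v k i)"
    have p: "qmul (v k i) p = qc 1" using qmul_qinv[OF i(2)] by (simp add: p_def)
    define w where "w k' j = v k' j - qmul (v k' i) (qmul p (v k j))" for k' j
    obtain c where c: "\<exists>j\<in>J'. c j \<noteq> 0" "\<forall>k\<in>K. (\<Sum>j\<in>J'. qmul (w k j) (c j)) = 0"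
      using insert.IH[of J' w] J' by auto
    define e where "e = c(i := - qmul p (\<Sum>j\<in>J'. qmul (v k j) (c j)))"
    have S: "(\<Sum>j\<in>J. qmul (v k' j) (e j)) = (\<Sum>j\<in>J'. qmul (w k' j) (c j))" for k'
    proof -
      have "(\<Sum>j\<in>J. qmul (v k' j) (e j)) = qmul (v k' i) (e i) + (\<Sum>j\<in>J'. qmul (v k' j) (e j))"
        using J' by simp
      also have "(\<Sum>j\<in>J'. qmul (v k' j) (e j)) = (\<Sum>j\<in>J'. qmul (v k' j) (c j))"
        using J'(4) by (intro sum.cong) (auto simp: e_def)
      also have "qmul (v k' i) (e i) = - (\<Sum>j\<in>J'. qmul (qmul (v k' i) (qmul p (v k j))) (c j))"
        by (simp add: e_def qmul_minus_right qmul_sum_right qmul_assoc)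
      also have "\<dots> + (\<Sum>j\<in>J'. qmul (v k' j) (c j)) = (\<Sum>j\<in>J'. qmul (w k' j) (c j))"
        unfolding w_def diff_conv_add_uminus qmul_add_left qmul_minus_left
        by (simp add: sum_subtractf)
      finally show ?thesis .
    qed
    have "w k j = 0" for j
      unfolding w_def qmul_assoc[symmetric] p by simp
    then have "(\<Sum>j\<in>J. qmul (v k j) (e j)) = 0" unfolding S by simp
    moreover have "\<exists>j\<in>J. e j \<noteq> 0" using c(1) J' by (auto simp: e_def)
    ultimately show ?thesis using c(2) S by (intro exI[of _ e]) auto
  qed
qed

text \<open>Among more than \<open>K\<close> columns there is a right linear relation:
  \<open>qmul_homogeneous_system\<close> supplies nonzero coefficients annihilated by all row
  factors \<open>v k\<close>, hence by \<open>R\<close>.\<close>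

lemma qrank_sum_rank_one_le:
  assumes "\<And>i j. i < m \<Longrightarrow> j < n \<Longrightarrow> R i j = (\<Sum>k<K. qmul (u k i) (v k j))"
  shows "qrank m n R \<le> K"
proof -
  let ?X = "{card J | J. J \<subseteq> {..<n} \<and>
      (\<forall>c. (\<forall>i<m. (\<Sum>j\<in>J. qmul (R i j) (c j)) = 0) \<longrightarrow> (\<forall>j\<in>J. c j = 0))}"
  have "?X \<subseteq> {..n}" by (auto dest: card_mono[rotated])
  then have "finite ?X" by (rule finite_subset) simp
  moreover have "0 \<in> ?X" by (auto intro!: exI[of _ "{}"])
  moreover have "x \<le> K" if x: "x \<in> ?X" for x
  proof -
    obtain J where J: "x = card J" "J \<subseteq> {..<n}"
      and ind: "\<And>c. (\<forall>i<m. (\<Sum>j\<in>J. qmul (R i j) (c j)) = 0) \<Longrightarrow> (\<forall>j\<in>J. c j = 0)"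
      using x by blast
    have fin: "finite J" using J(2) finite_subset by blast
    show "x \<le> K"
    proof (rule ccontr)
      assume "\<not> x \<le> K"
      then obtain c where c: "\<exists>j\<in>J. c j \<noteq> 0" "\<forall>k\<in>{..<K}. (\<Sum>j\<in>J. qmul (v k j) (c j)) = 0"
        using qmul_homogeneous_system[of "{..<K}" J v] fin J(1) by auto
      have "(\<Sum>j\<in>J. qmul (R i j) (c j)) = 0" if "i < m" for i
      proof -
        have "(\<Sum>j\<in>J. qmul (R i j) (c j)) = (\<Sum>j\<in>J. \<Sum>k<K. qmul (u k i) (qmul (v k j) (c j)))"
          using J(2) that by (intro sum.cong) (auto simp: assms qmul_sum_left qmul_assoc)
        also have "\<dots> = (\<Sum>k<K. qmul (u k i) (\<Sum>j\<in>J. qmul (v k j) (c j)))"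
          by (subst sum.swap) (simp add: qmul_sum_right)
        also have "\<dots> = 0" using c(2) by simp
        finally show ?thesis .
      qed
      then show False using ind c(1) by blast
    qed
  qed
  ultimately show ?thesis unfolding qrank_def by (subst Max_le_iff) auto
qed

lemma qvnorm_L2: "qvnorm n x = L2_set (\<lambda>i. norm (x i)) {..<n}"
  by (simp add: qvnorm_def L2_set_def)

lemma qvnorm_triangle: "qvnorm n (\<lambda>i. x i + y i) \<le> qvnorm n x + qvnorm n y"
proof -
  have "qvnorm n (\<lambda>i. x i + y i) \<le> L2_set (\<lambda>i. norm (x i) + norm (y i)) {..<n}"
    unfolding qvnorm_L2 by (intro L2_set_mono norm_triangle_ineq) auto
  also have "\<dots> \<le> qvnorm n x + qvnorm n y"
    unfolding qvnorm_L2 by (rule L2_set_triangle_ineq)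
  finally show ?thesis .
qed

text \<open>The rank is recorded by a factorization into \<open>K\<close> products of a column and a
  row, the norm by an inequality for every vector. Both pass to sums directly, whereas
  \<open>qrank\<close> and \<open>qopnorm\<close> are a \<open>Max\<close> and a \<open>Sup\<close>;
  the conversion is made once, in \<open>qsplits_imp_rank_norm\<close>.\<close>

definition qsplits :: "nat \<Rightarrow> nat \<Rightarrow> qmat \<Rightarrow> real \<Rightarrow> real \<Rightarrow> bool" where
  "qsplits m n A r \<delta> \<longleftrightarrow> (\<exists>(K::nat) u v E. real K \<le> r
     \<and> (\<forall>i<m. \<forall>j<n. A i j = (\<Sum>k<K. qmul (u k i) (v k j)) + E i j)
     \<and> (\<forall>x. qvnorm m (\<lambda>i. \<Sum>j<n. qmul (E i j) (x j)) \<le> \<delta> * qvnorm n x))"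

lemma qsplits_imp_rank_norm:
  assumes "qsplits m n A r \<delta>" "0 \<le> \<delta>"
  shows "\<exists>R N. (\<forall>i<m. \<forall>j<n. A i j = R i j + N i j) \<and> real (qrank m n R) \<le> r \<and> qopnorm m n N \<le> \<delta>"
proof -
  obtain K :: nat and u v E where K: "real K \<le> r"
    and A: "\<And>i j. i < m \<Longrightarrow> j < n \<Longrightarrow> A i j = (\<Sum>k<K. qmul (u k i) (v k j)) + E i j"
    and E: "\<And>x. qvnorm m (\<lambda>i. \<Sum>j<n. qmul (E i j) (x j)) \<le> \<delta> * qvnorm n x"
    using assms(1) unfolding qsplits_def by auto
  define R where "R i j = (\<Sum>k<K. qmul (u k i) (v k j))" for i j
  have "qrank m n R \<le> K" by (rule qrank_sum_rank_one_le) (simp add: R_def)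
  moreover have "qopnorm m n E \<le> \<delta>"
    unfolding qopnorm_def
  proof (rule cSup_least)
    show "{qvnorm m (\<lambda>i. \<Sum>j<n. qmul (E i j) (x j)) |x. qvnorm n x \<le> 1} \<noteq> {}"
      by (auto intro!: exI[of _ "\<lambda>_. 0"] simp: qvnorm_def)
  next
    fix y assume "y \<in> {qvnorm m (\<lambda>i. \<Sum>j<n. qmul (E i j) (x j)) |x. qvnorm n x \<le> 1}"
    then obtain x where x: "y = qvnorm m (\<lambda>i. \<Sum>j<n. qmul (E i j) (x j))" "qvnorm n x \<le> 1" by auto
    have "\<delta> * qvnorm n x \<le> \<delta> * 1" using x(2) assms(2) by (intro mult_left_mono)
    then show "y \<le> \<delta>" using E[of x] x(1) by simp
  qed
  ultimately show ?thesis using K A by (intro exI[of _ R] exI[of _ E]) (auto simp: R_def)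
qed

lemma sum_split_lessThan_add:
  fixes K L :: nat and f g :: "nat \<Rightarrow> 'b::comm_monoid_add"
  shows "(\<Sum>k<K+L. if k < K then f k else g (k - K)) = (\<Sum>k<K. f k) + (\<Sum>k<L. g k)"
proof (induction L)
  case (Suc L)
  then show ?case by (simp add: add.assoc)
qed simp

lemma qsplits_add:
  assumes "qsplits m n A r \<delta>" "qsplits m n A' r' \<delta>'"
  shows "qsplits m n (\<lambda>i j. A i j + A' i j) (r + r') (\<delta> + \<delta>')"
proof -
  obtain K :: nat and u v E where K: "real K \<le> r"
    and A: "\<And>i j. i < m \<Longrightarrow> j < n \<Longrightarrow> A i j = (\<Sum>k<K. qmul (u k i) (v k j)) + E i j"
    and E: "\<And>x. qvnorm m (\<lambda>i. \<Sum>j<n. qmul (E i j) (x j)) \<le> \<delta> * qvnorm n x"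
    using assms(1) unfolding qsplits_def by auto
  obtain K' :: nat and u' v' E' where K': "real K' \<le> r'"
    and A': "\<And>i j. i < m \<Longrightarrow> j < n \<Longrightarrow> A' i j = (\<Sum>k<K'. qmul (u' k i) (v' k j)) + E' i j"
    and E': "\<And>x. qvnorm m (\<lambda>i. \<Sum>j<n. qmul (E' i j) (x j)) \<le> \<delta>' * qvnorm n x"
    using assms(2) unfolding qsplits_def by auto
  have "qvnorm m (\<lambda>i. \<Sum>j<n. qmul (E i j + E' i j) (x j)) \<le> (\<delta> + \<delta>') * qvnorm n x" for x
    using qvnorm_triangle[of m "\<lambda>i. \<Sum>j<n. qmul (E i j) (x j)" "\<lambda>i. \<Sum>j<n. qmul (E' i j) (x j)"]
      E[of x] E'[of x]
    by (simp add: qmul_add_left sum.distrib distrib_right)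
  moreover have "A i j + A' i j = (\<Sum>k<K+K'. qmul (if k < K then u k i else u' (k - K) i)
         (if k < K then v k j else v' (k - K) j)) + (E i j + E' i j)" if "i < m" "j < n" for i j
  proof -
    have "(\<Sum>k<K+K'. qmul (if k < K then u k i else u' (k - K) i)
         (if k < K then v k j else v' (k - K) j)) =
       (\<Sum>k<K+K'. if k < K then qmul (u k i) (v k j) else qmul (u' (k - K) i) (v' (k - K) j))"
      by (intro sum.cong) auto
    also have "\<dots> = (\<Sum>k<K. qmul (u k i) (v k j)) + (\<Sum>k<K'. qmul (u' k i) (v' k j))"
      by (rule sum_split_lessThan_add)
    finally show ?thesis by (simp add: A[OF that] A'[OF that])
  qed
  ultimately show ?thesis using K K' unfolding qsplits_def
    by (intro exI[of _ "K + K'"] exI[of _ "\<lambda>k i. if k < K then u k i else u' (k - K) i"]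
        exI[of _ "\<lambda>k j. if k < K then v k j else v' (k - K) j"]
        exI[of _ "\<lambda>i j. E i j + E' i j"]) auto
qed

lemma qsplits_zero: "qsplits m n (\<lambda>i j. 0) 0 0"
  unfolding qsplits_def
  by (intro exI[of _ 0] exI[of _ "\<lambda>i j. 0"]) (simp add: qvnorm_def)

lemma qsplits_sum:
  assumes "\<And>a. a \<in> A \<Longrightarrow> qsplits m n (X a) r \<delta>"
  shows "qsplits m n (\<lambda>i j. \<Sum>a\<in>A. X a i j) (real (card A) * r) (real (card A) * \<delta>)"
  using assms
proof (induction A rule: infinite_finite_induct)
  case (insert a A)
  have "qsplits m n (\<lambda>i j. X a i j + (\<Sum>a\<in>A. X a i j)) (r + real (card A) * r) (\<delta> + real (card A) * \<delta>)"
    using insert by (intro qsplits_add) auto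
  then show ?case using insert.hyps by (simp add: distrib_right)
qed (simp_all add: qsplits_zero)

section \<open>Splittings of complex matrices and their lift to quaternion matrices\<close>

definition csplits :: "'a set \<Rightarrow> ('a \<Rightarrow> 'a \<Rightarrow> complex) \<Rightarrow> real \<Rightarrow> real \<Rightarrow> bool" where
  "csplits A X r \<delta> \<longleftrightarrow> (\<exists>(K::nat) u v E. real K \<le> r
     \<and> (\<forall>\<alpha>\<in>A. \<forall>\<beta>\<in>A. X \<alpha> \<beta> = (\<Sum>k<K. u k \<alpha> * v k \<beta>) + E \<alpha> \<beta>)
     \<and> (\<forall>x. L2_set (\<lambda>\<alpha>. cmod (\<Sum>\<beta>\<in>A. E \<alpha> \<beta> * x \<beta>)) A \<le> \<delta> * L2_set (\<lambda>\<beta>. cmod (x \<beta>)) A))"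

lemma csplits_add:
  assumes "csplits A X r \<delta>" "csplits A X' r' \<delta>'"
  shows "csplits A (\<lambda>i j. X i j + X' i j) (r + r') (\<delta> + \<delta>')"
proof -
  obtain K :: nat and u v E where K: "real K \<le> r"
    and A: "\<And>i j. i \<in> A \<Longrightarrow> j \<in> A \<Longrightarrow> X i j = (\<Sum>k<K. u k i * v k j) + E i j"
    and E: "\<And>x. L2_set (\<lambda>\<alpha>. cmod (\<Sum>\<beta>\<in>A. E \<alpha> \<beta> * x \<beta>)) A \<le> \<delta> * L2_set (\<lambda>\<beta>. cmod (x \<beta>)) A"
    using assms(1) unfolding csplits_def by auto
  obtain K' :: nat and u' v' E' where K': "real K' \<le> r'"
    and A': "\<And>i j. i \<in> A \<Longrightarrow> j \<in> A \<Longrightarrow> X' i j = (\<Sum>k<K'. u' k i * v' k j) + E' i j"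
    and E': "\<And>x. L2_set (\<lambda>\<alpha>. cmod (\<Sum>\<beta>\<in>A. E' \<alpha> \<beta> * x \<beta>)) A \<le> \<delta>' * L2_set (\<lambda>\<beta>. cmod (x \<beta>)) A"
    using assms(2) unfolding csplits_def by auto
  have "L2_set (\<lambda>\<alpha>. cmod (\<Sum>\<beta>\<in>A. (E \<alpha> \<beta> + E' \<alpha> \<beta>) * x \<beta>)) A
          \<le> (\<delta> + \<delta>') * L2_set (\<lambda>\<beta>. cmod (x \<beta>)) A" for x
  proof -
    have "L2_set (\<lambda>\<alpha>. cmod (\<Sum>\<beta>\<in>A. (E \<alpha> \<beta> + E' \<alpha> \<beta>) * x \<beta>)) A \<le>
      L2_set (\<lambda>\<alpha>. cmod (\<Sum>\<beta>\<in>A. E \<alpha> \<beta> * x \<beta>) + cmod (\<Sum>\<beta>\<in>A. E' \<alpha> \<beta> * x \<beta>)) A"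
      unfolding distrib_right sum.distrib by (intro L2_set_mono norm_triangle_ineq) auto
    also have "\<dots> \<le> L2_set (\<lambda>\<alpha>. cmod (\<Sum>\<beta>\<in>A. E \<alpha> \<beta> * x \<beta>)) A + L2_set (\<lambda>\<alpha>. cmod (\<Sum>\<beta>\<in>A. E' \<alpha> \<beta> * x \<beta>)) A"
      by (rule L2_set_triangle_ineq)
    finally show ?thesis using E[of x] E'[of x] by (simp add: distrib_right)
  qed
  moreover have "X i j + X' i j = (\<Sum>k<K+K'. (if k < K then u k i else u' (k - K) i) *
         (if k < K then v k j else v' (k - K) j)) + (E i j + E' i j)" if "i \<in> A" "j \<in> A" for i j
  proof -
    have "(\<Sum>k<K+K'. (if k < K then u k i else u' (k - K) i) *
         (if k < K then v k j else v' (k - K) j)) =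
       (\<Sum>k<K+K'. if k < K then u k i * v k j else u' (k - K) i * v' (k - K) j)"
      by (intro sum.cong) auto
    also have "\<dots> = (\<Sum>k<K. u k i * v k j) + (\<Sum>k<K'. u' k i * v' k j)"
      by (rule sum_split_lessThan_add)
    finally show ?thesis by (simp add: A[OF that] A'[OF that])
  qed
  ultimately show ?thesis using K K' unfolding csplits_def
    by (intro exI[of _ "K + K'"] exI[of _ "\<lambda>k i. if k < K then u k i else u' (k - K) i"]
        exI[of _ "\<lambda>k j. if k < K then v k j else v' (k - K) j"]
        exI[of _ "\<lambda>i j. E i j + E' i j"]) auto
qed

lemma csplits_mono:
  assumes "csplits A X r \<delta>" "r \<le> r'" "\<delta> \<le> \<delta>'"
  shows "csplits A X r' \<delta>'"
proof -
  have "\<delta> * L2_set f A \<le> \<delta>' * L2_set f A" for f :: "'a \<Rightarrow> real"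
    using assms(3) by (intro mult_right_mono) (auto simp: L2_set_def sum_nonneg)
  moreover obtain K :: nat and u v E where "real K \<le> r"
    "\<forall>\<alpha>\<in>A. \<forall>\<beta>\<in>A. X \<alpha> \<beta> = (\<Sum>k<K. u k \<alpha> * v k \<beta>) + E \<alpha> \<beta>"
    "\<And>x. L2_set (\<lambda>\<alpha>. cmod (\<Sum>\<beta>\<in>A. E \<alpha> \<beta> * x \<beta>)) A \<le> \<delta> * L2_set (\<lambda>\<beta>. cmod (x \<beta>)) A"
    using assms(1) unfolding csplits_def by blast
  ultimately show ?thesis using assms(2) unfolding csplits_def
    by (rule_tac exI[of _ K], rule_tac exI[of _ u], rule_tac exI[of _ v], rule_tac exI[of _ E])
      (meson order_trans)
qed

lemma csplits_sum_rank_one: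
  assumes "finite I" "\<And>\<alpha> \<beta>. \<alpha> \<in> A \<Longrightarrow> \<beta> \<in> A \<Longrightarrow> X \<alpha> \<beta> = (\<Sum>k\<in>I. u k \<alpha> * v k \<beta>) + E \<alpha> \<beta>"
    and "\<And>x. L2_set (\<lambda>\<alpha>. cmod (\<Sum>\<beta>\<in>A. E \<alpha> \<beta> * x \<beta>)) A \<le> \<delta> * L2_set (\<lambda>\<beta>. cmod (x \<beta>)) A"
  shows "csplits A X (real (card I)) \<delta>"
proof -
  obtain h where h: "bij_betw h {..<card I} I"
    using ex_bij_betw_nat_finite[OF assms(1)] by (auto simp: atLeast0LessThan)
  have "(\<Sum>k\<in>I. u k \<alpha> * v k \<beta>) = (\<Sum>k<card I. u (h k) \<alpha> * v (h k) \<beta>)" for \<alpha> \<beta>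
    using sum.reindex_bij_betw[OF h, of "\<lambda>k. u k \<alpha> * v k \<beta>"] by simp
  then show ?thesis unfolding csplits_def using assms(2,3)
    by (intro exI[of _ "card I"] exI[of _ "\<lambda>k. u (h k)"] exI[of _ "\<lambda>k. v (h k)"] exI[of _ E]) auto
qed

lemma sum_mod_eq:
  fixes g :: "nat \<Rightarrow> 'b::comm_monoid_add"
  assumes "a < s"
  shows "(\<Sum>i<N * s. if i mod s = a then g i else 0) = (\<Sum>I<N. g (I * s+a))"
proof -
  have "(\<Sum>i<N * s. if i mod s = a then g i else 0) = (\<Sum>i\<in>{i\<in>{..<N * s}. i mod s = a}. g i)"
    by (rule sum.inter_filter[symmetric]) simp
  also have "\<dots> = (\<Sum>I<N. g (I * s+a))"
  proof (rule sum.reindex_bij_witness[of _ "\<lambda>I. I * s+a" "\<lambda>i. i div s"])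
    fix I assume "I \<in> {..<N}"
    then have "I * s + a < I * s + s" "I * s + s \<le> N * s"
      using assms mult_le_mono1[of "Suc I" N s] by auto
    then have "I * s + a < N * s" by linarith
    then show "I * s+a \<in> {i \<in> {..<N * s}. i mod s = a}" using assms by auto
  next
    fix i assume "i \<in> {i \<in> {..<N * s}. i mod s = a}"
    then show "i div s \<in> {..<N}" by (auto simp: less_mult_imp_div_less)
  qed (use assms in auto)
  finally show ?thesis .
qed

lemma L2_set_le_imp_sum_squares:
  assumes "L2_set f A \<le> \<delta> * L2_set g B"
  shows "(\<Sum>x\<in>A. (f x)\<^sup>2) \<le> \<delta>\<^sup>2 * (\<Sum>x\<in>B. (g x)\<^sup>2)"
proof -
  have "(L2_set f A)\<^sup>2 \<le> (\<delta> * L2_set g B)\<^sup>2"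
    using assms by (intro power_mono) (auto simp: L2_set_def sum_nonneg)
  then show ?thesis by (simp add: L2_set_def power_mult_distrib sum_nonneg)
qed

text \<open>The scalar matrix is placed at position (a, b) of every block. Its complex entries act
  on the components \<open>q1\<close> and \<open>q2\<close> of \<open>h\<close> times the vector
  separately, each with the complex bound, and \<open>h\<close> of norm one preserves norms; so
  neither \<open>r\<close> nor \<open>\<delta>\<close> deteriorates. The bijection \<open>f\<close>
  replaces multi-indices by linear indices.\<close>

lemma csplits_imp_qsplits:
  assumes X: "csplits A X r \<delta>" and f: "bij_betw f {..<N} A"
    and ab: "a < s" "b < t" and h: "norm h = 1" and d0: "0 \<le> \<delta>"
  shows "qsplits (N * s) (N*t) (\<lambda>i j. if i mod s = a \<and> j mod t = b
           then qmul (qc (X (f (i div s)) (f (j div t)))) h else 0) r \<delta>"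
proof -
  obtain K :: nat and u v E where K: "real K \<le> r"
    and X: "\<And>i j. i \<in> A \<Longrightarrow> j \<in> A \<Longrightarrow> X i j = (\<Sum>k<K. u k i * v k j) + E i j"
    and E: "\<And>x. L2_set (\<lambda>\<alpha>. cmod (\<Sum>\<beta>\<in>A. E \<alpha> \<beta> * x \<beta>)) A \<le> \<delta> * L2_set (\<lambda>\<beta>. cmod (x \<beta>)) A"
    using X unfolding csplits_def by blast
  define u' where "u' k i = (if i mod s = a then qc (u k (f (i div s))) else 0)" for k i
  define v' where "v' k j = (if j mod t = b then qmul (qc (v k (f (j div t)))) h else 0)" for k j
  define E' where "E' i j = (if i mod s = a \<and> j mod t = b
           then qmul (qc (E (f (i div s)) (f (j div t)))) h else 0)" for i j
  have fA: "f (i div s') \<in> A" if "i < N * s'" for i s'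
    using bij_betwE[OF f] that by (auto simp: less_mult_imp_div_less)
  have 1: "(if i mod s = a \<and> j mod t = b then qmul (qc (X (f (i div s)) (f (j div t)))) h else 0)
      = (\<Sum>k<K. qmul (u' k i) (v' k j)) + E' i j" if "i < N * s" "j < N*t" for i j
  proof (cases "i mod s = a \<and> j mod t = b")
    case True
    have "qmul (qc (X (f (i div s)) (f (j div t)))) h =
      (\<Sum>k<K. qmul (qc (u k (f (i div s)))) (qmul (qc (v k (f (j div t)))) h)) + E' i j"
      using True by (simp add: X[OF fA[OF that(1)] fA[OF that(2)]] E'_def qc_add qc_sum qmul_add_left
          qmul_sum_left qc_mult qmul_assoc)
    then show ?thesis using True by (simp add: u'_def v'_def)
  qed (auto simp: u'_def v'_def E'_def intro!: sum.neutral)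
  have 2: "qvnorm (N * s) (\<lambda>i. \<Sum>j<N*t. qmul (E' i j) (x j)) \<le> \<delta> * qvnorm (N*t) x" for x
  proof -
    define y where "y J = qmul h (x (J*t+b))" for J
    define g where "g = the_inv_into {..<N} f"
    have gf: "g (f J) = J" if "J < N" for J
      unfolding g_def using f that by (simp add: bij_betw_def the_inv_into_f_f)
    define Y where "Y \<beta> = y (g \<beta>)" for \<beta>
    define Z where "Z \<alpha> = (\<Sum>\<beta>\<in>A. qmul (qc (E \<alpha> \<beta>)) (Y \<beta>))" for \<alpha>
    have in1: "(\<Sum>j<N*t. qmul (E' i j) (x j)) = (if i mod s = a then Z (f (i div s)) else 0)" for i
    proof (cases "i mod s = a")
      case True
      have "(\<Sum>j<N*t. qmul (E' i j) (x j)) =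
        (\<Sum>j<N*t. if j mod t = b then qmul (qc (E (f (i div s)) (f (j div t)))) (qmul h (x j)) else 0)"
        using True by (intro sum.cong) (auto simp: E'_def qmul_assoc)
      also have "\<dots> = (\<Sum>J<N. qmul (qc (E (f (i div s)) (f ((J*t+b) div t)))) (y J))"
        unfolding y_def by (rule sum_mod_eq[OF ab(2)])
      also have "\<dots> = (\<Sum>J<N. qmul (qc (E (f (i div s)) (f J))) (Y (f J)))"
        using ab(2) by (intro sum.cong) (auto simp: Y_def gf)
      also have "\<dots> = Z (f (i div s))"
        unfolding Z_def by (rule sum.reindex_bij_betw[OF f])
      finally show ?thesis using True by simp
    qed (simp add: E'_def)
    have "(\<Sum>i<N * s. (norm (\<Sum>j<N*t. qmul (E' i j) (x j)))\<^sup>2)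
        = (\<Sum>i<N * s. if i mod s = a then (norm (Z (f (i div s))))\<^sup>2 else 0)"
      unfolding in1 by (intro sum.cong) auto
    also have "\<dots> = (\<Sum>I<N. (norm (Z (f ((I * s+a) div s))))\<^sup>2)"
      by (rule sum_mod_eq[OF ab(1)])
    also have "\<dots> = (\<Sum>I<N. (norm (Z (f I)))\<^sup>2)"
      using ab(1) by (intro sum.cong) auto
    also have "\<dots> = (\<Sum>\<alpha>\<in>A. (norm (Z \<alpha>))\<^sup>2)"
      by (rule sum.reindex_bij_betw[OF f])
    also have "\<dots> = (\<Sum>\<alpha>\<in>A. (cmod (\<Sum>\<beta>\<in>A. E \<alpha> \<beta> * q1 (Y \<beta>)))\<^sup>2)
        + (\<Sum>\<alpha>\<in>A. (cmod (\<Sum>\<beta>\<in>A. E \<alpha> \<beta> * q2 (Y \<beta>)))\<^sup>2)"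
      unfolding norm_decomp Z_def by (simp add: q1_sum q2_sum q1_qmul_qc q2_qmul_qc sum.distrib)
    also have "\<dots> \<le> \<delta>\<^sup>2 * (\<Sum>\<beta>\<in>A. (cmod (q1 (Y \<beta>)))\<^sup>2) + \<delta>\<^sup>2 * (\<Sum>\<beta>\<in>A. (cmod (q2 (Y \<beta>)))\<^sup>2)"
      by (intro add_mono L2_set_le_imp_sum_squares E)
    also have "\<dots> = \<delta>\<^sup>2 * (\<Sum>\<beta>\<in>A. (norm (Y \<beta>))\<^sup>2)"
      unfolding norm_decomp by (simp add: sum.distrib algebra_simps)
    also have "(\<Sum>\<beta>\<in>A. (norm (Y \<beta>))\<^sup>2) = (\<Sum>J<N. (norm (Y (f J)))\<^sup>2)"
      by (rule sum.reindex_bij_betw[OF f, symmetric])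
    also have "\<dots> = (\<Sum>J<N. (norm (x (J*t+b)))\<^sup>2)"
      by (intro sum.cong) (auto simp: Y_def gf y_def norm_qmul h)
    also have "\<dots> = (\<Sum>j<N*t. if j mod t = b then (norm (x j))\<^sup>2 else 0)"
      by (rule sum_mod_eq[OF ab(2), symmetric])
    also have "\<delta>\<^sup>2 * \<dots> \<le> \<delta>\<^sup>2 * (\<Sum>j<N*t. (norm (x j))\<^sup>2)"
      by (intro mult_left_mono sum_mono) auto
    finally have "qvnorm (N * s) (\<lambda>i. \<Sum>j<N*t. qmul (E' i j) (x j)) \<le> sqrt (\<delta>\<^sup>2 * (\<Sum>j<N*t. (norm (x j))\<^sup>2))"
      unfolding qvnorm_def by (rule real_sqrt_le_mono)
    then show ?thesis using d0 by (simp add: qvnorm_def real_sqrt_mult)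
  qed
  show ?thesis unfolding qsplits_def
    by (rule exI[of _ K], rule exI[of _ u'], rule exI[of _ v'], rule exI[of _ E'])
      (use K 1 2 in blast)
qed

section \<open>Characters on multi-index grids\<close>

definition lam :: "nat \<Rightarrow> (nat \<Rightarrow> nat) \<Rightarrow> (nat \<Rightarrow> nat) set" where
  "lam d n = PiE {..<d} (\<lambda>l. {..<n l})"

lemma finite_lam [simp]: "finite (lam d n)"
  by (simp add: lam_def finite_PiE)

lemma card_lam: "card (lam d n) = Nsize d n"
  by (simp add: lam_def card_PiE Nsize_def)

lemma lamD: "\<alpha> \<in> lam d n \<Longrightarrow> l < d \<Longrightarrow> \<alpha> l < n l"
  by (auto simp: lam_def PiE_def Pi_def)

definition mi :: "nat \<Rightarrow> (nat \<Rightarrow> nat) \<Rightarrow> nat \<Rightarrow> nat \<Rightarrow> nat" where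
  "mi d n I = restrict (midx d n I) {..<d}"

lemma midx_Suc: "l < d \<Longrightarrow> midx (Suc d) n I l = midx d n (I div n d) l"
proof -
  assume l: "l < d"
  have "{l<..<Suc d} = insert d {l<..<d}" using l by auto
  then have "(\<Prod>k\<in>{l<..<Suc d}. n k) = n d * (\<Prod>k\<in>{l<..<d}. n k)" by simp
  then show ?thesis by (simp add: midx_def div_mult2_eq)
qed

lemma midx_last: "midx (Suc d) n I d = I mod n d"
proof -
  have "{d<..<Suc d} = {}" by auto
  then show ?thesis by (simp add: midx_def)
qed

lemma midx_inj:
  assumes "I < Nsize d n" "J < Nsize d n" "\<And>l. l < d \<Longrightarrow> midx d n I l = midx d n J l"
  shows "I = J"
  using assms
proof (induction d arbitrary: I J)
  case 0
  then show ?case by (simp add: Nsize_def)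
next
  case (Suc d)
  have "I mod n d = J mod n d" using Suc.prems(3)[of d] by (simp add: midx_last)
  moreover have "I div n d = J div n d"
  proof (rule Suc.IH)
    show "I div n d < Nsize d n" "J div n d < Nsize d n"
      using Suc.prems by (auto simp: Nsize_def less_mult_imp_div_less)
    show "midx d n (I div n d) l = midx d n (J div n d) l" if "l < d" for l
      using Suc.prems(3)[of l] that by (simp add: midx_Suc)
  qed
  ultimately show ?case by (metis div_mult_mod_eq)
qed

lemma bij_betw_mi:
  assumes "\<And>l. l < d \<Longrightarrow> 0 < n l"
  shows "bij_betw (mi d n) {..<Nsize d n} (lam d n)"
proof -
  have "inj_on (mi d n) {..<Nsize d n}"
  proof (rule inj_onI)
    fix I J assume "I \<in> {..<Nsize d n}" "J \<in> {..<Nsize d n}" and eq: "mi d n I = mi d n J"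
    moreover have "midx d n I l = midx d n J l" if "l < d" for l
      using fun_cong[OF eq, of l] that by (simp add: mi_def)
    ultimately show "I = J" by (intro midx_inj[of I d n J]) auto
  qed
  moreover have "mi d n ` {..<Nsize d n} \<subseteq> lam d n"
    using assms by (auto simp: mi_def lam_def midx_def simp del: restrict_apply intro!: restrict_PiE_iff[THEN iffD2])
  ultimately show ?thesis
    by (simp add: bij_betw_def card_image card_lam card_subset_eq)
qed

text \<open>The factor added last in \<open>mshift\<close> acts on the least significant digit of
  the linear index, which is also the last coordinate of \<open>midx\<close>; the induction
  therefore splits the index by \<open>div\<close> and \<open>mod\<close>.\<close>

lemma mshift_eq:
  "mshift n q d I J = (if \<forall>l<d. int (n l) dvd int (midx d n I l) - int (midx d n J l) - q l then 1 else 0)"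
proof (induction d arbitrary: I J)
  case 0
  show ?case unfolding mshift.simps by simp
next
  case (Suc d)
  show ?case
  proof -
    have iff: "(\<forall>l<Suc d. int (n l) dvd int (midx (Suc d) n I l) - int (midx (Suc d) n J l) - q l) \<longleftrightarrow>
      int (n d) dvd int (I mod n d) - int (J mod n d) - q d \<and>
      (\<forall>l<d. int (n l) dvd int (midx d n (I div n d) l) - int (midx d n (J div n d) l) - q l)"
      unfolding All_less_Suc by (simp add: midx_Suc midx_last)
    have if_conj: "(if P \<and> Q then 1 else 0) = (if Q then 1 else 0) * (if P then 1 else (0::real))" for P Q
      by simp
    have shift: "shiftP (n d) (q d) (I mod n d) (J mod n d) =
        (if int (n d) dvd int (I mod n d) - int (J mod n d) - q d then 1 else 0)"
      unfolding shiftP_def dvd_eq_mod_eq_0 ..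
    show ?thesis
      unfolding iff if_conj mshift.simps kron_rr_def Suc.IH shift ..
  qed
qed

lemma Nsize_pos: "(\<And>l. l < d \<Longrightarrow> 0 < n l) \<Longrightarrow> 0 < Nsize d n"
  by (simp add: Nsize_def prod_pos)

section \<open>Characters of the finite grid, orthogonality and Parseval\<close>

definition zc :: "nat \<Rightarrow> int \<Rightarrow> nat \<Rightarrow> complex" where
  "zc n q k = cis (2 * pi * real_of_int q * real k / real n)"

lemma zc_add: "zc n (p + q) k = zc n p k * zc n q k"
  by (simp add: zc_def cis_mult add_divide_distrib algebra_simps)

lemma zc_uminus: "zc n (- q) k = cnj (zc n q k)"
  by (simp add: zc_def cis_cnj)

lemma norm_zc [simp]: "cmod (zc n q k) = 1"
  by (simp add: zc_def)

lemma zc_0 [simp]: "zc n 0 k = 1"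
  by (simp add: zc_def)

lemma sum_zc:
  assumes "0 < n"
  shows "(\<Sum>k<n. zc n q k) = (if int n dvd q then of_nat n else 0)"
proof -
  define w where "w = cis (2 * pi * real_of_int q / real n)"
  have wk: "zc n q k = w ^ k" for k
    unfolding zc_def w_def Complex.DeMoivre by (rule arg_cong[of _ _ cis]) simp
  have "w ^ n = cis (2 * pi * real_of_int q)"
    using assms by (simp add: w_def Complex.DeMoivre)
  also have "\<dots> = 1" by (metis cis_multiple_2pi Ints_of_int)
  finally have wn: "w ^ n = 1" .
  have w1: "w = 1 \<longleftrightarrow> int n dvd q"
  proof
    assume "int n dvd q"
    then obtain m where "q = int n * m" by (elim dvdE)
    moreover have "cis (2 * pi * real_of_int m) = 1" by (metis cis_multiple_2pi Ints_of_int)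
    ultimately show "w = 1" using assms by (simp add: w_def mult.assoc)
  next
    assume "w = 1"
    then obtain m :: int where "2 * pi * real_of_int q / real n = of_int (2 * m) * pi"
      unfolding w_def cis_conv_exp exp_eq_1 by auto
    then have "real_of_int q = real_of_int (int n * m)"
      using assms pi_gt_zero by (simp add: field_simps)
    then have "q = int n * m" by linarith
    then show "int n dvd q" by simp
  qed
  show ?thesis
  proof (cases "w = 1")
    case True
    then show ?thesis using w1 by (simp add: wk)
  next
    case False
    then show ?thesis using w1 wn by (simp add: wk geometric_sum)
  qed
qed

definition zchr :: "nat \<Rightarrow> (nat \<Rightarrow> nat) \<Rightarrow> (nat \<Rightarrow> int) \<Rightarrow> (nat \<Rightarrow> nat) \<Rightarrow> complex" where
  "zchr d n q k = (\<Prod>l<d. zc (n l) (q l) (k l))"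

lemma zchr_add: "zchr d n (\<lambda>l. p l + q l) k = zchr d n p k * zchr d n q k"
  by (simp add: zchr_def zc_add prod.distrib)

lemma zchr_uminus: "zchr d n (\<lambda>l. - q l) k = cnj (zchr d n q k)"
  by (simp add: zchr_def zc_uminus)

lemma zchr_diff: "zchr d n (\<lambda>l. p l - q l) k = zchr d n p k * cnj (zchr d n q k)"
  using zchr_add[of d n p "\<lambda>l. - q l"] by (simp add: zchr_uminus)

lemma norm_zchr [simp]: "cmod (zchr d n q k) = 1"
  by (simp add: zchr_def prod_norm[symmetric])

text \<open>A character is symmetric in index and grid point, so \<open>grid_parseval\<close> serves
  for sums over frequencies as well as for sums over matrix indices.\<close>

lemma zchr_swap: "zchr d n (\<lambda>l. int (\<alpha> l)) k = zchr d n (\<lambda>l. int (k l)) \<alpha>"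
  by (simp add: zchr_def zc_def mult_ac)

lemma sum_zchr:
  assumes "\<And>l. l < d \<Longrightarrow> 0 < n l"
  shows "(\<Sum>k\<in>lam d n. zchr d n q k) = (if \<forall>l<d. int (n l) dvd q l then of_nat (Nsize d n) else 0)"
proof -
  have "(\<Sum>k\<in>lam d n. zchr d n q k) = (\<Prod>l<d. \<Sum>k<n l. zc (n l) (q l) k)"
    unfolding lam_def zchr_def by (rule prod_sum_PiE[symmetric]) auto
  also have "\<dots> = (\<Prod>l<d. if int (n l) dvd q l then of_nat (n l) else 0)"
    using assms by (intro prod.cong) (auto simp: sum_zc)
  also have "\<dots> = (if \<forall>l<d. int (n l) dvd q l then of_nat (Nsize d n) else 0)"
    by (auto simp: Nsize_def intro!: prod.cong prod_zero)
  finally show ?thesis .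
qed

lemma lam_eq_iff_dvd:
  assumes "\<alpha> \<in> lam d n" "\<beta> \<in> lam d n"
  shows "(\<forall>l<d. int (n l) dvd int (\<alpha> l) - int (\<beta> l)) \<longleftrightarrow> \<alpha> = \<beta>"
proof
  assume H: "\<forall>l<d. int (n l) dvd int (\<alpha> l) - int (\<beta> l)"
  have "\<alpha> l = \<beta> l" if "l < d" for l
  proof -
    have "\<bar>int (\<alpha> l) - int (\<beta> l)\<bar> < int (n l)"
      using lamD[OF assms(1) that] lamD[OF assms(2) that] by linarith
    then show ?thesis using H that dvd_imp_le_int[of "int (\<alpha> l) - int (\<beta> l)" "int (n l)"] by fastforce
  qed
  then show "\<alpha> = \<beta>" using assms unfolding lam_def by (intro PiE_ext) auto
qed simp

lemma grid_parseval:
  assumes n: "\<And>l. l < d \<Longrightarrow> 0 < n l"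
  shows "(\<Sum>k\<in>lam d n. (cmod (\<Sum>\<beta>\<in>lam d n. x \<beta> * zchr d n (\<lambda>l. int (\<beta> l)) k))\<^sup>2)
     = real (Nsize d n) * (\<Sum>\<beta>\<in>lam d n. (cmod (x \<beta>))\<^sup>2)"
proof -
  have "complex_of_real (\<Sum>k\<in>lam d n. (cmod (\<Sum>\<beta>\<in>lam d n. x \<beta> * zchr d n (\<lambda>l. int (\<beta> l)) k))\<^sup>2)
    = (\<Sum>k\<in>lam d n. \<Sum>\<beta>\<in>lam d n. \<Sum>\<gamma>\<in>lam d n.
         x \<beta> * cnj (x \<gamma>) * zchr d n (\<lambda>l. int (\<beta> l) - int (\<gamma> l)) k)"
    unfolding of_real_sum complex_norm_square zchr_diff
    by (simp add: sum_product mult_ac)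
  also have "\<dots> = (\<Sum>\<beta>\<in>lam d n. \<Sum>\<gamma>\<in>lam d n. x \<beta> * cnj (x \<gamma>) *
        (\<Sum>k\<in>lam d n. zchr d n (\<lambda>l. int (\<beta> l) - int (\<gamma> l)) k))"
    unfolding sum_distrib_left
    by (rule trans[OF sum.swap sum.cong[OF refl sum.swap]])
  also have "\<dots> = (\<Sum>\<beta>\<in>lam d n. \<Sum>\<gamma>\<in>lam d n. if \<beta> = \<gamma> then x \<beta> * cnj (x \<gamma>) * of_nat (Nsize d n) else 0)"
    by (intro sum.cong refl) (simp add: sum_zchr[OF n] lam_eq_iff_dvd)
  also have "\<dots> = (\<Sum>\<beta>\<in>lam d n. x \<beta> * cnj (x \<beta>) * of_nat (Nsize d n))"
    by (simp add: sum.delta)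
  also have "\<dots> = complex_of_real (real (Nsize d n) * (\<Sum>\<beta>\<in>lam d n. (cmod (x \<beta>))\<^sup>2))"
    unfolding of_real_mult of_real_sum complex_norm_square sum_distrib_left
    by (intro sum.cong refl) (simp add: mult_ac)
  finally show ?thesis by (simp only: of_real_eq_iff)
qed

lemma lam_mono: "(\<And>l. l < d \<Longrightarrow> n l \<le> m l) \<Longrightarrow> lam d n \<subseteq> lam d m"
  unfolding lam_def by (intro PiE_mono) auto

text \<open>\<open>X\<close> is the section on \<open>lam d n\<close> of a circulant of size
  \<open>M\<close> with eigenvalues \<open>w k\<close>. Each eigenvalue above
  \<open>\<delta>\<close> is split off as one rank-one term. For the others, a vector is extended by
  zero to \<open>lam d M\<close>, Parseval is used twice, and restricting to the rows in
  \<open>lam d n\<close> only decreases the norm.\<close>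

lemma csplits_diag:
  assumes nM: "\<And>l. l < d \<Longrightarrow> 0 < n l" "\<And>l. l < d \<Longrightarrow> n l \<le> M l" and d0: "0 \<le> \<delta>"
    and X: "\<And>\<alpha> \<beta>. \<alpha> \<in> lam d n \<Longrightarrow> \<beta> \<in> lam d n \<Longrightarrow>
      X \<alpha> \<beta> = (\<Sum>k\<in>lam d M. w k * zchr d M (\<lambda>l. int (\<beta> l) - int (\<alpha> l)) k) / of_nat (Nsize d M)"
  shows "csplits (lam d n) X (real (card {k\<in>lam d M. \<delta> < cmod (w k)})) \<delta>"
proof -
  have M: "0 < M l" if "l < d" for l using nM[OF that] by linarith
  define Nm where "Nm = Nsize d M"
  have Nm: "0 < Nm" using M by (simp add: Nm_def Nsize_pos)
  define G where "G = {k\<in>lam d M. \<delta> < cmod (w k)}"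
  define w' where "w' k = (if k \<in> G then 0 else w k)" for k
  have w': "cmod (w' k) \<le> \<delta>" if "k \<in> lam d M" for k
    using that d0 by (auto simp: w'_def G_def)
  define e where "e \<beta> k = zchr d M (\<lambda>l. int (\<beta> l)) k" for \<beta> k
  define E where "E \<alpha> \<beta> = (\<Sum>k\<in>lam d M. w' k * (e \<beta> k * cnj (e \<alpha> k))) / of_nat Nm" for \<alpha> \<beta>
  show ?thesis unfolding G_def[symmetric]
  proof (rule csplits_sum_rank_one)
    show "finite G" by (simp add: G_def)
  next
    fix \<alpha> \<beta> assume ab: "\<alpha> \<in> lam d n" "\<beta> \<in> lam d n"
    have "X \<alpha> \<beta> = (\<Sum>k\<in>lam d M. w k * (e \<beta> k * cnj (e \<alpha> k))) / of_nat Nm"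
      by (simp add: X[OF ab] Nm_def zchr_diff e_def)
    also have "(\<Sum>k\<in>lam d M. w k * (e \<beta> k * cnj (e \<alpha> k))) =
       (\<Sum>k\<in>lam d M. (if k \<in> G then w k * (e \<beta> k * cnj (e \<alpha> k)) else 0) + w' k * (e \<beta> k * cnj (e \<alpha> k)))"
      by (intro sum.cong) (auto simp: w'_def)
    also have "\<dots> = (\<Sum>k\<in>G. w k * (e \<beta> k * cnj (e \<alpha> k))) + (\<Sum>k\<in>lam d M. w' k * (e \<beta> k * cnj (e \<alpha> k)))"
    proof -
      have "lam d M \<inter> G = G" by (auto simp: G_def)
      then show ?thesis by (simp add: sum.distrib sum.inter_restrict[symmetric])
    qed
    also have "\<dots> / of_nat Nm = (\<Sum>k\<in>G. (w k * cnj (e \<alpha> k) / of_nat Nm) * e \<beta> k) + E \<alpha> \<beta>"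
      by (simp add: E_def add_divide_distrib sum_divide_distrib mult_ac)
    finally show "X \<alpha> \<beta> = (\<Sum>k\<in>G. (w k * cnj (e \<alpha> k) / of_nat Nm) * e \<beta> k) + E \<alpha> \<beta>" .
  next
    fix x :: "(nat \<Rightarrow> nat) \<Rightarrow> complex"
    have sub: "lam d n \<subseteq> lam d M" using nM by (intro lam_mono) auto
    define x' where "x' \<beta> = (if \<beta> \<in> lam d n then x \<beta> else 0)" for \<beta>
    define y where "y k = (\<Sum>\<beta>\<in>lam d M. x' \<beta> * e \<beta> k)" for k
    have yx: "(\<Sum>\<beta>\<in>lam d n. e \<beta> k * x \<beta>) = y k" for k
      unfolding y_def x'_def using sub
      by (intro sum.mono_neutral_cong_left) (auto simp: mult_ac)
    \<comment> \<open>Conjugation turns the conjugate characters of the row index into characters,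
      the form that \<open>grid_parseval\<close> accepts; moduli are not affected.\<close>
    define z where "z k = cnj (w' k * y k)" for k
    have Ex: "(\<Sum>\<beta>\<in>lam d n. E \<alpha> \<beta> * x \<beta>) = cnj (\<Sum>k\<in>lam d M. z k * zchr d M (\<lambda>l. int (k l)) \<alpha>) / of_nat Nm" for \<alpha>
    proof -
      have "(\<Sum>\<beta>\<in>lam d n. E \<alpha> \<beta> * x \<beta>) =
         (\<Sum>\<beta>\<in>lam d n. \<Sum>k\<in>lam d M. w' k * cnj (e \<alpha> k) * (e \<beta> k * x \<beta>)) / of_nat Nm"
        unfolding E_def sum_divide_distrib sum_distrib_right
        by (intro sum.cong refl) (simp add: mult_ac)
      also have "\<dots> = (\<Sum>k\<in>lam d M. w' k * cnj (e \<alpha> k) * y k) / of_nat Nm"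
        by (subst sum.swap) (simp add: sum_distrib_left[symmetric] yx)
      finally show ?thesis
        by (simp add: z_def e_def zchr_swap[of d M \<alpha>] mult_ac)
    qed
    have "(\<Sum>\<alpha>\<in>lam d n. (cmod (\<Sum>\<beta>\<in>lam d n. E \<alpha> \<beta> * x \<beta>))\<^sup>2)
       \<le> (\<Sum>\<alpha>\<in>lam d M. (cmod (\<Sum>\<beta>\<in>lam d n. E \<alpha> \<beta> * x \<beta>))\<^sup>2)"
      using sub by (intro sum_mono2) auto
    also have "\<dots> = (\<Sum>\<alpha>\<in>lam d M. (cmod (\<Sum>k\<in>lam d M. z k * zchr d M (\<lambda>l. int (k l)) \<alpha>))\<^sup>2) / (real Nm)\<^sup>2"
      unfolding Ex by (simp add: norm_divide power_divide sum_divide_distrib del: cnj_sum complex_cnj_mult)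
    also have "\<dots> = (\<Sum>k\<in>lam d M. (cmod (z k))\<^sup>2) / real Nm"
      by (subst grid_parseval) (use M Nm in \<open>auto simp: Nm_def power2_eq_square\<close>)
    also have "\<dots> \<le> (\<Sum>k\<in>lam d M. \<delta>\<^sup>2 * (cmod (y k))\<^sup>2) / real Nm"
      using w' by (intro divide_right_mono sum_mono)
        (auto simp: z_def norm_mult power_mult_distrib intro!: mult_right_mono power_mono)
    also have "\<dots> = \<delta>\<^sup>2 * (\<Sum>\<beta>\<in>lam d M. (cmod (x' \<beta>))\<^sup>2)"
      unfolding sum_distrib_left[symmetric] y_def e_def
      by (subst grid_parseval) (use M Nm in \<open>auto simp: Nm_def\<close>)
    also have "(\<Sum>\<beta>\<in>lam d M. (cmod (x' \<beta>))\<^sup>2) = (\<Sum>\<beta>\<in>lam d n. (cmod (x \<beta>))\<^sup>2)"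
      unfolding x'_def using sub by (intro sum.mono_neutral_cong_right) auto
    finally have "L2_set (\<lambda>\<alpha>. cmod (\<Sum>\<beta>\<in>lam d n. E \<alpha> \<beta> * x \<beta>)) (lam d n)
        \<le> sqrt (\<delta>\<^sup>2 * (\<Sum>\<beta>\<in>lam d n. (cmod (x \<beta>))\<^sup>2))"
      unfolding L2_set_def by (rule real_sqrt_le_mono)
    then show "L2_set (\<lambda>\<alpha>. cmod (\<Sum>\<beta>\<in>lam d n. E \<alpha> \<beta> * x \<beta>)) (lam d n) \<le> \<delta> * L2_set (\<lambda>\<beta>. cmod (x \<beta>)) (lam d n)"
      using d0 by (simp add: L2_set_def real_sqrt_mult)
  qed
qed

section \<open>A discrete Kolmogorov inequality\<close>

lemma zc_power: "zc m 1 j ^ k = zc m (int k) j"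
  by (simp add: zc_def Complex.DeMoivre mult_ac)

text \<open>A discrete mean value property. The average over the m-th roots of unity kills the
  powers with exponents from 1 to m - 1 exactly, so the error is at most the tail of the power
  series from degree m on, which is absolutely convergent at radius \<open>r\<close>. Discrete
  averages can later be compared with grid sums point by point.\<close>

lemma roots_mean_tendsto:
  assumes H: "H holomorphic_on ball 0 1" and r: "0 \<le> r" "r < 1"
  shows "(\<lambda>m. (\<Sum>j<m. H (of_real r * zc m 1 j)) / of_nat m) \<longlonglongrightarrow> H 0"
proof -
  define a where "a n = (deriv ^^ n) H 0 / fact n" for n
  have ser: "(\<lambda>n. a n * w ^ n) sums H w" if "cmod w < 1" for w
    using holomorphic_power_series[OF H, of w] that by (simp add: a_def)
  have a0: "a 0 = H 0" by (simp add: a_def)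
  define r' where "r' = (1 + r) / 2"
  have r': "r < r'" "r' < 1" "0 < r'" using r by (auto simp: r'_def)
  have "summable (\<lambda>n. a n * of_real r' ^ n)"
    using ser[of "of_real r'"] r' by (simp add: sums_iff)
  then have "summable (\<lambda>n. norm (a n * of_real r ^ n))"
    by (rule powser_insidea) (use r r' in simp)
  then have summ: "summable (\<lambda>n. cmod (a n) * r ^ n)"
    using r by (simp add: norm_mult norm_power)
  define T where "T m = (\<Sum>n. cmod (a (n + m)) * r ^ (n + m))" for m
  have T: "T \<longlonglongrightarrow> 0"
    unfolding T_def using suminf_exist_split2[OF summ] .
  have bound: "cmod (H z - (\<Sum>n<m. a n * z ^ n)) \<le> T m" if z: "cmod z = r" for z m
  proof -
    have "(\<lambda>n. a (n + m) * z ^ (n + m)) sums (H z - (\<Sum>n<m. a n * z ^ n))"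
      using ser[of z] z r by (intro sums_split_initial_segment) auto
    moreover have "summable (\<lambda>n. norm (a (n + m) * z ^ (n + m)))"
      using summable_ignore_initial_segment[OF summ, of m] z by (simp add: norm_mult norm_power)
    ultimately have "cmod (H z - (\<Sum>n<m. a n * z ^ n)) \<le> (\<Sum>n. norm (a (n + m) * z ^ (n + m)))"
      using summable_norm[of "\<lambda>n. a (n + m) * z ^ (n + m)"] by (simp add: sums_iff)
    then show ?thesis using z by (simp add: T_def norm_mult norm_power)
  qed
  have "cmod ((\<Sum>j<m. H (of_real r * zc m 1 j)) / of_nat m - H 0) \<le> T m" if m: "0 < m" for m
  proof -
    define P where "P z = (\<Sum>n<m. a n * z ^ n)" for z
    have "(\<Sum>j<m. P (of_real r * zc m 1 j)) = (\<Sum>n<m. a n * of_real r ^ n * (\<Sum>j<m. zc m (int n) j))"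
      unfolding P_def by (subst sum.swap) (simp add: power_mult_distrib zc_power sum_distrib_left mult_ac)
    also have "\<dots> = (\<Sum>n<m. if n = 0 then a 0 * of_nat m else 0)"
      using m by (intro sum.cong) (auto simp: sum_zc dvd_imp_le)
    also have "\<dots> = a 0 * of_nat m" using m by (simp add: sum.delta)
    finally have P: "(\<Sum>j<m. P (of_real r * zc m 1 j)) = H 0 * of_nat m" by (simp add: a0)
    have "(\<Sum>j<m. H (of_real r * zc m 1 j)) / of_nat m - H 0
      = (\<Sum>j<m. H (of_real r * zc m 1 j) - P (of_real r * zc m 1 j)) / of_nat m"
      using m by (simp add: sum_subtractf P diff_divide_distrib)
    also have "cmod \<dots> \<le> (\<Sum>j<m. T m) / real m"
      unfolding norm_divide norm_of_nat P_def using r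
      by (intro divide_right_mono sum_norm_le bound) (auto simp: norm_mult)
    finally show ?thesis using m by simp
  qed
  then have "\<forall>\<^sub>F m in sequentially. cmod ((\<Sum>j<m. H (of_real r * zc m 1 j)) / of_nat m - H 0) \<le> T m"
    by (intro eventually_sequentiallyI[of 1]) auto
  then have "(\<lambda>m. (\<Sum>j<m. H (of_real r * zc m 1 j)) / of_nat m - H 0) \<longlonglongrightarrow> 0"
    by (rule Lim_null_comparison[OF _ T])
  then show ?thesis by (simp add: LIM_zero_iff)
qed

text \<open>Cauchy transform of the measure with mass \<open>u k / n\<close> at the k-th grid point
  of the unit circle. Its Taylor coefficients are the discrete Fourier coefficients of
  \<open>u\<close> at nonnegative frequencies.\<close>

definition cauchy_tr :: "nat \<Rightarrow> (nat \<Rightarrow> complex) \<Rightarrow> complex \<Rightarrow> complex" where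
  "cauchy_tr n u z = (\<Sum>k<n. u k / (1 - z * zc n (-1) k)) / of_nat n"

lemma Re_Cauchy_kernel_pos:
  assumes "cmod w < 1"
  shows "0 < Re (1 / (1 - w))"
proof -
  have "Re w < 1" using complex_Re_le_cmod[of w] assms by linarith
  moreover have "1 - w \<noteq> 0" using assms by auto
  ultimately show ?thesis by (simp add: Re_divide' cmod_def complex_eq_iff sum_power2_gt_zero_iff)
qed

text \<open>In the right half-plane the root has an argument of modulus at most pi/4, where the
  cosine is at least 1 / sqrt 2.\<close>

lemma sqrt_cmod_le_Re_csqrt:
  assumes "0 \<le> Re w"
  shows "sqrt (cmod w) \<le> sqrt 2 * Re (csqrt w)"
proof -
  have "Re (csqrt w) = sqrt ((cmod w + Re w) / 2)" by simp
  then have "sqrt 2 * Re (csqrt w) = sqrt (cmod w + Re w)"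
    by (simp add: real_sqrt_mult[symmetric] del: csqrt.sel)
  then show ?thesis using assms by simp
qed

text \<open>Kolmogorov's argument. The bound does not depend on \<open>r\<close>, which may thus be
  taken as close to 1 as the length of a partial sum requires; \<open>\<epsilon>\<close> pays for
  averaging over finitely many points.\<close>

lemma cauchy_tr_pos_mean:
  fixes u :: "nat \<Rightarrow> real"
  assumes n: "0 < n" and u: "\<And>k. k < n \<Longrightarrow> 0 \<le> u k" and r: "0 \<le> r" "r < 1" and e: "0 < \<epsilon>"
  shows "\<forall>\<^sub>F m in sequentially.
    (\<Sum>j<m. sqrt (cmod (cauchy_tr n (\<lambda>k. of_real (u k)) (of_real r * zc m 1 j)))) / real m
      \<le> sqrt 2 * sqrt ((\<Sum>k<n. u k) / real n) + \<epsilon>"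
proof (cases "\<exists>k<n. u k \<noteq> 0")
  \<comment> \<open>A vanishing \<open>u\<close> is set apart: its transform is 0, where
    \<open>csqrt\<close> is not holomorphic. A single positive value makes the real part strictly
    positive.\<close>
  case False
  then have "cauchy_tr n (\<lambda>k. of_real (u k)) z = 0" for z by (simp add: cauchy_tr_def)
  moreover have "(\<Sum>k<n. u k) = 0" using False by simp
  ultimately show ?thesis using e by simp
next
  case True
  then obtain k0 where k0: "k0 < n" "u k0 > 0" using u by force
  define F where "F = cauchy_tr n (\<lambda>k. of_real (u k))"
  have nz: "cmod (z * zc n (-1) k) < 1" if "cmod z < 1" for z k using that by (simp add: norm_mult)
  have nz': "1 - z * zc n (-1) k \<noteq> 0" if "cmod z < 1" for z k using nz[OF that, of k] by auto
  have Fpos: "0 < Re (F z)" if z: "cmod z < 1" for z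
  proof -
    have "Re (complex_of_real x / w) = x * Re (1 / w)" for x w
      by (simp add: Re_divide)
    then have "Re (F z) = (\<Sum>k<n. u k * Re (1 / (1 - z * zc n (-1) k))) / real n"
      by (simp only: F_def cauchy_tr_def Re_divide_of_nat Re_sum)
    also have "\<dots> > 0"
    proof (intro divide_pos_pos sum_pos2[of _ k0])
      show "0 < u k0 * Re (1 / (1 - z * zc n (- 1) k0))"
        using k0 Re_Cauchy_kernel_pos[OF nz[OF z]] by (intro mult_pos_pos)
      show "0 \<le> u i * Re (1 / (1 - z * zc n (- 1) i))" if "i \<in> {..<n}" for i
        using u[of i] that Re_Cauchy_kernel_pos[OF nz[OF z, of i]] by (intro mult_nonneg_nonneg) auto
    qed (use k0 n in auto)
    finally show ?thesis .
  qed
  have Fhol: "F holomorphic_on ball 0 1"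
    unfolding F_def cauchy_tr_def using nz' n by (intro holomorphic_intros) auto
  have "(\<lambda>z. csqrt (F z)) holomorphic_on ball 0 1"
    using Fpos by (intro holomorphic_on_csqrt' Fhol) (force simp: complex_nonpos_Reals_iff)
  then have "(\<lambda>m. (\<Sum>j<m. csqrt (F (of_real r * zc m 1 j))) / of_nat m) \<longlonglongrightarrow> csqrt (F 0)"
    by (rule roots_mean_tendsto[OF _ r])
  then have "(\<lambda>m. Re ((\<Sum>j<m. csqrt (F (of_real r * zc m 1 j))) / of_nat m)) \<longlonglongrightarrow> Re (csqrt (F 0))"
    by (rule tendsto_Re)
  moreover have "Re (csqrt (F 0)) = sqrt ((\<Sum>k<n. u k) / real n)"
  proof -
    have "F 0 = of_real ((\<Sum>k<n. u k) / real n)" by (simp add: F_def cauchy_tr_def)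
    moreover have "0 \<le> (\<Sum>k<n. u k) / real n" using u by (intro divide_nonneg_nonneg sum_nonneg) auto
    ultimately show ?thesis by (simp only: of_real_sqrt[symmetric] Re_complex_of_real)
  qed
  ultimately have lim: "(\<lambda>m. Re ((\<Sum>j<m. csqrt (F (of_real r * zc m 1 j))) / of_nat m)) \<longlonglongrightarrow>
      sqrt ((\<Sum>k<n. u k) / real n)" by simp
  have "\<forall>\<^sub>F m in sequentially. Re ((\<Sum>j<m. csqrt (F (of_real r * zc m 1 j))) / of_nat m)
      < sqrt ((\<Sum>k<n. u k) / real n) + \<epsilon> / sqrt 2"
    using e by (intro order_tendstoD[OF lim]) simp
  then show ?thesis
  proof (rule eventually_mono)
    fix m assume *: "Re ((\<Sum>j<m. csqrt (F (of_real r * zc m 1 j))) / of_nat m)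
      < sqrt ((\<Sum>k<n. u k) / real n) + \<epsilon> / sqrt 2"
    have "(\<Sum>j<m. sqrt (cmod (F (of_real r * zc m 1 j)))) \<le> (\<Sum>j<m. sqrt 2 * Re (csqrt (F (of_real r * zc m 1 j))))"
      using r by (intro sum_mono sqrt_cmod_le_Re_csqrt less_imp_le Fpos) (auto simp: norm_mult)
    then have "(\<Sum>j<m. sqrt (cmod (F (of_real r * zc m 1 j)))) / real m
        \<le> (\<Sum>j<m. sqrt 2 * Re (csqrt (F (of_real r * zc m 1 j)))) / real m"
      by (rule divide_right_mono) simp
    also have "\<dots> = sqrt 2 * Re ((\<Sum>j<m. csqrt (F (of_real r * zc m 1 j))) / of_nat m)"
      by (simp add: sum_distrib_left Re_divide_of_nat del: csqrt.sel)
    also have "\<dots> \<le> sqrt 2 * (sqrt ((\<Sum>k<n. u k) / real n) + \<epsilon> / sqrt 2)"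
      using * by (intro mult_left_mono) auto
    finally show "(\<Sum>j<m. sqrt (cmod (cauchy_tr n (\<lambda>k. of_real (u k)) (of_real r * zc m 1 j)))) / real m
      \<le> sqrt 2 * sqrt ((\<Sum>k<n. u k) / real n) + \<epsilon>"
      by (simp add: F_def distrib_left)
  qed
qed

lemma sqrt_cmod_add: "sqrt (cmod (x + y)) \<le> sqrt (cmod x) + sqrt (cmod y)"
  by (rule order_trans[OF real_sqrt_le_mono[OF norm_triangle_ineq] sqrt_add_le_add_sqrt]) auto

lemma sqrt_cmod_diff: "sqrt (cmod (x - y)) \<le> sqrt (cmod x) + sqrt (cmod y)"
  by (rule order_trans[OF real_sqrt_le_mono[OF norm_triangle_ineq4] sqrt_add_le_add_sqrt]) auto

text \<open>The factor 4 counts the positive and negative parts of \<open>Re (u k)\<close> and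
  \<open>Im (u k)\<close>, each dominated by \<open>cmod (u k)\<close>; the square root of the
  modulus is subadditive.\<close>

lemma cauchy_tr_mean:
  assumes n: "0 < n" and r: "0 \<le> r" "r < 1" and e: "0 < \<epsilon>"
  shows "\<forall>\<^sub>F m in sequentially.
    (\<Sum>j<m. sqrt (cmod (cauchy_tr n u (of_real r * zc m 1 j)))) / real m
      \<le> 4 * sqrt 2 * sqrt ((\<Sum>k<n. cmod (u k)) / real n) + \<epsilon>"
proof -
  define v :: "(nat \<Rightarrow> real) \<Rightarrow> nat \<Rightarrow> complex" where "v f k = of_real (f k)" for f k
  define p1 where "p1 k = max (Re (u k)) 0" for k
  define p2 where "p2 k = max (- Re (u k)) 0" for k
  define p3 where "p3 k = max (Im (u k)) 0" for k
  define p4 where "p4 k = max (- Im (u k)) 0" for k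
  have uk: "u k = v p1 k - v p2 k + \<i> * (v p3 k - v p4 k)" for k
    by (simp add: v_def p1_def p2_def p3_def p4_def complex_eq_iff max_def)
  have C: "cauchy_tr n u z = cauchy_tr n (v p1) z - cauchy_tr n (v p2) z
      + \<i> * (cauchy_tr n (v p3) z - cauchy_tr n (v p4) z)" for z
    unfolding cauchy_tr_def uk
    by (simp add: add_divide_distrib diff_divide_distrib sum.distrib sum_subtractf sum_distrib_left
        right_diff_distrib)
  let ?M = "\<lambda>p m. (\<Sum>j<m. sqrt (cmod (cauchy_tr n (v p) (of_real r * zc m 1 j)))) / real m"
  let ?A = "sqrt ((\<Sum>k<n. cmod (u k)) / real n)"
  have ev: "\<forall>\<^sub>F m in sequentially. ?M p m \<le> sqrt 2 * ?A + \<epsilon> / 4"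
    if p: "\<And>k. 0 \<le> p k" "\<And>k. p k \<le> cmod (u k)" for p
  proof -
    have "sqrt ((\<Sum>k<n. p k) / real n) \<le> ?A"
      by (intro real_sqrt_le_mono divide_right_mono sum_mono p) simp
    then have le: "sqrt 2 * sqrt ((\<Sum>k<n. p k) / real n) + \<epsilon> / 4 \<le> sqrt 2 * ?A + \<epsilon> / 4"
      by (intro add_mono mult_left_mono) auto
    have "\<forall>\<^sub>F m in sequentially. ?M p m \<le> sqrt 2 * sqrt ((\<Sum>k<n. p k) / real n) + \<epsilon> / 4"
      unfolding v_def using cauchy_tr_pos_mean[OF n p(1) r, of "\<epsilon> / 4"] e by simp
    then show ?thesis by (rule eventually_mono) (use le in linarith)
  qed
  have "\<forall>\<^sub>F m in sequentially. ?M p1 m \<le> sqrt 2 * ?A + \<epsilon> / 4"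
    "\<forall>\<^sub>F m in sequentially. ?M p2 m \<le> sqrt 2 * ?A + \<epsilon> / 4"
    "\<forall>\<^sub>F m in sequentially. ?M p3 m \<le> sqrt 2 * ?A + \<epsilon> / 4"
    "\<forall>\<^sub>F m in sequentially. ?M p4 m \<le> sqrt 2 * ?A + \<epsilon> / 4"
    by (rule ev; use abs_Re_le_cmod abs_Im_le_cmod in \<open>force simp: p1_def p2_def p3_def p4_def abs_le_iff\<close>)+
  then show ?thesis
  proof eventually_elim
    case (elim m)
    have "sqrt (cmod (cauchy_tr n u z)) \<le> sqrt (cmod (cauchy_tr n (v p1) z)) + sqrt (cmod (cauchy_tr n (v p2) z))
       + (sqrt (cmod (cauchy_tr n (v p3) z)) + sqrt (cmod (cauchy_tr n (v p4) z)))" for z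
      unfolding C using sqrt_cmod_add[of "cauchy_tr n (v p1) z - cauchy_tr n (v p2) z" "\<i> * (cauchy_tr n (v p3) z - cauchy_tr n (v p4) z)"]
        sqrt_cmod_diff[of "cauchy_tr n (v p1) z" "cauchy_tr n (v p2) z"]
        sqrt_cmod_diff[of "cauchy_tr n (v p3) z" "cauchy_tr n (v p4) z"]
      by (simp add: norm_mult)
    then have "(\<Sum>j<m. sqrt (cmod (cauchy_tr n u (of_real r * zc m 1 j)))) / real m \<le>
      (\<Sum>j<m. sqrt (cmod (cauchy_tr n (v p1) (of_real r * zc m 1 j))) + sqrt (cmod (cauchy_tr n (v p2) (of_real r * zc m 1 j)))
       + (sqrt (cmod (cauchy_tr n (v p3) (of_real r * zc m 1 j))) + sqrt (cmod (cauchy_tr n (v p4) (of_real r * zc m 1 j))))) / real m"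
      by (intro divide_right_mono sum_mono) auto
    also have "\<dots> = ?M p1 m + ?M p2 m + (?M p3 m + ?M p4 m)"
      by (simp add: sum.distrib add_divide_distrib)
    finally show ?case using elim by linarith
  qed
qed

section \<open>From the Cauchy transform to partial sums on the grid\<close>

definition dft :: "nat \<Rightarrow> (nat \<Rightarrow> complex) \<Rightarrow> int \<Rightarrow> complex" where
  "dft n u q = (\<Sum>k<n. u k * zc n (- q) k) / of_nat n"

lemma norm_dft_le: "cmod (dft n u q) \<le> (\<Sum>k<n. cmod (u k)) / real n"
  unfolding dft_def norm_divide norm_of_nat
  by (intro divide_right_mono sum_norm_le) (auto simp: norm_mult)

text \<open>A partial sum is a difference of two Cauchy transforms; the second one is that of
  a modulated function, whose moduli are unchanged.\<close>

lemma dft_partial_sum_eq: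
  assumes "cmod z < 1"
  shows "(\<Sum>q<b. dft n u (int q) * z ^ q) =
    cauchy_tr n u z - z ^ b * cauchy_tr n (\<lambda>k. u k * zc n (- int b) k) z"
proof -
  have pw: "zc n (- 1) k ^ q = zc n (- int q) k" for k q
    by (simp add: zc_def Complex.DeMoivre mult_ac)
  have geo: "(\<Sum>q<b. u k * zc n (- int q) k * z ^ q) =
     u k / (1 - z * zc n (-1) k) - z ^ b * (u k * zc n (- int b) k / (1 - z * zc n (-1) k))" for k
  proof -
    define w where "w = z * zc n (-1) k"
    have w1: "w \<noteq> 1" using assms by (auto simp: w_def norm_mult dest: arg_cong[of _ _ cmod])
    have "(\<Sum>q<b. u k * zc n (- int q) k * z ^ q) = u k * (\<Sum>q<b. w ^ q)"
      by (simp add: w_def power_mult_distrib pw sum_distrib_left mult_ac)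
    also have "(\<Sum>q<b. w ^ q) = (1 - w ^ b) / (1 - w)"
      using w1 by (simp add: sum_gp_strict)
    also have "u k * \<dots> = u k / (1 - w) - z ^ b * (u k * zc n (- int b) k / (1 - w))"
      by (simp add: w_def power_mult_distrib pw right_diff_distrib diff_divide_distrib mult_ac)
    finally show ?thesis by (simp add: w_def)
  qed
  have "(\<Sum>q<b. dft n u (int q) * z ^ q) = (\<Sum>k<n. \<Sum>q<b. u k * zc n (- int q) k * z ^ q) / of_nat n"
    unfolding dft_def sum_divide_distrib sum_distrib_right
    by (subst sum.swap) (simp add: sum_divide_distrib)
  then show ?thesis
    unfolding geo cauchy_tr_def
    by (simp add: sum_subtractf diff_divide_distrib sum_distrib_left)
qed

lemma cmod_cis_diff_le: "cmod (cis a - cis b) \<le> \<bar>a - b\<bar>"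
proof -
  have "cis a - cis b = cis b * (exp (\<i> * of_real (a - b)) - 1)"
    by (simp add: cis_conv_exp exp_add[symmetric] algebra_simps)
  then have "cmod (cis a - cis b) = 2 * \<bar>sin ((a - b) / 2)\<bar>"
    by (simp add: norm_mult dist_exp_i_1 del: of_real_diff)
  also have "\<dots> \<le> 2 * \<bar>(a - b) / 2\<bar>" by (intro mult_left_mono abs_sin_x_le_abs_x) simp
  finally show ?thesis by simp
qed

text \<open>\<open>cauchy_tr_mean\<close> controls means over very many points inside the disc, but
  the grid has \<open>n\<close> points on the unit circle. The partial sum has \<open>b\<close>
  coefficients, each bounded by the mean \<open>A\<close> of \<open>cmod (u k)\<close>; so if
  \<open>n\<close> is large against the square of \<open>b\<close>, it changes by at most
  \<open>A\<close> along an arc of length 2 pi / n and a short way inwards. Two Cauchy transforms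
  and this change give the constant 8 sqrt 2 + 1, and sqrt 2 is rounded up to 3/2.\<close>

lemma dft_partial_sum_grid:
  assumes n: "0 < n" "4 * pi * (real b)\<^sup>2 \<le> real n"
  shows "(\<Sum>j<n. sqrt (cmod (\<Sum>q<b. dft n u (int q) * zc n (int q) j))) / real n
    \<le> 13 * sqrt ((\<Sum>k<n. cmod (u k)) / real n)"
proof (rule field_le_epsilon)
  fix \<epsilon> :: real assume e: "0 < \<epsilon>"
  define A where "A = (\<Sum>k<n. cmod (u k)) / real n"
  have A: "0 \<le> A" by (simp add: A_def sum_nonneg)
  \<comment> \<open>The permitted change \<open>A\<close> is split in halves. This radius gives
    \<open>b * (1 - r ^ b) \<le> 1 / 2\<close> by Bernoulli's inequality, and the hypothesis on
    \<open>n\<close> gives the same bound for \<open>2 * pi * b\<^sup>2 / n\<close>.\<close>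
  define r where "r = 1 - 1 / (2 * (real b)\<^sup>2 + 2)"
  have "0 < 2 * (real b)\<^sup>2 + 2" by (smt (verit) zero_le_power2)
  then have r: "0 \<le> r" "r < 1" by (auto simp: r_def divide_simps)
  have rb: "real b * (1 - r ^ b) \<le> 1 / 2"
  proof -
    have "1 + real b * (r - 1) \<le> (1 + (r - 1)) ^ b" using r by (intro Bernoulli_inequality) simp
    then have "1 - r ^ b \<le> real b * (1 - r)" by (simp add: algebra_simps)
    then have "real b * (1 - r ^ b) \<le> real b * (real b * (1 - r))" by (intro mult_left_mono) auto
    also have "\<dots> = (real b)\<^sup>2 / (2 * (real b)\<^sup>2 + 2)" by (simp add: r_def power2_eq_square)
    also have "\<dots> \<le> 1 / 2" using \<open>0 < 2 * (real b)\<^sup>2 + 2\<close> by (simp add: field_simps)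
    finally show ?thesis .
  qed
  define P where "P z = (\<Sum>q<b. dft n u (int q) * z ^ q)" for z
  let ?u' = "\<lambda>k. u k * zc n (- int b) k"
  have A': "(\<Sum>k<n. cmod (?u' k)) / real n = A" by (simp add: A_def norm_mult)
  have "\<forall>\<^sub>F m in sequentially. (\<Sum>j<m. sqrt (cmod (cauchy_tr n u (of_real r * zc m 1 j)))) / real m
      \<le> 4 * sqrt 2 * sqrt A + \<epsilon> / 2"
    unfolding A_def using e by (intro cauchy_tr_mean n r) simp
  moreover have "\<forall>\<^sub>F m in sequentially. (\<Sum>j<m. sqrt (cmod (cauchy_tr n ?u' (of_real r * zc m 1 j)))) / real m
      \<le> 4 * sqrt 2 * sqrt A + \<epsilon> / 2"
    unfolding A'[symmetric] using e by (intro cauchy_tr_mean n r) simp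
  ultimately have "\<forall>\<^sub>F m in sequentially. (\<Sum>j<m. sqrt (cmod (P (of_real r * zc m 1 j)))) / real m
      \<le> 8 * sqrt 2 * sqrt A + \<epsilon>"
  proof eventually_elim
    case (elim m)
    have "sqrt (cmod (P z)) \<le> sqrt (cmod (cauchy_tr n u z)) + sqrt (cmod (cauchy_tr n ?u' z))"
      if z: "cmod z < 1" for z
    proof -
      have "cmod (z ^ b * cauchy_tr n ?u' z) \<le> 1 * cmod (cauchy_tr n ?u' z)"
        unfolding norm_mult norm_power using z by (intro mult_right_mono power_le_one) auto
      then show ?thesis
        unfolding P_def dft_partial_sum_eq[OF z]
        by (intro order_trans[OF sqrt_cmod_diff] add_mono real_sqrt_le_mono) auto
    qed
    then have "(\<Sum>j<m. sqrt (cmod (P (of_real r * zc m 1 j)))) / real m \<le>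
      (\<Sum>j<m. sqrt (cmod (cauchy_tr n u (of_real r * zc m 1 j))) + sqrt (cmod (cauchy_tr n ?u' (of_real r * zc m 1 j)))) / real m"
      using r by (intro divide_right_mono sum_mono) (auto simp: norm_mult)
    then show ?case using elim by (simp add: sum.distrib add_divide_distrib)
  qed
  then obtain m0 where m0: "\<And>m. m0 \<le> m \<Longrightarrow> (\<Sum>j<m. sqrt (cmod (P (of_real r * zc m 1 j)))) / real m
      \<le> 8 * sqrt 2 * sqrt A + \<epsilon>"
    by (auto simp: eventually_sequentially)
  \<comment> \<open>\<open>m\<close> is a multiple of \<open>n\<close> beyond \<open>m0\<close>. The
    fine points fall into \<open>n\<close> blocks of length \<open>t\<close>, the k-th block filling
    the arc that starts at the k-th grid point, and \<open>j div t\<close> is the block of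
    \<open>j\<close>.\<close>
  define t where "t = Suc m0"
  define m where "m = n * t"
  have "t \<le> n * t" using n by simp
  then have m: "m0 \<le> m" "0 < m" using n by (auto simp: m_def t_def)
  define g where "g k = sqrt (cmod (P (zc n 1 k)))" for k
  have near: "g (j div t) \<le> sqrt (cmod (P (of_real r * zc m 1 j))) + sqrt A" for j
  proof -
    have ang: "2 * pi * real j / real m - 2 * pi * real (j div t) / real n = 2 * pi / real n * (real (j mod t) / real t)"
    proof -
      have "real j = real (j div t) * real t + real (j mod t)"
        by (metis div_mult_mod_eq of_nat_add of_nat_mult)
      moreover have "0 < real t" by (simp add: t_def)
      ultimately show ?thesis using n by (simp add: m_def field_simps)
    qed
    have frac: "0 \<le> real (j mod t) / real t" "real (j mod t) / real t \<le> 1"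
      using mod_less_divisor[of t j] by (simp_all add: t_def del: mod_less_divisor)
    have q: "cmod (zc n 1 (j div t) ^ q - (of_real r * zc m 1 j) ^ q) \<le> (1 - r ^ b) + real b * (2 * pi / real n)"
      if qb: "q < b" for q
    proof -
      have "zc n 1 (j div t) ^ q - (of_real r * zc m 1 j) ^ q
        = (zc n 1 (j div t) ^ q - zc m 1 j ^ q) + of_real (1 - r ^ q) * zc m 1 j ^ q"
        by (simp add: power_mult_distrib algebra_simps)
      then have "cmod (zc n 1 (j div t) ^ q - (of_real r * zc m 1 j) ^ q)
         \<le> cmod (zc n 1 (j div t) ^ q - zc m 1 j ^ q) + cmod (of_real (1 - r ^ q) * zc m 1 j ^ q)"
        by (metis norm_triangle_ineq)
      also have "cmod (of_real (1 - r ^ q) * zc m 1 j ^ q) = 1 - r ^ q"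
        unfolding norm_mult norm_power norm_of_real using r by (simp add: power_le_one)
      also have "1 - r ^ q \<le> 1 - r ^ b" using qb r by (simp add: power_decreasing)
      also have "cmod (zc n 1 (j div t) ^ q - zc m 1 j ^ q) \<le>
          \<bar>real q * (2 * pi * real (j div t) / real n) - real q * (2 * pi * real j / real m)\<bar>"
        unfolding zc_def Complex.DeMoivre using cmod_cis_diff_le by simp
      also have "\<dots> = real q * (2 * pi / real n * (real (j mod t) / real t))"
        unfolding ang[symmetric] right_diff_distrib[symmetric] abs_mult
        using ang frac n by (simp add: abs_minus_commute)
      also have "\<dots> \<le> real b * (2 * pi / real n * 1)"
        using qb frac by (intro mult_mono mult_left_mono) auto
      finally show ?thesis by simp
    qed
    have "cmod (P (zc n 1 (j div t)) - P (of_real r * zc m 1 j))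
       = cmod (\<Sum>q<b. dft n u (int q) * (zc n 1 (j div t) ^ q - (of_real r * zc m 1 j) ^ q))"
      by (simp add: P_def sum_subtractf right_diff_distrib)
    also have "\<dots> \<le> (\<Sum>q<b. A * ((1 - r ^ b) + real b * (2 * pi / real n)))"
    proof (intro sum_norm_le)
      fix x assume "x \<in> {..<b}"
      then show "cmod (dft n u (int x) * (zc n 1 (j div t) ^ x - (of_real r * zc m 1 j) ^ x))
          \<le> A * ((1 - r ^ b) + real b * (2 * pi / real n))"
        unfolding norm_mult using A by (intro mult_mono q norm_dft_le[of n u, folded A_def]) auto
    qed
    also have "\<dots> = A * (real b * (1 - r ^ b) + 2 * pi * (real b)\<^sup>2 / real n)"
      by (simp add: power2_eq_square algebra_simps)
    also have "\<dots> \<le> A * (1 / 2 + 1 / 2)"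
      using rb n A by (intro mult_left_mono add_mono) (auto simp: field_simps)
    finally have "cmod (P (zc n 1 (j div t)) - P (of_real r * zc m 1 j)) \<le> A" by simp
    then have "sqrt (cmod (P (zc n 1 (j div t)) - P (of_real r * zc m 1 j))) \<le> sqrt A" by simp
    moreover have "g (j div t) = sqrt (cmod (P (of_real r * zc m 1 j) + (P (zc n 1 (j div t)) - P (of_real r * zc m 1 j))))"
      by (simp add: g_def)
    ultimately show ?thesis
      using sqrt_cmod_add[of "P (of_real r * zc m 1 j)" "P (zc n 1 (j div t)) - P (of_real r * zc m 1 j)"]
      by linarith
  qed
  have "(\<Sum>j<m. g (j div t)) = (\<Sum>k<n. \<Sum>j\<in>{k * t..<k * t + t}. g (j div t))"
    unfolding m_def by (rule sum.nat_group[symmetric])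
  also have "\<dots> = (\<Sum>k<n. \<Sum>j\<in>{k * t..<k * t + t}. g k)"
  proof (intro sum.cong refl)
    fix k j assume "j \<in> {k * t..<k * t + t}"
    then have "j div t = k" by (intro div_nat_eqI) (auto simp: mult_ac)
    then show "g (j div t) = g k" by simp
  qed
  also have "\<dots> = real t * (\<Sum>k<n. g k)" by (simp add: sum_distrib_left)
  finally have "(\<Sum>k<n. g k) / real n = (\<Sum>j<m. g (j div t)) / real m"
    using m(2) by (simp add: m_def)
  also have "\<dots> \<le> (\<Sum>j<m. sqrt (cmod (P (of_real r * zc m 1 j))) + sqrt A) / real m"
    by (intro divide_right_mono sum_mono near) simp
  also have "\<dots> = (\<Sum>j<m. sqrt (cmod (P (of_real r * zc m 1 j)))) / real m + sqrt A"
    using m by (simp add: sum.distrib add_divide_distrib)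
  also have "\<dots> \<le> 8 * sqrt 2 * sqrt A + \<epsilon> + sqrt A" using m0[OF m(1)] by simp
  also have "\<dots> \<le> 13 * sqrt A + \<epsilon>"
  proof -
    have "sqrt 2 \<le> 3/2" by (rule real_le_lsqrt) (auto simp: power2_eq_square)
    then have "(8 * sqrt 2 + 1) * sqrt A \<le> 13 * sqrt A" using A by (intro mult_right_mono) auto
    then show ?thesis by (simp add: distrib_right)
  qed
  finally show "(\<Sum>j<n. sqrt (cmod (\<Sum>q<b. dft n u (int q) * zc n (int q) j))) / real n
    \<le> 13 * sqrt ((\<Sum>k<n. cmod (u k)) / real n) + \<epsilon>"
    by (simp add: g_def P_def zc_power A_def)
qed

text \<open>Modulation by the frequency \<open>M\<close> carries the symmetric window to one of
  length \<open>2 * M + 1\<close> starting at 0 and leaves all moduli unchanged.\<close>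

lemma dft_symmetric_partial_sum_grid:
  assumes n: "0 < n" "4 * pi * (real (2 * M + 1))\<^sup>2 \<le> real n"
  shows "(\<Sum>j<n. sqrt (cmod (\<Sum>q=-int M..int M. dft n u q * zc n q j))) / real n
    \<le> 13 * sqrt ((\<Sum>k<n. cmod (u k)) / real n)"
proof -
  define v where "v k = u k * zc n (int M) k" for k
  have "cmod (\<Sum>q=-int M..int M. dft n u q * zc n q j) = cmod (\<Sum>q<2*M+1. dft n v (int q) * zc n (int q) j)" for j
  proof -
    have dft_v: "dft n v (int q) = dft n u (int q - int M)" for q
      unfolding dft_def v_def using zc_add[of n "int M" "- int q"] by (simp add: mult.assoc)
    have "(\<Sum>q<2*M+1. dft n v (int q) * zc n (int q) j)
        = (\<Sum>q<2*M+1. dft n u (int q - int M) * zc n (int q - int M) j * zc n (int M) j)"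
    proof (intro sum.cong refl)
      fix q
      have "zc n (int q) j = zc n (int q - int M) j * zc n (int M) j"
        using zc_add[of n "int q - int M" "int M" j] by simp
      then show "dft n v (int q) * zc n (int q) j = dft n u (int q - int M) * zc n (int q - int M) j * zc n (int M) j"
        by (simp only: dft_v mult.assoc)
    qed
    also have "\<dots> = (\<Sum>q=-int M..int M. dft n u q * zc n q j) * zc n (int M) j"
      unfolding sum_distrib_right
      by (rule sum.reindex_bij_witness[of _ "\<lambda>q. nat (q + int M)" "\<lambda>q. int q - int M"]) auto
    finally show ?thesis by (simp add: norm_mult)
  qed
  moreover have "cmod (v k) = cmod (u k)" for k by (simp add: v_def norm_mult)
  ultimately show ?thesis using dft_partial_sum_grid[OF n, of v] by simp
qed

section \<open>Partial sums on the multidimensional grid\<close>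

definition gavg :: "nat \<Rightarrow> (nat \<Rightarrow> nat) \<Rightarrow> ((nat \<Rightarrow> nat) \<Rightarrow> real) \<Rightarrow> real" where
  "gavg d n g = (\<Sum>k\<in>lam d n. g k) / real (Nsize d n)"

lemma gavg_mono: "(\<And>k. k \<in> lam d n \<Longrightarrow> f k \<le> g k) \<Longrightarrow> gavg d n f \<le> gavg d n g"
  unfolding gavg_def by (intro divide_right_mono sum_mono) auto

lemma gavg_add: "gavg d n (\<lambda>k. f k + g k) = gavg d n f + gavg d n g"
  by (simp add: gavg_def sum.distrib add_divide_distrib)

lemma gavg_cmult: "gavg d n (\<lambda>k. c * g k) = c * gavg d n g"
  by (simp add: gavg_def sum_distrib_left)

lemma gavg_nonneg: "(\<And>k. 0 \<le> g k) \<Longrightarrow> 0 \<le> gavg d n g"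
  by (simp add: gavg_def sum_nonneg)

lemma gavg_const: "(\<And>l. l < d \<Longrightarrow> 0 < n l) \<Longrightarrow> gavg d n (\<lambda>_. c) = c"
  using Nsize_pos[of d n] by (simp add: gavg_def card_lam)

lemma avg_sqrt_le:
  assumes "finite A" "\<And>x. x \<in> A \<Longrightarrow> 0 \<le> f x"
  shows "(\<Sum>x\<in>A. sqrt (f x)) / real (card A) \<le> sqrt ((\<Sum>x\<in>A. f x) / real (card A))"
proof (cases "card A = 0")
  case False
  have "(\<Sum>x\<in>A. sqrt (f x))\<^sup>2 \<le> (\<Sum>x\<in>A. (sqrt (f x))\<^sup>2) * real (card A)"
    by (rule sum_squared_le_sum_of_squares)
  also have "(\<Sum>x\<in>A. (sqrt (f x))\<^sup>2) = (\<Sum>x\<in>A. f x)"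
    using assms by (intro sum.cong) auto
  finally have "(\<Sum>x\<in>A. sqrt (f x))\<^sup>2 / (real (card A))\<^sup>2 \<le> (\<Sum>x\<in>A. f x) * real (card A) / (real (card A))\<^sup>2"
    by (rule divide_right_mono) simp
  then have "((\<Sum>x\<in>A. sqrt (f x)) / real (card A))\<^sup>2 \<le> (\<Sum>x\<in>A. f x) / real (card A)"
    using False by (simp add: power_divide power2_eq_square)
  then show ?thesis by (rule real_le_rsqrt)
qed simp

lemma gavg_sqrt_le:
  assumes "\<And>k. k \<in> lam d n \<Longrightarrow> 0 \<le> f k"
  shows "gavg d n (\<lambda>k. sqrt (f k)) \<le> sqrt (gavg d n f)"
  using avg_sqrt_le[of "lam d n" f] assms by (simp add: gavg_def card_lam)

lemma lam_fun_upd: "k \<in> lam d n \<Longrightarrow> l < d \<Longrightarrow> j < n l \<Longrightarrow> k(l := j) \<in> lam d n"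
  by (auto simp: lam_def PiE_def Pi_def extensional_def)

text \<open>Swapping \<open>k l\<close> with \<open>j\<close> is an involution on the pairs
  \<open>(k, j)\<close>, so an independent uniform value in one coordinate does not change the
  mean.\<close>

lemma gavg_fibre:
  assumes l: "l < d" and n: "0 < n l"
  shows "gavg d n g = gavg d n (\<lambda>k. (\<Sum>j<n l. g (k(l := j))) / real (n l))"
proof -
  have "(\<Sum>k\<in>lam d n. \<Sum>j<n l. g (k(l := j))) = (\<Sum>(k,j)\<in>lam d n \<times> {..<n l}. g (k(l := j)))"
    by (simp add: sum.cartesian_product)
  also have "\<dots> = (\<Sum>(k,j)\<in>lam d n \<times> {..<n l}. g k)"
    by (rule sum.reindex_bij_witness[of _ "\<lambda>(k,j). (k(l := j), k l)" "\<lambda>(k,j). (k(l := j), k l)"])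
      (auto simp: lam_fun_upd l lamD)
  also have "\<dots> = real (n l) * (\<Sum>k\<in>lam d n. g k)"
    by (simp add: sum.cartesian_product[symmetric] sum_distrib_left)
  finally show ?thesis
    using n by (simp add: gavg_def sum_divide_distrib[symmetric])
qed

text \<open>Fourier partial sum in coordinate \<open>l\<close> alone, the other coordinates being
  frozen. It is computed from grid values, so it makes sense for every grid function and the
  one-dimensional inequality applies on each fibre.\<close>

definition psum :: "nat \<Rightarrow> (nat \<Rightarrow> nat) \<Rightarrow> nat \<Rightarrow> ((nat \<Rightarrow> nat) \<Rightarrow> complex) \<Rightarrow> (nat \<Rightarrow> nat) \<Rightarrow> complex" where
  "psum l n M u k = (\<Sum>q=-int M..int M. dft (n l) (\<lambda>j. u (k(l := j))) q * zc (n l) q (k l))"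

text \<open>The one-dimensional inequality holds on every fibre in direction \<open>l\<close>.
  Concavity of the square root moves the mean over the fibres inside, so the constant does not grow
  with \<open>d\<close>.\<close>

lemma gavg_psum:
  assumes l: "l < d" and n: "0 < n l" "4 * pi * (real (2 * M + 1))\<^sup>2 \<le> real (n l)"
  shows "gavg d n (\<lambda>k. sqrt (cmod (psum l n M u k))) \<le> 13 * sqrt (gavg d n (\<lambda>k. cmod (u k)))"
proof -
  have "gavg d n (\<lambda>k. sqrt (cmod (psum l n M u k)))
     = gavg d n (\<lambda>k. (\<Sum>j<n l. sqrt (cmod (psum l n M u (k(l := j))))) / real (n l))"
    by (rule gavg_fibre) (use l n in auto)
  also have "\<dots> \<le> gavg d n (\<lambda>k. 13 * sqrt ((\<Sum>j<n l. cmod (u (k(l := j)))) / real (n l)))"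
    by (intro gavg_mono) (use dft_symmetric_partial_sum_grid[OF n] in \<open>simp add: psum_def\<close>)
  also have "\<dots> = 13 * gavg d n (\<lambda>k. sqrt ((\<Sum>j<n l. cmod (u (k(l := j)))) / real (n l)))"
    by (rule gavg_cmult)
  also have "\<dots> \<le> 13 * sqrt (gavg d n (\<lambda>k. (\<Sum>j<n l. cmod (u (k(l := j)))) / real (n l)))"
    by (intro mult_left_mono gavg_sqrt_le) (auto simp: sum_nonneg)
  also have "gavg d n (\<lambda>k. (\<Sum>j<n l. cmod (u (k(l := j)))) / real (n l)) = gavg d n (\<lambda>k. cmod (u k))"
    by (rule gavg_fibre[symmetric]) (use l n in auto)
  finally show ?thesis .
qed

text \<open>No aliasing: a frequency \<open>q l\<close> of the polynomial and a frequency of the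
  window differ by less than \<open>n l\<close>, so they are congruent modulo \<open>n l\<close>
  only if they are equal. The grid partial sum is then the true truncation.\<close>

lemma psum_trig_poly:
  assumes l: "l < d" and n: "0 < n l" and Q: "finite Q" "\<And>q. q \<in> Q \<Longrightarrow> \<bar>q l\<bar> + int M < int (n l)"
  shows "psum l n M (\<lambda>k. \<Sum>q\<in>Q. a q * zchr d n q k) k =
    (\<Sum>q\<in>Q. (if \<bar>q l\<bar> \<le> int M then a q else 0) * zchr d n q k)"
proof -
  define R where "R q = (\<Prod>i\<in>{..<d}-{l}. zc (n i) (q i) (k i))" for q
  have split: "zchr d n q (k(l := j)) = R q * zc (n l) (q l) j" for q j
  proof -
    have "zchr d n q (k(l := j)) = zc (n l) (q l) j * (\<Prod>i\<in>{..<d}-{l}. zc (n i) (q i) ((k(l := j)) i))"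
      unfolding zchr_def using l by (subst prod.remove[of _ l]) auto
    also have "(\<Prod>i\<in>{..<d}-{l}. zc (n i) (q i) ((k(l := j)) i)) = R q"
      unfolding R_def by (intro prod.cong) auto
    finally show ?thesis by (simp only: mult.commute)
  qed
  have dft: "dft (n l) (\<lambda>j. \<Sum>q\<in>Q. a q * zchr d n q (k(l := j))) m = (\<Sum>q\<in>Q. if q l = m then a q * R q else 0)"
    if m: "m \<in> {-int M..int M}" for m
  proof -
    have "dft (n l) (\<lambda>j. \<Sum>q\<in>Q. a q * zchr d n q (k(l := j))) m
       = (\<Sum>j<n l. \<Sum>q\<in>Q. a q * R q * zc (n l) (q l - m) j) / of_nat (n l)"
      unfolding dft_def split sum_distrib_right
      by (simp add: diff_conv_add_uminus zc_add mult_ac del: add_uminus_conv_diff)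
    also have "\<dots> = (\<Sum>q\<in>Q. a q * R q * (\<Sum>j<n l. zc (n l) (q l - m) j)) / of_nat (n l)"
      unfolding sum_distrib_left by (subst sum.swap) simp
    also have "\<dots> = (\<Sum>q\<in>Q. if q l = m then a q * R q else 0)"
      unfolding sum_divide_distrib
    proof (intro sum.cong refl)
      fix q assume q: "q \<in> Q"
      have "\<bar>q l - m\<bar> < int (n l)" using Q(2)[OF q] m by auto
      then have "int (n l) dvd q l - m \<longleftrightarrow> q l = m"
        using dvd_imp_le_int[of "q l - m" "int (n l)"] by fastforce
      then show "a q * R q * (\<Sum>j<n l. zc (n l) (q l - m) j) / of_nat (n l) = (if q l = m then a q * R q else 0)"
        using n by (simp add: sum_zc)
    qed
    finally show ?thesis .
  qed
  have "psum l n M (\<lambda>k. \<Sum>q\<in>Q. a q * zchr d n q k) k =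
     (\<Sum>m=-int M..int M. \<Sum>q\<in>Q. if q l = m then a q * R q * zc (n l) m (k l) else 0)"
    unfolding psum_def by (intro sum.cong refl) (simp add: dft sum_distrib_right if_distrib[of "\<lambda>x. x * _"] cong: if_cong)
  also have "\<dots> = (\<Sum>q\<in>Q. \<Sum>m=-int M..int M. if q l = m then a q * R q * zc (n l) m (k l) else 0)"
    by (rule sum.swap)
  also have "\<dots> = (\<Sum>q\<in>Q. (if \<bar>q l\<bar> \<le> int M then a q else 0) * zchr d n q k)"
  proof (intro sum.cong refl)
    fix q
    have "zchr d n q k = R q * zc (n l) (q l) (k l)" using split[of q "k l"] by simp
    then show "(\<Sum>m=-int M..int M. if q l = m then a q * R q * zc (n l) m (k l) else 0)
       = (if \<bar>q l\<bar> \<le> int M then a q else 0) * zchr d n q k"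
      by (auto simp: sum.delta abs_le_iff)
  qed
  finally show ?thesis .
qed

section \<open>Kernels\<close>

definition fbox :: "nat \<Rightarrow> (nat \<Rightarrow> nat) \<Rightarrow> (nat \<Rightarrow> int) set" where
  "fbox d M = {q \<in> Zd d. \<forall>l<d. \<bar>q l\<bar> \<le> int (M l)}"

lemma bij_betw_fbox:
  "bij_betw (\<lambda>q. restrict q {..<d}) (fbox d M) (PiE {..<d} (\<lambda>l. {-int (M l)..int (M l)}))"
proof (rule bij_betw_byWitness[where f' = "\<lambda>q l. if l < d then q l else 0"])
  show "\<forall>q\<in>fbox d M. (\<lambda>l. if l < d then restrict q {..<d} l else 0) = q"
    by (auto simp: fbox_def Zd_def)
  show "\<forall>q\<in>PiE {..<d} (\<lambda>l. {-int (M l)..int (M l)}). restrict (\<lambda>l. if l < d then q l else 0) {..<d} = q"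
    by (auto simp: PiE_def extensional_def restrict_def)
  show "(\<lambda>q. restrict q {..<d}) ` fbox d M \<subseteq> PiE {..<d} (\<lambda>l. {-int (M l)..int (M l)})"
    by (auto simp: fbox_def abs_le_iff minus_le_iff simp del: restrict_apply intro!: restrict_PiE_iff[THEN iffD2])
  show "(\<lambda>q l. if l < d then q l else 0) ` PiE {..<d} (\<lambda>l. {-int (M l)..int (M l)}) \<subseteq> fbox d M"
    by (fastforce simp: fbox_def Zd_def PiE_def Pi_def abs_le_iff)
qed

lemma finite_fbox [simp]: "finite (fbox d M)"
  using bij_betw_finite[OF bij_betw_fbox] by (simp add: finite_PiE)

lemma sum_fbox_prod:
  fixes f :: "nat \<Rightarrow> int \<Rightarrow> 'b::comm_semiring_1"
  shows "(\<Sum>q\<in>fbox d M. \<Prod>l<d. f l (q l)) = (\<Prod>l<d. \<Sum>q=-int (M l)..int (M l). f l q)"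
proof -
  have "(\<Sum>q\<in>fbox d M. \<Prod>l<d. f l (q l)) = (\<Sum>q\<in>fbox d M. \<Prod>l<d. f l (restrict q {..<d} l))"
    by (intro sum.cong prod.cong) auto
  also have "\<dots> = (\<Sum>q\<in>PiE {..<d} (\<lambda>l. {-int (M l)..int (M l)}). \<Prod>l<d. f l (q l))"
    by (rule sum.reindex_bij_betw[OF bij_betw_fbox])
  also have "\<dots> = (\<Prod>l<d. \<Sum>q=-int (M l)..int (M l). f l q)"
    by (rule prod_sum_PiE[symmetric]) auto
  finally show ?thesis .
qed

text \<open>An L1 bound, taken on the grid of size \<open>n\<close>, for the trigonometric kernel
  with coefficients \<open>\<kappa>\<close>. Uniformity in the translation \<open>y\<close> is
  essential: in \<open>L1le_fcoeff\<close> it is, up to sign, a coordinate of the integration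
  variable and need not be a grid point.\<close>

definition kbound :: "nat \<Rightarrow> nat \<Rightarrow> (int \<Rightarrow> complex) \<Rightarrow> real \<Rightarrow> bool" where
  "kbound n D \<kappa> B \<longleftrightarrow> (\<forall>y::real. (\<Sum>j<n. cmod (\<Sum>q=-int D..int D.
      \<kappa> q * cis (real_of_int q * (2 * pi * real j / real n - y)))) / real n \<le> B)"

section \<open>Fejer and de la Vallee-Poussin weights\<close>

definition fej :: "nat \<Rightarrow> int \<Rightarrow> complex" where
  "fej N q = of_real (max 0 (1 - \<bar>real_of_int q\<bar> / real N))"

lemma card_pairs_diff:
  assumes "\<bar>q\<bar> \<le> int N"
  shows "int (card {(i,j). i < N \<and> j < N \<and> int i - int j = q}) = int N - \<bar>q\<bar>"
proof (cases "0 \<le> q")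
  case True
  have "{(i,j). i < N \<and> j < N \<and> int i - int j = q} = (\<lambda>j. (j + nat q, j)) ` {..<N - nat q}"
    using True by (auto simp: image_iff)
  then have "card {(i,j). i < N \<and> j < N \<and> int i - int j = q} = N - nat q"
    by (simp add: card_image inj_on_def)
  then show ?thesis using True assms by simp
next
  case False
  have "{(i,j). i < N \<and> j < N \<and> int i - int j = q} = (\<lambda>i. (i, i + nat (-q))) ` {..<N - nat (-q)}"
    using False by (auto simp: image_iff)
  then have "card {(i,j). i < N \<and> j < N \<and> int i - int j = q} = N - nat (-q)"
    by (simp add: card_image inj_on_def)
  then show ?thesis using False assms by simp
qed

text \<open>When the square is expanded, the frequency \<open>q\<close> occurs once for each pair
  below \<open>N\<close> with difference \<open>q\<close>. In particular the kernel is nonnegative;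
  a range \<open>D\<close> beyond \<open>N\<close> only adds zero weights.\<close>

lemma fejer_kernel:
  assumes N: "0 < N" "N \<le> D"
  shows "(\<Sum>q=-int D..int D. fej N q * cis (real_of_int q * y)) =
    of_real ((cmod (\<Sum>j<N. cis (real j * y)))\<^sup>2 / real N)"
proof -
  let ?S = "{..<N} \<times> {..<N}"
  let ?h = "\<lambda>(i,j). cis ((real i - real j) * y)"
  have "complex_of_real ((cmod (\<Sum>j<N. cis (real j * y)))\<^sup>2) = (\<Sum>i<N. cis (real i * y)) * cnj (\<Sum>j<N. cis (real j * y))"
    by (rule complex_norm_square)
  also have "\<dots> = (\<Sum>i<N. \<Sum>j<N. cis ((real i - real j) * y))"
    by (simp add: sum_product cis_cnj cis_mult algebra_simps)
  also have "\<dots> = (\<Sum>x\<in>?S. ?h x)" by (simp add: sum.cartesian_product)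
  also have "\<dots> = (\<Sum>q=-int D..int D. \<Sum>x\<in>{x \<in> ?S. (case x of (i,j) \<Rightarrow> int i - int j) = q}. ?h x)"
    using N by (intro sum.group[symmetric]) auto
  also have "\<dots> = (\<Sum>q=-int D..int D. of_nat N * (fej N q * cis (real_of_int q * y)))"
  proof (intro sum.cong refl)
    fix q assume "q \<in> {-int D..int D}"
    let ?X = "{(i,j). i < N \<and> j < N \<and> int i - int j = q}"
    have "(\<Sum>x\<in>{x \<in> ?S. (case x of (i,j) \<Rightarrow> int i - int j) = q}. ?h x) = (\<Sum>x\<in>?X. cis (real_of_int q * y))"
      by (rule sum.cong) auto
    also have "\<dots> = of_nat (card ?X) * cis (real_of_int q * y)" by simp
    also have "complex_of_nat (card ?X) = of_nat N * fej N q"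
    proof (cases "\<bar>q\<bar> \<le> int N")
      case True
      have "complex_of_nat (card ?X) = of_int (int N - \<bar>q\<bar>)"
        unfolding card_pairs_diff[OF True, symmetric] by simp
      also have "\<dots> = of_real (real N * (1 - \<bar>real_of_int q\<bar> / real N))"
        using N by (simp add: right_diff_distrib flip: of_int_abs)
      also have "1 - \<bar>real_of_int q\<bar> / real N = max 0 (1 - \<bar>real_of_int q\<bar> / real N)"
        using True N by (simp add: max_def divide_simps) linarith
      finally show ?thesis by (simp add: fej_def)
    next
      case False
      then have "?X = {}" by auto
      then have "card ?X = 0" by (simp only: card.empty)
      moreover have "max 0 (1 - \<bar>real_of_int q\<bar> / real N) = 0"
        using False N by (simp add: max_def divide_simps) linarith
      ultimately show ?thesis by (simp add: fej_def)
    qed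
    finally show "(\<Sum>x\<in>{x \<in> ?S. (case x of (i,j) \<Rightarrow> int i - int j) = q}. ?h x)
      = of_nat N * (fej N q * cis (real_of_int q * y))" by simp
  qed
  also have "\<dots> = of_nat N * (\<Sum>q=-int D..int D. fej N q * cis (real_of_int q * y))"
    by (simp add: sum_distrib_left)
  finally show ?thesis using N by (simp add: field_simps)
qed

lemma fej_zero_outside: "0 < N \<Longrightarrow> int N \<le> \<bar>q\<bar> \<Longrightarrow> fej N q = 0"
  by (auto simp: fej_def max_def divide_simps)

lemma kbound_fej:
  assumes N: "0 < N" "N \<le> D" "N \<le> n"
  shows "kbound n D (fej N) 1"
  unfolding kbound_def
proof
  fix y :: real
  define S where "S j = (\<Sum>q=-int D..int D. fej N q * cis (real_of_int q * (2 * pi * real j / real n - y)))" for j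
  have nonneg: "complex_of_real (cmod (S j)) = S j" for j
    unfolding S_def fejer_kernel[OF N(1,2)] norm_of_real by (simp only: abs_of_nonneg zero_le_divide_iff zero_le_power2 of_nat_0_le_iff simp_thms)
  have "(\<Sum>j<n. S j) = (\<Sum>q=-int D..int D. fej N q * cis (- (real_of_int q * y)) * (\<Sum>j<n. zc n q j))"
    unfolding S_def sum_distrib_left zc_def
    by (subst sum.swap) (simp add: mult.assoc cis_mult algebra_simps)
  also have "\<dots> = (\<Sum>q=-int D..int D. if q = 0 then of_nat n else 0)"
  proof (intro sum.cong refl)
    fix q
    show "fej N q * cis (- (real_of_int q * y)) * (\<Sum>j<n. zc n q j) = (if q = 0 then of_nat n else 0)"
    proof (cases "q = 0")
      case True then show ?thesis by (simp add: fej_def)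
    next
      case False
      have "fej N q = 0" if "int n dvd q"
        using dvd_imp_le_int[OF False that] N by (intro fej_zero_outside) auto
      then show ?thesis using False N by (simp add: sum_zc)
    qed
  qed
  also have "\<dots> = of_nat n" by (simp add: sum.delta)
  finally have "complex_of_real (\<Sum>j<n. cmod (S j)) = of_real (real n)"
    by (simp add: nonneg)
  then have "(\<Sum>j<n. cmod (S j)) = real n" by (simp only: of_real_eq_iff)
  then show "(\<Sum>j<n. cmod (\<Sum>q=-int D..int D. fej N q * cis (real_of_int q * (2 * pi * real j / real n - y)))) / real n \<le> 1"
    unfolding S_def using N by simp
qed

text \<open>This merely counts the surviving frequencies. The bound is bad in \<open>M\<close> but
  free of \<open>N\<close>, \<open>D\<close> and \<open>n\<close>, so that \<open>\<eta>\<close> in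
  \<open>iterated_cutoff\<close> can be chosen before the smoothing parameter and the grid.\<close>

lemma kbound_truncated_fej:
  assumes "0 < n"
  shows "kbound n D (\<lambda>q. if int M < \<bar>q\<bar> then 0 else fej N q) (2 * real M + 1)"
  unfolding kbound_def
proof
  fix y :: real
  have f1: "cmod (fej N q) \<le> 1" for q by (simp add: fej_def)
  have "cmod (\<Sum>q=-int D..int D. (if int M < \<bar>q\<bar> then 0 else fej N q) * cis (real_of_int q * x)) \<le> 2 * real M + 1" for x
  proof -
    have "cmod (\<Sum>q=-int D..int D. (if int M < \<bar>q\<bar> then 0 else fej N q) * cis (real_of_int q * x))
       \<le> (\<Sum>q=-int D..int D. if q \<in> {-int M..int M} then 1 else 0)"
      using f1 by (intro sum_norm_le) (auto simp: norm_mult)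
    also have "\<dots> = real (card ({-int D..int D} \<inter> {-int M..int M}))"
      by (subst sum.inter_restrict[symmetric]) auto
    also have "\<dots> \<le> real (card {-int M..int M})"
      by (intro of_nat_mono card_mono) auto
    finally show ?thesis by simp
  qed
  then have "(\<Sum>j<n. cmod (\<Sum>q=-int D..int D. (if int M < \<bar>q\<bar> then 0 else fej N q) * cis (real_of_int q * (2 * pi * real j / real n - y)))) / real n
     \<le> (\<Sum>j<n. 2 * real M + 1) / real n"
    by (intro divide_right_mono sum_mono) auto
  then show "(\<Sum>j<n. cmod (\<Sum>q=-int D..int D. (if int M < \<bar>q\<bar> then 0 else fej N q) * cis (real_of_int q * (2 * pi * real j / real n - y)))) / real n
     \<le> 2 * real M + 1" using assms by simp
qed

text \<open>Coefficients of the de la Vallee-Poussin kernel.\<close>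

definition vpk :: "nat \<Rightarrow> int \<Rightarrow> complex" where
  "vpk n q = 2 * fej (2 * n) q - fej n q"

lemma vpk_eq_1:
  assumes "0 < n" "\<bar>q\<bar> \<le> int n"
  shows "vpk n q = 1"
proof -
  have q: "\<bar>real_of_int q\<bar> \<le> real n" using assms(2) by linarith
  have "fej n q = of_real (1 - \<bar>real_of_int q\<bar> / real n)"
    "fej (2 * n) q = of_real (1 - \<bar>real_of_int q\<bar> / (2 * real n))"
    using assms q by (auto simp: fej_def max_def divide_simps)
  then have "vpk n q = of_real (2 * (1 - \<bar>real_of_int q\<bar> / (2 * real n)) - (1 - \<bar>real_of_int q\<bar> / real n))"
    by (simp add: vpk_def)
  also have "2 * (1 - \<bar>real_of_int q\<bar> / (2 * real n)) - (1 - \<bar>real_of_int q\<bar> / real n) = 1"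
    by (simp add: field_simps)
  finally show ?thesis by simp
qed

lemma kbound_vpk:
  assumes "0 < n" "2 * n \<le> m"
  shows "kbound m (2 * n) (vpk n) 3"
  unfolding kbound_def
proof
  fix y :: real
  let ?K = "\<lambda>\<kappa> j. \<Sum>q=-int (2*n)..int (2*n). \<kappa> q * cis (real_of_int q * (2 * pi * real j / real m - y))"
  have "?K (vpk n) j = 2 * ?K (fej (2 * n)) j - ?K (fej n) j" for j
    by (simp add: vpk_def left_diff_distrib sum_subtractf sum_distrib_left mult.assoc)
  then have "cmod (?K (vpk n) j) \<le> 2 * cmod (?K (fej (2 * n)) j) + cmod (?K (fej n) j)" for j
    using norm_triangle_ineq4[of "2 * ?K (fej (2 * n)) j" "?K (fej n) j"] by (simp add: norm_mult)
  then have "(\<Sum>j<m. cmod (?K (vpk n) j)) / real m \<le> (\<Sum>j<m. 2 * cmod (?K (fej (2 * n)) j) + cmod (?K (fej n) j)) / real m"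
    by (intro divide_right_mono sum_mono) auto
  also have "\<dots> = 2 * ((\<Sum>j<m. cmod (?K (fej (2 * n)) j)) / real m) + (\<Sum>j<m. cmod (?K (fej n) j)) / real m"
    by (simp add: sum.distrib add_divide_distrib sum_distrib_left)
  also have "\<dots> \<le> 2 * 1 + 1"
    using kbound_fej[of "2*n" "2*n" m] kbound_fej[of n "2*n" m] assms
    unfolding kbound_def by (intro add_mono mult_left_mono) auto
  finally show "(\<Sum>j<m. cmod (?K (vpk n) j)) / real m \<le> 3" by simp
qed

section \<open>Coefficient functions of integrable type\<close>

definition smooth :: "nat \<Rightarrow> (nat \<Rightarrow> nat) \<Rightarrow> (nat \<Rightarrow> nat) \<Rightarrow> (nat \<Rightarrow> int \<Rightarrow> complex) \<Rightarrow>
    ((nat \<Rightarrow> int) \<Rightarrow> complex) \<Rightarrow> (nat \<Rightarrow> nat) \<Rightarrow> complex" where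
  "smooth d n D \<kappa> c k = (\<Sum>q\<in>fbox d D. (\<Prod>l<d. \<kappa> l (q l)) * c q * zchr d n q k)"

text \<open>A norm bound on a coefficient function that is implied by the corresponding
  bound on the L1 norm of a function with these Fourier coefficients.\<close>

definition L1le :: "nat \<Rightarrow> ((nat \<Rightarrow> int) \<Rightarrow> complex) \<Rightarrow> real \<Rightarrow> bool" where
  "L1le d c B \<longleftrightarrow> (\<forall>n D \<kappa> b. (\<forall>l<d. 0 < n l \<and> kbound (n l) (D l) (\<kappa> l) (b l)) \<longrightarrow>
     gavg d n (\<lambda>k. cmod (smooth d n D \<kappa> c k)) \<le> B * (\<Prod>l<d. b l))"

lemma L1leD:
  assumes "L1le d c B" "\<And>l. l < d \<Longrightarrow> 0 < n l" "\<And>l. l < d \<Longrightarrow> kbound (n l) (D l) (\<kappa> l) (b l)"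
  shows "gavg d n (\<lambda>k. cmod (smooth d n D \<kappa> c k)) \<le> B * (\<Prod>l<d. b l)"
  using assms unfolding L1le_def by simp

lemma L1le_mono:
  assumes c: "L1le d c B" and B: "B \<le> B'"
  shows "L1le d c B'"
  unfolding L1le_def
proof (intro allI impI)
  fix n D \<kappa> b assume h: "\<forall>l<d. 0 < n l \<and> kbound (n l) (D l) (\<kappa> l) (b l)"
  have "0 \<le> b l" if "l < d" for l
  proof -
    have "0 \<le> (\<Sum>j<n l. cmod (\<Sum>q=-int (D l)..int (D l). \<kappa> l q * cis (real_of_int q * (2 * pi * real j / real (n l) - 0)))) / real (n l)"
      by (simp add: sum_nonneg)
    also have "\<dots> \<le> b l" using h that unfolding kbound_def by blast
    finally show ?thesis .
  qed
  then have "B * (\<Prod>l<d. b l) \<le> B' * (\<Prod>l<d. b l)"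
    using B by (intro mult_right_mono prod_nonneg) auto
  then show "gavg d n (\<lambda>k. cmod (smooth d n D \<kappa> c k)) \<le> B' * (\<Prod>l<d. b l)"
    using L1leD[OF c, of n D \<kappa> b] h by (auto elim: order_trans)
qed

definition trigpoly :: "nat \<Rightarrow> ((nat \<Rightarrow> int) \<Rightarrow> complex) \<Rightarrow> bool" where
  "trigpoly d p \<longleftrightarrow> finite {q. p q \<noteq> 0} \<and> {q. p q \<noteq> 0} \<subseteq> Zd d"

text \<open>Stands for being the coefficient function of an integrable function. Density of the
  trigonometric polynomials supplies the property in \<open>L1type_fcoeff\<close>, and the choice of
  the boxes rests on it alone.\<close>

definition L1type :: "nat \<Rightarrow> ((nat \<Rightarrow> int) \<Rightarrow> complex) \<Rightarrow> bool" where
  "L1type d c \<longleftrightarrow> (\<forall>\<eta>>0. \<exists>p. trigpoly d p \<and> L1le d (\<lambda>q. c q - p q) \<eta>)"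

lemma trigpoly_subset_fbox:
  assumes "trigpoly d p"
  shows "\<exists>D. {q. p q \<noteq> 0} \<subseteq> fbox d (\<lambda>_. D)"
proof -
  define X where "X = insert 0 ((\<lambda>(q,l). nat \<bar>q l\<bar>) ` ({q. p q \<noteq> 0} \<times> {..<d}))"
  have fin: "finite X" using assms by (simp add: X_def trigpoly_def)
  have "\<bar>q l\<bar> \<le> int (Max X)" if "p q \<noteq> 0" "l < d" for q l
  proof -
    have "nat \<bar>q l\<bar> \<in> X" using that by (force simp: X_def)
    then have "nat \<bar>q l\<bar> \<le> Max X" by (rule Max_ge[OF fin])
    then show ?thesis by linarith
  qed
  then show ?thesis using assms by (intro exI[of _ "Max X"]) (auto simp: fbox_def trigpoly_def)
qed

lemma fbox_mono: "(\<And>l. l < d \<Longrightarrow> M l \<le> M' l) \<Longrightarrow> fbox d M \<subseteq> fbox d M'"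
  by (fastforce simp: fbox_def)

section \<open>Sharp cut-offs, one coordinate at a time\<close>

definition kap :: "nat \<Rightarrow> (nat \<Rightarrow> nat) \<Rightarrow> nat \<Rightarrow> nat \<Rightarrow> int \<Rightarrow> complex" where
  "kap N M l j q = (if j < l \<and> int (M j) < \<bar>q\<bar> then 0 else fej N q)"

text \<open>Stage \<open>l\<close> of the construction. Stage 0 is the Fejer mean with parameter
  \<open>N\<close>, and stage \<open>d\<close> is the Fejer-weighted sum over the box
  \<open>fbox d M\<close> as soon as \<open>N\<close> dominates \<open>M\<close>.\<close>

abbreviation cutoff where
  "cutoff d n N M l \<equiv> smooth d n (\<lambda>_. N) (kap N M l)"

lemma smooth_diff: "smooth d n D \<kappa> (\<lambda>q. c q - p q) k = smooth d n D \<kappa> c k - smooth d n D \<kappa> p k"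
  by (simp add: smooth_def right_diff_distrib left_diff_distrib sum_subtractf)

lemma kbound_kap:
  assumes "0 < N" "N \<le> n"
  shows "kbound n N (kap N M l j) (if j < l then 2 * real (M j) + 1 else 1)"
proof (cases "j < l")
  case True
  then have "kap N M l j = (\<lambda>q. if int (M j) < \<bar>q\<bar> then 0 else fej N q)" by (auto simp: kap_def)
  then show ?thesis using True kbound_truncated_fej[of n N "M j" N] assms by simp
next
  case False
  then have "kap N M l j = fej N" by (auto simp: kap_def)
  then show ?thesis using False kbound_fej[of N N n] assms by simp
qed

text \<open>Two consecutive stages differ by a sharp cut-off in coordinate \<open>l\<close>, which
  is a one-dimensional partial sum. The condition on \<open>n l\<close> excludes aliasing between
  the frequencies up to \<open>N\<close> and the window up to \<open>M l\<close>.\<close>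

lemma smooth_kap_Suc:
  assumes l: "l < d" and n: "N + M l < n l"
  shows "cutoff d n N M (Suc l) c k = psum l n (M l) (cutoff d n N M l c) k"
proof -
  have "psum l n (M l) (cutoff d n N M l c) k =
    (\<Sum>q\<in>fbox d (\<lambda>_. N). (if \<bar>q l\<bar> \<le> int (M l) then (\<Prod>j<d. kap N M l j (q j)) * c q else 0) * zchr d n q k)"
    unfolding smooth_def
  proof (rule psum_trig_poly[OF l])
    fix q assume "q \<in> fbox d (\<lambda>_. N)"
    then have "\<bar>q l\<bar> \<le> int N" using l by (simp add: fbox_def)
    then show "\<bar>q l\<bar> + int (M l) < int (n l)" using n by linarith
  qed (use n in auto)
  also have "\<dots> = cutoff d n N M (Suc l) c k"
    unfolding smooth_def
  proof (intro sum.cong refl)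
    fix q
    have "(if \<bar>q l\<bar> \<le> int (M l) then \<Prod>j<d. kap N M l j (q j) else 0) = (\<Prod>j<d. kap N M (Suc l) j (q j))"
    proof (cases "\<bar>q l\<bar> \<le> int (M l)")
      case True
      then have "kap N M (Suc l) j (q j) = kap N M l j (q j)" for j
        by (auto simp: kap_def less_Suc_eq)
      then show ?thesis using True by simp
    next
      case False
      then have "kap N M (Suc l) l (q l) = 0" by (simp add: kap_def)
      then have "(\<Prod>j<d. kap N M (Suc l) j (q j)) = 0" using l by (intro prod_zero) auto
      then show ?thesis using False by simp
    qed
    then show "(if \<bar>q l\<bar> \<le> int (M l) then (\<Prod>j<d. kap N M l j (q j)) * c q else 0) * zchr d n q k
      = (\<Prod>j<d. kap N M (Suc l) j (q j)) * c q * zchr d n q k" by (auto split: if_splits)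
  qed
  finally show ?thesis by simp
qed

definition grid_ev :: "nat \<Rightarrow> ((nat \<Rightarrow> nat) \<Rightarrow> bool) \<Rightarrow> bool" where
  "grid_ev d P \<longleftrightarrow> (\<exists>n0. \<forall>n. (\<forall>j<d. n0 \<le> n j) \<longrightarrow> P n)"

lemma grid_ev_ge: "grid_ev d (\<lambda>n. \<forall>j<d. m \<le> n j)"
  unfolding grid_ev_def by auto

lemma grid_ev_conj: "grid_ev d P \<Longrightarrow> grid_ev d Q \<Longrightarrow> grid_ev d (\<lambda>n. P n \<and> Q n)"
proof -
  assume "grid_ev d P" "grid_ev d Q"
  then obtain m m' where m: "\<And>n. (\<forall>j<d. m \<le> n j) \<Longrightarrow> P n" "\<And>n. (\<forall>j<d. m' \<le> n j) \<Longrightarrow> Q n"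
    unfolding grid_ev_def by blast
  then show ?thesis unfolding grid_ev_def by (intro exI[of _ "max m m'"]) auto
qed

lemma grid_ev_mono: "grid_ev d P \<Longrightarrow> (\<And>n. P n \<Longrightarrow> Q n) \<Longrightarrow> grid_ev d Q"
  unfolding grid_ev_def by blast

lemma smooth_poly_kap_Suc:
  assumes "\<And>q. p q \<noteq> 0 \<Longrightarrow> \<bar>q l\<bar> \<le> int (M l)"
  shows "smooth d n D (kap N M (Suc l)) p k = smooth d n D (kap N M l) p k"
  unfolding smooth_def
proof (intro sum.cong refl)
  fix q
  show "(\<Prod>j<d. kap N M (Suc l) j (q j)) * p q * zchr d n q k = (\<Prod>j<d. kap N M l j (q j)) * p q * zchr d n q k"
  proof (cases "p q = 0")
    case False
    then have "kap N M (Suc l) j (q j) = kap N M l j (q j)" for j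
      using assms[of q] by (auto simp: kap_def less_Suc_eq)
    then show ?thesis by simp
  qed simp
qed

text \<open>The cut-off in each coordinate is chosen after those in the earlier coordinates. At that stage
  the earlier cut-offs are bounded operators on L1 (with a bad constant), and the one-dimensional
  inequality bounds the new cut-off uniformly in the smoothing parameter N.\<close>

lemma iterated_cutoff:
  assumes fin: "finite I" and c: "\<And>i. i \<in> I \<Longrightarrow> L1type d (c i)" and \<delta>: "0 < \<delta>" and l: "l \<le> d"
  shows "\<exists>M. (\<forall>j<l. K \<le> M j) \<and> (\<forall>i\<in>I. \<forall>N>0. grid_ev d (\<lambda>n.
     gavg d n (\<lambda>k. sqrt (cmod (cutoff d n N M 0 (c i) k - cutoff d n N M l (c i) k)))
       \<le> real l * \<delta>))"
  using l
proof (induction l)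
  case 0
  show ?case by (auto simp: grid_ev_def gavg_def)
next
  case (Suc l)
  then have ld: "l < d" by simp
  obtain M where MK: "\<forall>j<l. K \<le> M j" and M: "\<And>i N. i \<in> I \<Longrightarrow> 0 < N \<Longrightarrow> grid_ev d (\<lambda>n.
     gavg d n (\<lambda>k. sqrt (cmod (cutoff d n N M 0 (c i) k - cutoff d n N M l (c i) k)))
       \<le> real l * \<delta>)"
    using Suc by auto
  define B where "B = (\<Prod>j<d. if j < l then 2 * real (M j) + 1 else 1)"
  have B: "0 < B" unfolding B_def by (intro prod_pos) auto
  \<comment> \<open>Here 14 is 1 + 13: the remainder \<open>H\<close> enters once itself and once
    through \<open>gavg_psum\<close>. \<open>B\<close> bounds the kernels of the earlier cut-offs,
    so the mean of \<open>cmod (H k)\<close> is at most \<open>\<eta> * B\<close>, whose root is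
    \<open>\<delta> / 14\<close>.\<close>
  define \<eta> where "\<eta> = (\<delta> / 14)\<^sup>2 / B"
  have \<eta>: "0 < \<eta>" using \<delta> B by (simp add: \<eta>_def)
  have "\<forall>i. \<exists>p. i \<in> I \<longrightarrow> trigpoly d p \<and> L1le d (\<lambda>q. c i q - p q) \<eta>"
    using c \<eta> unfolding L1type_def by blast
  then obtain p where p: "\<And>i. i \<in> I \<Longrightarrow> trigpoly d (p i)" "\<And>i. i \<in> I \<Longrightarrow> L1le d (\<lambda>q. c i q - p i q) \<eta>"
    by metis
  have "\<forall>i. \<exists>D. i \<in> I \<longrightarrow> {q. p i q \<noteq> 0} \<subseteq> fbox d (\<lambda>_. D)"
    using trigpoly_subset_fbox p(1) by blast
  then obtain D where D: "\<And>i. i \<in> I \<Longrightarrow> {q. p i q \<noteq> 0} \<subseteq> fbox d (\<lambda>_. D i)"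
    by metis
  \<comment> \<open>The new cut-off is at least the degree of each of the finitely many polynomials,
    so it leaves all of them unchanged; \<open>K\<close> makes the box as large as desired.\<close>
  define M' where "M' = M(l := Max (insert K (D ` I)))"
  have M'l: "K \<le> M' l" "\<And>i. i \<in> I \<Longrightarrow> D i \<le> M' l" using fin by (auto simp: M'_def)
  have kap_eq: "kap N M' j = kap N M j" if "j \<le> l" for N j
    using that by (auto simp: kap_def M'_def fun_eq_iff)
  show ?case
  proof (intro exI[of _ M'] conjI ballI allI impI)
    fix j assume "j < Suc l" then show "K \<le> M' j" using MK M'l by (auto simp: M'_def less_Suc_eq)
  next
    fix i and N :: nat assume i: "i \<in> I" and N: "0 < N"
    \<comment> \<open>Large enough to exclude aliasing and to meet the hypothesis of the
      one-dimensional inequality. This threshold may depend on \<open>N\<close>, whereas the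
      cut-offs were fixed before \<open>N\<close>.\<close>
    define m where "m = N + M' l + 1 + nat \<lceil>4 * pi * (real (2 * M' l + 1))\<^sup>2\<rceil>"
    have "grid_ev d (\<lambda>n. gavg d n (\<lambda>k. sqrt (cmod (cutoff d n N M 0 (c i) k - cutoff d n N M l (c i) k)))
       \<le> real l * \<delta> \<and> (\<forall>j<d. m \<le> n j))"
      by (intro grid_ev_conj M i N grid_ev_ge)
    then show "grid_ev d (\<lambda>n.
     gavg d n (\<lambda>k. sqrt (cmod (cutoff d n N M' 0 (c i) k - cutoff d n N M' (Suc l) (c i) k)))
       \<le> real (Suc l) * \<delta>)"
    proof (rule grid_ev_mono, elim conjE)
      fix n assume IH: "gavg d n (\<lambda>k. sqrt (cmod (cutoff d n N M 0 (c i) k - cutoff d n N M l (c i) k)))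
       \<le> real l * \<delta>" and n: "\<forall>j<d. m \<le> n j"
      have nl: "N + M' l < n l" "0 < n l" using n ld by (fastforce simp: m_def)+
      have "4 * pi * (real (2 * M' l + 1))\<^sup>2 \<le> real m"
        unfolding m_def using real_nat_ceiling_ge[of "4 * pi * (real (2 * M' l + 1))\<^sup>2"] by linarith
      also have "real m \<le> real (n l)" using n ld by simp
      finally have nl': "4 * pi * (real (2 * M' l + 1))\<^sup>2 \<le> real (n l)" .
      define h where "h q = c i q - p i q" for q
      define H where "H = cutoff d n N M' l h"
      have pol: "cutoff d n N M' (Suc l) (p i) k = cutoff d n N M' l (p i) k" for k
      proof (rule smooth_poly_kap_Suc)
        fix q assume "p i q \<noteq> 0"
        then have "q \<in> fbox d (\<lambda>_. D i)" using D[OF i] by blast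
        then have "\<bar>q l\<bar> \<le> int (D i)" using ld by (simp add: fbox_def)
        then show "\<bar>q l\<bar> \<le> int (M' l)" using M'l(2)[OF i] by linarith
      qed
      \<comment> \<open>Both stages treat the polynomial alike, so it cancels, and only the
        remainder \<open>h\<close>, small in L1, is exposed to the new cut-off.\<close>
      have diff: "cutoff d n N M' l (c i) k - cutoff d n N M' (Suc l) (c i) k
         = H k - psum l n (M' l) H k" for k
      proof -
        have "H k - psum l n (M' l) H k = cutoff d n N M' l h k - cutoff d n N M' (Suc l) h k"
          unfolding H_def using smooth_kap_Suc[of l d N M' n h k] ld nl(1) by simp
        then show ?thesis unfolding h_def smooth_diff pol by simp
      qed
      have A: "gavg d n (\<lambda>k. cmod (H k)) \<le> \<eta> * B"
      proof -
        have nj: "N \<le> n j" if "j < d" for j using n that by (force simp: m_def)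
        have "gavg d n (\<lambda>k. cmod (H k)) \<le> \<eta> * (\<Prod>j<d. if j < l then 2 * real (M' j) + 1 else 1)"
          unfolding H_def h_def
        proof (rule L1leD[OF p(2)[OF i]])
          fix j assume "j < d"
          then show "kbound (n j) N (kap N M' l j) (if j < l then 2 * real (M' j) + 1 else 1)" "0 < n j"
            using kbound_kap[OF N nj] N nj[of j] by auto
        qed
        also have "(\<Prod>j<d. if j < l then 2 * real (M' j) + 1 else 1) = B"
          unfolding B_def by (intro prod.cong) (auto simp: M'_def)
        finally show ?thesis .
      qed
      also have "\<eta> * B = (\<delta> / 14)\<^sup>2" using B by (simp add: \<eta>_def)
      finally have sq: "sqrt (gavg d n (\<lambda>k. cmod (H k))) \<le> \<delta> / 14"
        using \<delta> by (intro real_le_lsqrt gavg_nonneg) auto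
      have "gavg d n (\<lambda>k. sqrt (cmod (cutoff d n N M' 0 (c i) k - cutoff d n N M' (Suc l) (c i) k)))
        \<le> gavg d n (\<lambda>k. sqrt (cmod (cutoff d n N M 0 (c i) k - cutoff d n N M l (c i) k))
            + (sqrt (cmod (H k)) + sqrt (cmod (psum l n (M' l) H k))))"
      proof (rule gavg_mono)
        fix k
        let ?a = "cutoff d n N M' 0 (c i) k" and ?b = "cutoff d n N M' l (c i) k"
          and ?c = "cutoff d n N M' (Suc l) (c i) k"
        have "sqrt (cmod (?a - ?c)) = sqrt (cmod ((?a - ?b) + (?b - ?c)))" by simp
        also have "\<dots> \<le> sqrt (cmod (?a - ?b)) + sqrt (cmod (?b - ?c))" by (rule sqrt_cmod_add)
        also have "sqrt (cmod (?b - ?c)) \<le> sqrt (cmod (H k)) + sqrt (cmod (psum l n (M' l) H k))"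
          unfolding diff by (rule sqrt_cmod_diff)
        finally show "sqrt (cmod (?a - ?c)) \<le> sqrt (cmod (cutoff d n N M 0 (c i) k - cutoff d n N M l (c i) k))
            + (sqrt (cmod (H k)) + sqrt (cmod (psum l n (M' l) H k)))"
          by (simp add: kap_eq)
      qed
      also have "\<dots> \<le> real l * \<delta> + (sqrt (gavg d n (\<lambda>k. cmod (H k))) + 13 * sqrt (gavg d n (\<lambda>k. cmod (H k))))"
        unfolding gavg_add by (intro add_mono IH gavg_sqrt_le gavg_psum ld nl nl') auto
      also have "\<dots> \<le> real (Suc l) * \<delta>" using sq by (simp add: algebra_simps)
      finally show "gavg d n (\<lambda>k. sqrt (cmod (cutoff d n N M' 0 (c i) k - cutoff d n N M' (Suc l) (c i) k)))
       \<le> real (Suc l) * \<delta>" .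
    qed
  qed
qed

section \<open>Box partial sums approximate in the L^(1/2) mean on fine grids\<close>

lemma fej_tendsto: "(\<lambda>N. fej N q) \<longlonglongrightarrow> 1"
proof -
  have "(\<lambda>N. max 0 (1 - \<bar>real_of_int q\<bar> / real N)) \<longlonglongrightarrow> max 0 (1 - 0)"
    by (intro tendsto_intros real_tendsto_divide_at_top[OF tendsto_const] filterlim_real_sequentially)
  then have "(\<lambda>N. complex_of_real (max 0 (1 - \<bar>real_of_int q\<bar> / real N))) \<longlonglongrightarrow> of_real (max 0 (1 - 0))"
    by (rule tendsto_of_real)
  then show ?thesis by (simp add: fej_def)
qed

text \<open>Characters have modulus one, so the estimate is uniform in the grid and its points, and
  \<open>N\<close> can be fixed before \<open>n\<close>.\<close>

lemma fejer_sum_approx: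
  assumes "finite Q" "0 < \<epsilon>"
  shows "\<forall>\<^sub>F N in sequentially. \<forall>n k. cmod ((\<Sum>q\<in>Q. a q * zchr d n q k) - (\<Sum>q\<in>Q. (\<Prod>l<d. fej N (q l)) * a q * zchr d n q k)) \<le> \<epsilon>"
proof -
  have "(\<lambda>N. \<Sum>q\<in>Q. cmod (1 - (\<Prod>l<d. fej N (q l))) * cmod (a q)) \<longlonglongrightarrow> (\<Sum>q\<in>Q. cmod (1 - (\<Prod>l<d. 1)) * cmod (a q))"
    by (intro tendsto_intros fej_tendsto)
  then have "\<forall>\<^sub>F N in sequentially. (\<Sum>q\<in>Q. cmod (1 - (\<Prod>l<d. fej N (q l))) * cmod (a q)) < \<epsilon>"
    using assms(2) by (intro order_tendstoD) auto
  then show ?thesis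
  proof (rule eventually_mono, intro allI)
    fix N n k assume *: "(\<Sum>q\<in>Q. cmod (1 - (\<Prod>l<d. fej N (q l))) * cmod (a q)) < \<epsilon>"
    have "cmod ((\<Sum>q\<in>Q. a q * zchr d n q k) - (\<Sum>q\<in>Q. (\<Prod>l<d. fej N (q l)) * a q * zchr d n q k))
      = cmod (\<Sum>q\<in>Q. (1 - (\<Prod>l<d. fej N (q l))) * a q * zchr d n q k)"
      by (simp add: sum_subtractf left_diff_distrib)
    also have "\<dots> \<le> (\<Sum>q\<in>Q. cmod (1 - (\<Prod>l<d. fej N (q l))) * cmod (a q))"
      by (intro sum_norm_le) (simp add: norm_mult)
    finally show "cmod ((\<Sum>q\<in>Q. a q * zchr d n q k) - (\<Sum>q\<in>Q. (\<Prod>l<d. fej N (q l)) * a q * zchr d n q k)) \<le> \<epsilon>"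
      using * by linarith
  qed
qed

lemma smooth_kap_all:
  assumes "\<And>l. l < d \<Longrightarrow> M l \<le> N"
  shows "cutoff d n N M d c k = (\<Sum>q\<in>fbox d M. (\<Prod>l<d. fej N (q l)) * c q * zchr d n q k)"
  unfolding smooth_def
proof (rule sum.mono_neutral_cong_right)
  show "fbox d M \<subseteq> fbox d (\<lambda>_. N)" using assms by (rule fbox_mono)
  show "\<forall>q\<in>fbox d (\<lambda>_. N) - fbox d M. (\<Prod>l<d. kap N M d l (q l)) * c q * zchr d n q k = 0"
  proof
    fix q assume "q \<in> fbox d (\<lambda>_. N) - fbox d M"
    then obtain l where "l < d" "\<not> \<bar>q l\<bar> \<le> int (M l)" by (auto simp: fbox_def)
    then have "(\<Prod>l<d. kap N M d l (q l)) = 0" by (intro prod_zero bexI[of _ l]) (auto simp: kap_def)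
    then show "(\<Prod>l<d. kap N M d l (q l)) * c q * zchr d n q k = 0" by simp
  qed
  show "(\<Prod>l<d. kap N M d l (q l)) * c q * zchr d n q k = (\<Prod>l<d. fej N (q l)) * c q * zchr d n q k"
    if "q \<in> fbox d M" for q
  proof -
    have "(\<Prod>l<d. kap N M d l (q l)) = (\<Prod>l<d. fej N (q l))"
      using that by (intro prod.cong) (auto simp: kap_def fbox_def)
    then show ?thesis by simp
  qed
qed simp

text \<open>The bound of \<open>iterated_cutoff\<close> is uniform in the auxiliary parameter
  \<open>N\<close>, and the two sums to be compared are finite. So \<open>N\<close> is chosen after
  \<open>p\<close> and \<open>M\<close>, with Fejer weights so close to 1 that they can be
  removed.\<close>

lemma partial_sums_converge:
  assumes fin: "finite I" and c: "\<And>i. i \<in> I \<Longrightarrow> L1type d (c i)" and \<epsilon>: "0 < \<epsilon>"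
  shows "\<exists>M. (\<forall>j<d. K \<le> M j) \<and> (\<forall>i\<in>I. \<exists>p. trigpoly d p \<and> L1le d (\<lambda>q. c i q - p q) \<epsilon> \<and>
    grid_ev d (\<lambda>n. gavg d n (\<lambda>k. sqrt (cmod ((\<Sum>q | p q \<noteq> 0. p q * zchr d n q k) - (\<Sum>q\<in>fbox d M. c i q * zchr d n q k)))) \<le> \<epsilon>))"
proof -
  \<comment> \<open>The total error is \<open>(d + 3) * \<delta>\<close>: one
    \<open>\<delta>\<close> per coordinate for the cut-offs, one for the Fejer mean of
    \<open>c i - p\<close>, and two for removing the weights from the polynomial and from the box
    sum. The \<open>min\<close> also yields \<open>\<delta>\<^sup>2 \<le> \<epsilon>\<close>, since
    \<open>p\<close> is chosen within \<open>\<delta>\<^sup>2\<close>.\<close>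
  define \<delta> where "\<delta> = min \<epsilon> 1 / (real d + 3)"
  have \<delta>: "0 < \<delta>" "(real d + 3) * \<delta> \<le> \<epsilon>" using \<epsilon> by (auto simp: \<delta>_def)
  have \<delta>2: "\<delta>\<^sup>2 \<le> \<epsilon>"
  proof -
    have "\<delta> \<le> min \<epsilon> 1"
      unfolding \<delta>_def using \<epsilon> divide_left_mono[of 1 "real d + 3" "min \<epsilon> 1"] by simp
    then show ?thesis using \<delta>(1) mult_mono[of \<delta> \<epsilon> \<delta> 1] by (simp add: power2_eq_square)
  qed
  obtain M where MK: "\<forall>j<d. K \<le> M j" and M: "\<And>i N. i \<in> I \<Longrightarrow> 0 < N \<Longrightarrow> grid_ev d (\<lambda>n.
     gavg d n (\<lambda>k. sqrt (cmod (cutoff d n N M 0 (c i) k - cutoff d n N M d (c i) k)))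
       \<le> real d * \<delta>)"
    using iterated_cutoff[where c = c and K = K, OF fin c \<delta>(1) order_refl] by auto
  show ?thesis
  proof (intro exI[of _ M] conjI ballI)
    show "\<forall>j<d. K \<le> M j" by (rule MK)
  next
    fix i assume i: "i \<in> I"
    obtain p where p: "trigpoly d p" "L1le d (\<lambda>q. c i q - p q) (\<delta>\<^sup>2)"
      using c[OF i] zero_less_power[OF \<delta>(1), of 2] unfolding L1type_def by blast
    have pE: "L1le d (\<lambda>q. c i q - p q) \<epsilon>"
      by (rule L1le_mono[OF p(2) \<delta>2])
    obtain D where D: "{q. p q \<noteq> 0} \<subseteq> fbox d (\<lambda>_. D)" using trigpoly_subset_fbox[OF p(1)] by blast
    define Q where "Q = {q. p q \<noteq> 0}"
    have Q: "finite Q" using p(1) by (simp add: Q_def trigpoly_def)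
    have "\<forall>\<^sub>F N in sequentially. \<forall>n k. cmod ((\<Sum>q\<in>Q. p q * zchr d n q k) - (\<Sum>q\<in>Q. (\<Prod>l<d. fej N (q l)) * p q * zchr d n q k)) \<le> \<delta>\<^sup>2"
      using \<delta>(1) by (intro fejer_sum_approx Q) simp
    moreover have "\<forall>\<^sub>F N in sequentially. \<forall>n k. cmod ((\<Sum>q\<in>fbox d M. c i q * zchr d n q k) - (\<Sum>q\<in>fbox d M. (\<Prod>l<d. fej N (q l)) * c i q * zchr d n q k)) \<le> \<delta>\<^sup>2"
      using \<delta>(1) by (intro fejer_sum_approx) auto
    moreover have "\<forall>\<^sub>F N in sequentially. 1 + D + (\<Sum>l<d. M l) \<le> N" by (rule eventually_ge_at_top)
    ultimately have "\<forall>\<^sub>F N in sequentially.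
       (\<forall>n k. cmod ((\<Sum>q\<in>Q. p q * zchr d n q k) - (\<Sum>q\<in>Q. (\<Prod>l<d. fej N (q l)) * p q * zchr d n q k)) \<le> \<delta>\<^sup>2) \<and>
       (\<forall>n k. cmod ((\<Sum>q\<in>fbox d M. c i q * zchr d n q k) - (\<Sum>q\<in>fbox d M. (\<Prod>l<d. fej N (q l)) * c i q * zchr d n q k)) \<le> \<delta>\<^sup>2) \<and>
       1 + D + (\<Sum>l<d. M l) \<le> N" by eventually_elim auto
    from eventually_happens'[OF sequentially_bot this] obtain N where
      N1: "\<And>n k. cmod ((\<Sum>q\<in>Q. p q * zchr d n q k) - (\<Sum>q\<in>Q. (\<Prod>l<d. fej N (q l)) * p q * zchr d n q k)) \<le> \<delta>\<^sup>2" and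
      N2: "\<And>n k. cmod ((\<Sum>q\<in>fbox d M. c i q * zchr d n q k) - (\<Sum>q\<in>fbox d M. (\<Prod>l<d. fej N (q l)) * c i q * zchr d n q k)) \<le> \<delta>\<^sup>2" and
      N3: "1 + D + (\<Sum>l<d. M l) \<le> N" by blast
    have N: "0 < N" "D \<le> N" using N3 by auto
    have MN: "M l \<le> N" if "l < d" for l
      using member_le_sum[where i = l and A = "{..<d}" and f = M] that N3 by auto
    have k0: "kap N M 0 = (\<lambda>_. fej N)" by (auto simp: kap_def fun_eq_iff)
    have sp: "cutoff d n N M 0 p k = (\<Sum>q\<in>Q. (\<Prod>l<d. fej N (q l)) * p q * zchr d n q k)" for n k
      unfolding smooth_def k0
    proof (rule sum.mono_neutral_right)
      show "Q \<subseteq> fbox d (\<lambda>_. N)" using D N fbox_mono[of d "\<lambda>_. D" "\<lambda>_. N"] by (auto simp: Q_def)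
    qed (auto simp: Q_def)
    have "grid_ev d (\<lambda>n. gavg d n (\<lambda>k. sqrt (cmod (cutoff d n N M 0 (c i) k - cutoff d n N M d (c i) k)))
       \<le> real d * \<delta> \<and> (\<forall>j<d. N \<le> n j))"
      by (intro grid_ev_conj M i N grid_ev_ge)
    then have "grid_ev d (\<lambda>n. gavg d n (\<lambda>k. sqrt (cmod ((\<Sum>q\<in>Q. p q * zchr d n q k) - (\<Sum>q\<in>fbox d M. c i q * zchr d n q k)))) \<le> \<epsilon>)"
    proof (rule grid_ev_mono, elim conjE)
      fix n assume ch: "gavg d n (\<lambda>k. sqrt (cmod (cutoff d n N M 0 (c i) k - cutoff d n N M d (c i) k)))
       \<le> real d * \<delta>" and n: "\<forall>j<d. N \<le> n j"
      have n0: "0 < n j" if "j < d" for j using n that N by force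
      define h where "h q = c i q - p q" for q
      have "gavg d n (\<lambda>k. cmod (cutoff d n N M 0 h k)) \<le> \<delta>\<^sup>2 * (\<Prod>l<d. 1)"
        unfolding h_def
      proof (rule L1leD[OF p(2) n0])
        fix j assume "j < d"
        then show "kbound (n j) N (kap N M 0 j) 1"
          using kbound_kap[OF N(1), of "n j" M 0 j] n by simp
      qed
      then have "sqrt (gavg d n (\<lambda>k. cmod (cutoff d n N M 0 h k))) \<le> \<delta>"
        using \<delta>(1) by (intro real_le_lsqrt gavg_nonneg) auto
      moreover have "gavg d n (\<lambda>k. sqrt (cmod (cutoff d n N M 0 h k))) \<le> sqrt (gavg d n (\<lambda>k. cmod (cutoff d n N M 0 h k)))"
        by (rule gavg_sqrt_le) simp
      ultimately have hb: "gavg d n (\<lambda>k. sqrt (cmod (cutoff d n N M 0 h k))) \<le> \<delta>" by linarith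
      have "gavg d n (\<lambda>k. sqrt (cmod ((\<Sum>q\<in>Q. p q * zchr d n q k) - (\<Sum>q\<in>fbox d M. c i q * zchr d n q k)))) \<le>
        gavg d n (\<lambda>k. sqrt (cmod (cutoff d n N M 0 (c i) k - cutoff d n N M d (c i) k))
           + sqrt (cmod (cutoff d n N M 0 h k)) + 2 * \<delta>)"
      proof (rule gavg_mono)
        fix k
        let ?P = "\<Sum>q\<in>Q. p q * zchr d n q k" and ?S = "\<Sum>q\<in>fbox d M. c i q * zchr d n q k"
        let ?P' = "cutoff d n N M 0 p k" and ?S' = "cutoff d n N M d (c i) k"
        let ?C = "cutoff d n N M 0 (c i) k" and ?H = "cutoff d n N M 0 h k"
        have PP: "sqrt (cmod (?P - ?P')) \<le> \<delta>"
          unfolding sp using N1[of n k] \<delta>(1) by (intro real_le_lsqrt) auto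
        have SS: "sqrt (cmod (?S - ?S')) \<le> \<delta>"
          using N2[of n k] \<delta>(1) smooth_kap_all[of d M N n "c i" k] MN by (intro real_le_lsqrt) auto
        \<comment> \<open>With the Fejer mean of \<open>c i\<close> as \<open>z\<close>, the three
          groups are the removal of the weights, the sharp cut-offs, and the Fejer mean of
          \<open>c i - p\<close>.\<close>
        have "x - y = (((x - x') - (y - y')) + (z - y')) - (z - x')" for x y x' y' z :: complex
          by simp
        from this[of ?P ?S ?P' ?S' ?C]
        have PS: "?P - ?S = (((?P - ?P') - (?S - ?S')) + (?C - ?S')) - ?H"
          unfolding h_def smooth_diff .
        have "sqrt (cmod (?P - ?S)) \<le> sqrt (cmod (((?P - ?P') - (?S - ?S')) + (?C - ?S'))) + sqrt (cmod ?H)"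
          by (subst PS) (rule sqrt_cmod_diff)
        also have "sqrt (cmod (((?P - ?P') - (?S - ?S')) + (?C - ?S'))) \<le> sqrt (cmod ((?P - ?P') - (?S - ?S'))) + sqrt (cmod (?C - ?S'))"
          by (rule sqrt_cmod_add)
        also have "sqrt (cmod ((?P - ?P') - (?S - ?S'))) \<le> sqrt (cmod (?P - ?P')) + sqrt (cmod (?S - ?S'))"
          by (rule sqrt_cmod_diff)
        finally show "sqrt (cmod (?P - ?S)) \<le> sqrt (cmod (?C - ?S')) + sqrt (cmod ?H) + 2 * \<delta>"
          using PP SS by linarith
      qed
      also have "\<dots> = gavg d n (\<lambda>k. sqrt (cmod (cutoff d n N M 0 (c i) k - cutoff d n N M d (c i) k)))
           + gavg d n (\<lambda>k. sqrt (cmod (cutoff d n N M 0 h k))) + 2 * \<delta>"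
        unfolding gavg_add by (simp add: gavg_const n0)
      also have "\<dots> \<le> real d * \<delta> + \<delta> + 2 * \<delta>" using ch hb by linarith
      also have "\<dots> \<le> \<epsilon>" using \<delta>(2) by (simp add: algebra_simps)
      finally show "gavg d n (\<lambda>k. sqrt (cmod ((\<Sum>q\<in>Q. p q * zchr d n q k) - (\<Sum>q\<in>fbox d M. c i q * zchr d n q k)))) \<le> \<epsilon>" .
    qed
    then show "\<exists>p. trigpoly d p \<and> L1le d (\<lambda>q. c i q - p q) \<epsilon> \<and>
       grid_ev d (\<lambda>n. gavg d n (\<lambda>k. sqrt (cmod ((\<Sum>q | p q \<noteq> 0. p q * zchr d n q k) - (\<Sum>q\<in>fbox d M. c i q * zchr d n q k)))) \<le> \<epsilon>)"
      using p(1) pE unfolding Q_def by blast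
  qed
qed

section \<open>Toeplitz and circulant matrices with scalar coefficients\<close>

definition mdiff :: "nat \<Rightarrow> (nat \<Rightarrow> nat) \<Rightarrow> (nat \<Rightarrow> nat) \<Rightarrow> nat \<Rightarrow> int" where
  "mdiff d \<alpha> \<beta> = (\<lambda>l. if l < d then int (\<alpha> l) - int (\<beta> l) else 0)"

text \<open>The combination of the shifts by \<open>q\<close> with coefficients \<open>a q\<close>,
  in the form of \<open>mshift_eq\<close>. An entry is a sum over \<open>Q\<close>, since several
  frequencies may be congruent modulo \<open>n\<close>.\<close>

definition circ :: "nat \<Rightarrow> (nat \<Rightarrow> nat) \<Rightarrow> (nat \<Rightarrow> int) set \<Rightarrow> ((nat \<Rightarrow> int) \<Rightarrow> complex) \<Rightarrow>
    (nat \<Rightarrow> nat) \<Rightarrow> (nat \<Rightarrow> nat) \<Rightarrow> complex" where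
  "circ d n Q a \<alpha> \<beta> = (\<Sum>q\<in>Q. if \<forall>l<d. int (n l) dvd int (\<alpha> l) - int (\<beta> l) - q l then a q else 0)"

lemma circ_diag:
  assumes n: "\<And>l. l < d \<Longrightarrow> 0 < n l"
  shows "(\<Sum>k\<in>lam d n. (\<Sum>q\<in>Q. a q * zchr d n q k) * zchr d n (\<lambda>l. int (\<beta> l) - int (\<alpha> l)) k) / of_nat (Nsize d n)
    = circ d n Q a \<alpha> \<beta>"
proof -
  have N: "0 < Nsize d n" using n by (rule Nsize_pos)
  have "(\<Sum>k\<in>lam d n. (\<Sum>q\<in>Q. a q * zchr d n q k) * zchr d n (\<lambda>l. int (\<beta> l) - int (\<alpha> l)) k)
    = (\<Sum>q\<in>Q. a q * (\<Sum>k\<in>lam d n. zchr d n (\<lambda>l. q l + (int (\<beta> l) - int (\<alpha> l))) k))"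
    unfolding sum_distrib_right sum_distrib_left zchr_add
    by (subst sum.swap) (simp add: mult.assoc)
  also have "\<dots> = (\<Sum>q\<in>Q. if \<forall>l<d. int (n l) dvd int (\<alpha> l) - int (\<beta> l) - q l then a q * of_nat (Nsize d n) else 0)"
  proof (intro sum.cong refl)
    fix q
    have "int (n l) dvd q l + (int (\<beta> l) - int (\<alpha> l)) \<longleftrightarrow> int (n l) dvd int (\<alpha> l) - int (\<beta> l) - q l" for l
      using dvd_minus_iff[of "int (n l)" "q l + (int (\<beta> l) - int (\<alpha> l))"] by (simp add: algebra_simps)
    then show "a q * (\<Sum>k\<in>lam d n. zchr d n (\<lambda>l. q l + (int (\<beta> l) - int (\<alpha> l))) k)
      = (if \<forall>l<d. int (n l) dvd int (\<alpha> l) - int (\<beta> l) - q l then a q * of_nat (Nsize d n) else 0)"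
      using sum_zchr[of d n "\<lambda>l. q l + (int (\<beta> l) - int (\<alpha> l))"] n by auto
  qed
  finally have eq: "(\<Sum>k\<in>lam d n. (\<Sum>q\<in>Q. a q * zchr d n q k) * zchr d n (\<lambda>l. int (\<beta> l) - int (\<alpha> l)) k)
    = (\<Sum>q\<in>Q. if \<forall>l<d. int (n l) dvd int (\<alpha> l) - int (\<beta> l) - q l then a q * of_nat (Nsize d n) else 0)" .
  show ?thesis
    unfolding circ_def eq sum_divide_distrib using N by (intro sum.cong refl) auto
qed

text \<open>Markov's inequality on the grid.\<close>

lemma card_large_le:
  assumes "0 < \<delta>" "gavg d n g \<le> \<epsilon>" "\<And>k. 0 \<le> g k" "\<And>k. P k \<Longrightarrow> \<delta> \<le> g k"
    and n: "\<And>l. l < d \<Longrightarrow> 0 < n l"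
  shows "real (card {k\<in>lam d n. P k}) \<le> \<epsilon> / \<delta> * real (Nsize d n)"
proof -
  have N: "0 < real (Nsize d n)" using n by (simp add: Nsize_pos)
  have "\<delta> * real (card {k\<in>lam d n. P k}) = (\<Sum>k\<in>{k\<in>lam d n. P k}. \<delta>)" by simp
  also have "\<dots> \<le> (\<Sum>k\<in>{k\<in>lam d n. P k}. g k)" using assms(4) by (intro sum_mono) auto
  also have "\<dots> \<le> (\<Sum>k\<in>lam d n. g k)" using assms(3) by (intro sum_mono2) auto
  also have "\<dots> \<le> \<epsilon> * real (Nsize d n)" using assms(2) N by (simp add: gavg_def field_simps)
  finally show ?thesis using assms(1) by (simp add: field_simps)
qed

lemma csplits_circulant:
  assumes n: "\<And>l. l < d \<Longrightarrow> 0 < n l" and \<epsilon>: "0 < \<epsilon>"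
    and small: "gavg d n (\<lambda>k. sqrt (cmod ((\<Sum>q\<in>Q. a q * zchr d n q k) - (\<Sum>q\<in>Q'. a' q * zchr d n q k)))) \<le> \<epsilon>"
  shows "csplits (lam d n) (\<lambda>\<alpha> \<beta>. circ d n Q a \<alpha> \<beta> - circ d n Q' a' \<alpha> \<beta>) (sqrt \<epsilon> * real (Nsize d n)) \<epsilon>"
proof -
  define w where "w k = (\<Sum>q\<in>Q. a q * zchr d n q k) - (\<Sum>q\<in>Q'. a' q * zchr d n q k)" for k
  have "csplits (lam d n) (\<lambda>\<alpha> \<beta>. circ d n Q a \<alpha> \<beta> - circ d n Q' a' \<alpha> \<beta>) (real (card {k\<in>lam d n. \<epsilon> < cmod (w k)})) \<epsilon>"
  proof (rule csplits_diag[OF n])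
    show "circ d n Q a \<alpha> \<beta> - circ d n Q' a' \<alpha> \<beta> =
      (\<Sum>k\<in>lam d n. w k * zchr d n (\<lambda>l. int (\<beta> l) - int (\<alpha> l)) k) / of_nat (Nsize d n)" for \<alpha> \<beta>
      using circ_diag[where d = d and n = n and Q = Q and a = a and \<alpha> = \<alpha> and \<beta> = \<beta>]
        circ_diag[where d = d and n = n and Q = Q' and a = a' and \<alpha> = \<alpha> and \<beta> = \<beta>] n
      by (simp add: w_def left_diff_distrib sum_subtractf diff_divide_distrib)
  qed (use \<epsilon> in auto)
  \<comment> \<open>A modulus above \<open>\<epsilon>\<close> has a square root above
    \<open>sqrt \<epsilon>\<close>, so the fraction of large eigenvalues is at most
    \<open>\<epsilon> / sqrt \<epsilon>\<close>.\<close>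
  moreover have "real (card {k\<in>lam d n. \<epsilon> < cmod (w k)}) \<le> \<epsilon> / sqrt \<epsilon> * real (Nsize d n)"
    using small \<epsilon> n unfolding w_def by (intro card_large_le) auto
  moreover have "\<epsilon> / sqrt \<epsilon> = sqrt \<epsilon>" using \<epsilon> by (simp add: real_div_sqrt)
  ultimately show ?thesis by (auto elim: csplits_mono)
qed

lemma csplits_toeplitz_L1:
  assumes n: "\<And>l. l < d \<Longrightarrow> 0 < n l" and \<epsilon>: "0 < \<epsilon>" and h: "L1le d h \<epsilon>"
  shows "csplits (lam d n) (\<lambda>\<alpha> \<beta>. h (mdiff d \<alpha> \<beta>)) (9 ^ d * sqrt \<epsilon> * real (Nsize d n)) (sqrt \<epsilon>)"
proof -
  \<comment> \<open>The kernel uses frequencies up to \<open>2 * n l\<close>, and row and column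
    indices differ by less than \<open>n l\<close>, so nothing wraps around modulo
    \<open>3 * n l\<close>; on the index differences the kernel has weight 1. The factor
    \<open>9 ^ d\<close> below is \<open>3 ^ d\<close> for the kernel bound times
    \<open>3 ^ d\<close> for the larger grid.\<close>
  define M where "M l = 3 * n l" for l
  define D where "D l = 2 * n l" for l
  have M0: "0 < M l" if "l < d" for l using n[OF that] by (simp add: M_def)
  have NM: "real (Nsize d M) = 3 ^ d * real (Nsize d n)" by (simp add: Nsize_def M_def prod.distrib)
  define w where "w = smooth d M D (\<lambda>l. vpk (n l)) h"
  have avg: "gavg d M (\<lambda>k. cmod (w k)) \<le> \<epsilon> * 3 ^ d"
    using L1leD[OF h, of M D "\<lambda>l. vpk (n l)" "\<lambda>_. 3"] M0 kbound_vpk n by (simp add: w_def M_def D_def)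
  have "csplits (lam d n) (\<lambda>\<alpha> \<beta>. h (mdiff d \<alpha> \<beta>)) (real (card {k\<in>lam d M. sqrt \<epsilon> < cmod (w k)})) (sqrt \<epsilon>)"
  proof (rule csplits_diag[OF n])
    fix \<alpha> \<beta> assume ab: "\<alpha> \<in> lam d n" "\<beta> \<in> lam d n"
    have lt: "\<bar>int (\<alpha> l) - int (\<beta> l)\<bar> < int (n l)" if "l < d" for l
      using lamD[OF ab(1) that] lamD[OF ab(2) that] by linarith
    have mem: "mdiff d \<alpha> \<beta> \<in> fbox d D" using lt by (fastforce simp: fbox_def Zd_def mdiff_def D_def)
    have iff: "(\<forall>l<d. int (M l) dvd int (\<alpha> l) - int (\<beta> l) - q l) \<longleftrightarrow> q = mdiff d \<alpha> \<beta>" if q: "q \<in> fbox d D" for q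
    proof
      assume dv: "\<forall>l<d. int (M l) dvd int (\<alpha> l) - int (\<beta> l) - q l"
      have "q l = mdiff d \<alpha> \<beta> l" for l
      proof (cases "l < d")
        case True
        have "\<bar>q l\<bar> \<le> int (D l)" using q True by (simp add: fbox_def)
        then have "\<bar>int (\<alpha> l) - int (\<beta> l) - q l\<bar> < int (M l)" using lt[OF True] by (simp add: M_def D_def)
        then have "int (\<alpha> l) - int (\<beta> l) - q l = 0"
          using dv True dvd_imp_le_int[of "int (\<alpha> l) - int (\<beta> l) - q l" "int (M l)"] by fastforce
        then show ?thesis using True by (simp add: mdiff_def)
      next
        case False then show ?thesis using q by (simp add: mdiff_def fbox_def Zd_def)
      qed
      then show "q = mdiff d \<alpha> \<beta>" by auto
    qed (simp add: mdiff_def)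
    have "(\<Sum>k\<in>lam d M. w k * zchr d M (\<lambda>l. int (\<beta> l) - int (\<alpha> l)) k) / of_nat (Nsize d M)
       = circ d M (fbox d D) (\<lambda>q. (\<Prod>l<d. vpk (n l) (q l)) * h q) \<alpha> \<beta>"
      unfolding w_def smooth_def by (rule circ_diag[OF M0])
    also have "\<dots> = (\<Sum>q\<in>fbox d D. if q = mdiff d \<alpha> \<beta> then (\<Prod>l<d. vpk (n l) (q l)) * h q else 0)"
      unfolding circ_def using iff by (intro sum.cong refl) simp
    also have "\<dots> = (\<Prod>l<d. vpk (n l) (mdiff d \<alpha> \<beta> l)) * h (mdiff d \<alpha> \<beta>)"
      using mem by (simp add: sum.delta)
    also have "(\<Prod>l<d. vpk (n l) (mdiff d \<alpha> \<beta> l)) = 1"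
    proof (intro prod.neutral ballI)
      fix l assume "l \<in> {..<d}"
      then show "vpk (n l) (mdiff d \<alpha> \<beta> l) = 1" using n lt[of l] by (intro vpk_eq_1) (auto simp: mdiff_def)
    qed
    finally show "h (mdiff d \<alpha> \<beta>) = (\<Sum>k\<in>lam d M. w k * zchr d M (\<lambda>l. int (\<beta> l) - int (\<alpha> l)) k) / of_nat (Nsize d M)"
      by simp
  qed (use \<epsilon> in \<open>auto simp: M_def\<close>)
  moreover have "real (card {k\<in>lam d M. sqrt \<epsilon> < cmod (w k)}) \<le> 9 ^ d * sqrt \<epsilon> * real (Nsize d n)"
  proof -
    have "real (card {k\<in>lam d M. sqrt \<epsilon> < cmod (w k)}) \<le> \<epsilon> * 3 ^ d / sqrt \<epsilon> * real (Nsize d M)"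
      using \<epsilon> M0 by (intro card_large_le[OF _ avg]) auto
    also have "\<dots> = (\<epsilon> / sqrt \<epsilon>) * (3 ^ d * 3 ^ d) * real (Nsize d n)" unfolding NM by (simp add: mult_ac)
    also have "\<epsilon> / sqrt \<epsilon> = sqrt \<epsilon>" using \<epsilon> by (simp add: real_div_sqrt)
    also have "(3 ^ d * 3 ^ d :: real) = 9 ^ d" by (simp add: power_mult_distrib[symmetric])
    finally show ?thesis by (simp add: mult_ac)
  qed
  ultimately show ?thesis by (auto elim: csplits_mono)
qed

text \<open>With frequencies bounded by \<open>D\<close>, a shift wraps around only in rows whose
  index has some coordinate among its first or last \<open>D\<close> values; in all other rows the
  two matrices agree. For each \<open>l\<close> these rows are at most the fraction
  \<open>2 * D / n l\<close> of the grid, and together at most \<open>\<epsilon>\<close> by the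
  hypothesis on \<open>n\<close>.\<close>

lemma csplits_toeplitz_circulant:
  assumes p: "{q. p q \<noteq> 0} \<subseteq> fbox d (\<lambda>_. D)" and \<epsilon>: "0 < \<epsilon>"
    and n: "\<And>l. l < d \<Longrightarrow> 0 < n l" "\<And>l. l < d \<Longrightarrow> real d * (2 * real D) \<le> \<epsilon> * real (n l)"
  shows "csplits (lam d n) (\<lambda>\<alpha> \<beta>. p (mdiff d \<alpha> \<beta>) - circ d n {q. p q \<noteq> 0} p \<alpha> \<beta>) (\<epsilon> * real (Nsize d n)) 0"
proof -
  define X where "X \<alpha> \<beta> = p (mdiff d \<alpha> \<beta>) - circ d n {q. p q \<noteq> 0} p \<alpha> \<beta>" for \<alpha> \<beta>
  define bad where "bad l = {\<alpha>\<in>lam d n. \<alpha> l < D \<or> n l \<le> \<alpha> l + D}" for l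
  define G where "G = (\<Union>l<d. bad l)"
  have finQ: "finite {q. p q \<noteq> 0}" using p finite_subset finite_fbox by blast
  have zero: "X \<alpha> \<beta> = 0" if a: "\<alpha> \<in> lam d n" "\<alpha> \<notin> G" and b: "\<beta> \<in> lam d n" for \<alpha> \<beta>
  proof -
    have int: "D \<le> \<alpha> l" "\<alpha> l + D < n l" if "l < d" for l
      using a that by (auto simp: G_def bad_def not_less not_le)
    have iff: "(\<forall>l<d. int (n l) dvd int (\<alpha> l) - int (\<beta> l) - q l) \<longleftrightarrow> q = mdiff d \<alpha> \<beta>" if q: "p q \<noteq> 0" for q
    proof
      assume dv: "\<forall>l<d. int (n l) dvd int (\<alpha> l) - int (\<beta> l) - q l"
      have qb: "q \<in> fbox d (\<lambda>_. D)" using q p by blast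
      have "q l = mdiff d \<alpha> \<beta> l" for l
      proof (cases "l < d")
        case True
        have "\<bar>q l\<bar> \<le> int D" using qb True by (simp add: fbox_def)
        then have "\<bar>int (\<alpha> l) - int (\<beta> l) - q l\<bar> < int (n l)" using int[OF True] lamD[OF b True] by linarith
        then have "int (\<alpha> l) - int (\<beta> l) - q l = 0"
          using dv True dvd_imp_le_int[of "int (\<alpha> l) - int (\<beta> l) - q l" "int (n l)"] by fastforce
        then show ?thesis using True by (simp add: mdiff_def)
      next
        case False then show ?thesis using qb by (simp add: mdiff_def fbox_def Zd_def)
      qed
      then show "q = mdiff d \<alpha> \<beta>" by auto
    qed (simp add: mdiff_def)
    have "circ d n {q. p q \<noteq> 0} p \<alpha> \<beta> = (\<Sum>q | p q \<noteq> 0. if q = mdiff d \<alpha> \<beta> then p q else 0)"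
      unfolding circ_def using iff by (intro sum.cong refl) simp
    also have "\<dots> = p (mdiff d \<alpha> \<beta>)" using finQ by (simp add: sum.delta)
    finally show ?thesis by (simp add: X_def)
  qed
  have finG: "finite G" by (auto simp: G_def bad_def)
  have "csplits (lam d n) X (real (card G)) 0"
  \<comment> \<open>Each exceptional row is one rank-one term, a coordinate vector times that row.
    Nothing remains, hence the norm 0.\<close>
  proof (rule csplits_sum_rank_one[OF finG, where u = "\<lambda>\<gamma> \<alpha>. if \<alpha> = \<gamma> then 1 else 0" and v = X and E = "\<lambda>_ _. 0"])
    fix \<alpha> \<beta> assume "\<alpha> \<in> lam d n" "\<beta> \<in> lam d n"
    have "(\<Sum>k\<in>G. (if \<alpha> = k then 1 else 0) * X k \<beta>) = (\<Sum>k\<in>G. if \<alpha> = k then X k \<beta> else 0)"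
      by (intro sum.cong) auto
    then show "X \<alpha> \<beta> = (\<Sum>k\<in>G. (if \<alpha> = k then 1 else 0) * X k \<beta>) + 0"
      using zero[OF \<open>\<alpha> \<in> lam d n\<close> _ \<open>\<beta> \<in> lam d n\<close>] finG by (auto simp: sum.delta')
  qed (simp add: L2_set_def)
  moreover have "real (card G) \<le> \<epsilon> * real (Nsize d n)"
  proof -
    have bad: "real d * real (card (bad l)) \<le> \<epsilon> * real (Nsize d n)" if l: "l < d" for l
    proof -
      define B where "B = {j. j < D \<or> n l \<le> j + D}"
      have cB: "card ({..<n l} \<inter> B) \<le> 2 * D"
      proof -
        have "{..<n l} \<inter> B \<subseteq> {..<D} \<union> {n l - D..<n l}" by (auto simp: B_def)
        then have "card ({..<n l} \<inter> B) \<le> card ({..<D} \<union> {n l - D..<n l})" by (intro card_mono) auto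
        also have "\<dots> \<le> card {..<D} + card {n l - D..<n l}" by (rule card_Un_le)
        finally show ?thesis by simp
      qed
      have N: "0 < real (Nsize d n)" using n(1) by (simp add: Nsize_pos)
      have "real (card (bad l)) = real (Nsize d n) * gavg d n (\<lambda>\<alpha>. if \<alpha> l \<in> B then 1 else 0)"
      proof -
        have "(\<Sum>\<alpha>\<in>lam d n. if \<alpha> l \<in> B then 1 else 0) = (\<Sum>\<alpha>\<in>bad l. (1::real))"
          unfolding bad_def B_def by (subst sum.inter_filter[symmetric]) auto
        then show ?thesis using N by (simp add: gavg_def)
      qed
      also have "gavg d n (\<lambda>\<alpha>. if \<alpha> l \<in> B then 1 else 0) = gavg d n (\<lambda>\<alpha>. (\<Sum>j<n l. if (\<alpha>(l := j)) l \<in> B then 1 else 0) / real (n l))"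
        by (rule gavg_fibre) (use l n in auto)
      also have "\<dots> \<le> gavg d n (\<lambda>\<alpha>. 2 * real D / real (n l))"
      proof (intro gavg_mono divide_right_mono)
        fix \<alpha> :: "nat \<Rightarrow> nat"
        have "(\<Sum>j<n l. if (\<alpha>(l := j)) l \<in> B then 1 else 0) = real (card ({..<n l} \<inter> B))"
          by (simp add: sum.inter_restrict[symmetric])
        then show "(\<Sum>j<n l. if (\<alpha>(l := j)) l \<in> B then 1 else 0) \<le> 2 * real D" using cB by linarith
      qed simp
      also have "\<dots> = 2 * real D / real (n l)" using n(1) by (rule gavg_const)
      finally have "real (card (bad l)) \<le> real (Nsize d n) * (2 * real D / real (n l))"
        by (simp add: mult_left_mono)
      then have "real d * real (card (bad l)) \<le> real d * (real (Nsize d n) * (2 * real D / real (n l)))"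
        by (rule mult_left_mono) simp
      also have "\<dots> = (real d * (2 * real D)) / real (n l) * real (Nsize d n)" by simp
      also have "\<dots> \<le> \<epsilon> * real (Nsize d n)"
        using n(1,2)[OF l] by (intro mult_right_mono) (auto simp: divide_le_eq)
      finally show ?thesis .
    qed
    show ?thesis
    proof (cases "d = 0")
      case True then show ?thesis using \<epsilon> by (simp add: G_def)
    next
      case False
      have "card G \<le> (\<Sum>l<d. card (bad l))" unfolding G_def by (rule card_UN_le) simp
      then have "real d * real (card G) \<le> (\<Sum>l<d. real d * real (card (bad l)))"
        unfolding sum_distrib_left[symmetric] of_nat_sum[symmetric] by (intro mult_left_mono of_nat_mono) auto
      also have "\<dots> \<le> (\<Sum>l<d. \<epsilon> * real (Nsize d n))" using bad by (intro sum_mono) auto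
      also have "\<dots> = real d * (\<epsilon> * real (Nsize d n))" by simp
      finally show ?thesis using False by simp
    qed
  qed
  ultimately show ?thesis unfolding X_def by (rule csplits_mono) simp
qed

lemma toeplitz_circulant_splits:
  assumes p: "trigpoly d p" "L1le d (\<lambda>q. c q - p q) \<epsilon>" and \<epsilon>: "0 < \<epsilon>"
    and small: "grid_ev d (\<lambda>n. gavg d n (\<lambda>k. sqrt (cmod ((\<Sum>q | p q \<noteq> 0. p q * zchr d n q k) - (\<Sum>q\<in>S. c q * zchr d n q k)))) \<le> \<epsilon>)"
  shows "grid_ev d (\<lambda>n. (\<forall>l<d. 0 < n l) \<and> csplits (lam d n) (\<lambda>\<alpha> \<beta>. c (mdiff d \<alpha> \<beta>) - circ d n S c \<alpha> \<beta>)
     ((9 ^ d * sqrt \<epsilon> + \<epsilon> + sqrt \<epsilon>) * real (Nsize d n)) (sqrt \<epsilon> + \<epsilon>))"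
proof -
  obtain D where D: "{q. p q \<noteq> 0} \<subseteq> fbox d (\<lambda>_. D)" using trigpoly_subset_fbox[OF p(1)] by blast
  define m where "m = 1 + nat \<lceil>real d * (2 * real D) / \<epsilon>\<rceil>"
  from grid_ev_conj[OF small grid_ev_ge[of d m]] show ?thesis
  proof (rule grid_ev_mono, elim conjE)
    fix n assume sm: "gavg d n (\<lambda>k. sqrt (cmod ((\<Sum>q | p q \<noteq> 0. p q * zchr d n q k) - (\<Sum>q\<in>S. c q * zchr d n q k)))) \<le> \<epsilon>"
      and nm: "\<forall>j<d. m \<le> n j"
    have n0: "0 < n l" if "l < d" for l using nm that by (force simp: m_def)
    have nD: "real d * (2 * real D) \<le> \<epsilon> * real (n l)" if "l < d" for l
    proof -
      have "real d * (2 * real D) / \<epsilon> \<le> real m"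
        unfolding m_def using real_nat_ceiling_ge[of "real d * (2 * real D) / \<epsilon>"] by linarith
      also have "\<dots> \<le> real (n l)" using nm that by simp
      finally show ?thesis using \<epsilon> by (simp add: field_simps)
    qed
    have "csplits (lam d n) (\<lambda>\<alpha> \<beta>. (c (mdiff d \<alpha> \<beta>) - p (mdiff d \<alpha> \<beta>))
        + (p (mdiff d \<alpha> \<beta>) - circ d n {q. p q \<noteq> 0} p \<alpha> \<beta>)
        + (circ d n {q. p q \<noteq> 0} p \<alpha> \<beta> - circ d n S c \<alpha> \<beta>))
      (9 ^ d * sqrt \<epsilon> * real (Nsize d n) + \<epsilon> * real (Nsize d n) + sqrt \<epsilon> * real (Nsize d n)) (sqrt \<epsilon> + 0 + \<epsilon>)"
      by (intro csplits_add csplits_toeplitz_circulant[OF D \<epsilon> n0 nD] csplits_circulant[OF n0 \<epsilon> sm]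
        csplits_toeplitz_L1[OF n0 \<epsilon> p(2)])
    then show "(\<forall>l<d. 0 < n l) \<and> csplits (lam d n) (\<lambda>\<alpha> \<beta>. c (mdiff d \<alpha> \<beta>) - circ d n S c \<alpha> \<beta>)
     ((9 ^ d * sqrt \<epsilon> + \<epsilon> + sqrt \<epsilon>) * real (Nsize d n)) (sqrt \<epsilon> + \<epsilon>)"
      using n0 by (simp add: distrib_right)
  qed
qed

section \<open>Density of trigonometric polynomials\<close>

text \<open>Restricting the measure once turns the set integrals of the definitions into integrals
  over a finite measure space, on which bounded measurable functions are integrable.\<close>

definition tor :: "nat \<Rightarrow> (nat \<Rightarrow> real) measure" where
  "tor d = restrict_space (torus_measure d) (torus d)"

interpretation lborel_prod: product_sigma_finite "\<lambda>_::nat. lborel :: real measure"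
  by unfold_locales

lemma torus_sets [measurable]: "torus d \<in> sets (torus_measure d)"
  unfolding torus_def torus_measure_def by (intro sets_PiM_I_finite) auto

lemma torus_Int_space: "torus d \<inter> space (torus_measure d) \<in> sets (torus_measure d)"
  by (intro sets.Int torus_sets sets.top)

lemma space_tor: "space (tor d) = torus d"
  using sets.sets_into_space[OF torus_sets[of d]] by (auto simp: tor_def space_restrict_space)

lemma integral_tor: "integral\<^sup>L (tor d) f = set_lebesgue_integral (torus_measure d) (torus d) f"
  for f :: "_ \<Rightarrow> 'b::{banach, second_countable_topology}"
  unfolding tor_def set_lebesgue_integral_def by (rule integral_restrict_space[OF torus_Int_space])

lemma integrable_tor: "integrable (tor d) f \<longleftrightarrow> set_integrable (torus_measure d) (torus d) f"
  for f :: "_ \<Rightarrow> 'b::{banach, second_countable_topology}"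
  unfolding tor_def set_integrable_def by (rule integrable_restrict_space[OF torus_Int_space])

lemma emeasure_tor: "emeasure (tor d) (space (tor d)) = ennreal ((2 * pi) ^ d)"
proof -
  have "emeasure (tor d) (torus d) = emeasure (torus_measure d) (torus d)"
    unfolding tor_def by (rule emeasure_restrict_space[OF torus_Int_space]) simp
  then have "emeasure (tor d) (space (tor d)) = emeasure (torus_measure d) (torus d)"
    by (simp add: space_tor)
  also have "\<dots> = (\<Prod>l<d. emeasure lborel {-pi..<pi})"
    unfolding torus_measure_def torus_def by (rule lborel_prod.emeasure_PiM) auto
  also have "\<dots> = ennreal ((2 * pi) ^ d)"
  proof -
    have "emeasure lborel {-pi..<pi} = ennreal (pi - (- pi))" by (rule emeasure_lborel_Ico) simp
    also have "pi - (- pi) = 2 * pi" by simp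
    finally have "emeasure lborel {-pi..<pi} = ennreal (2 * pi)" .
    then show ?thesis by (simp only: prod_constant card_lessThan) (simp add: ennreal_power)
  qed
  finally show ?thesis .
qed

interpretation tor: finite_measure "tor d" for d
  by standard (simp add: emeasure_tor)

lemma measure_tor: "measure (tor d) (space (tor d)) = (2 * pi) ^ d"
  by (simp add: measure_def emeasure_tor)

lemma coord_measurable: "l < d \<Longrightarrow> (\<lambda>\<theta>. \<theta> l) \<in> borel_measurable (tor d)"
proof -
  assume "l < d"
  then have "(\<lambda>\<theta>. \<theta> l) \<in> measurable (torus_measure d) lborel"
    unfolding torus_measure_def by (intro measurable_component_singleton) auto
  then have "(\<lambda>\<theta>. \<theta> l) \<in> borel_measurable (torus_measure d)" by simp
  then show ?thesis unfolding tor_def by (rule measurable_restrict_space1)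
qed

section \<open>Characters of the torus and their integrals\<close>

definition ip :: "nat \<Rightarrow> (nat \<Rightarrow> int) \<Rightarrow> (nat \<Rightarrow> real) \<Rightarrow> real" where
  "ip d q \<theta> = (\<Sum>l<d. real_of_int (q l) * \<theta> l)"

lemma ip_add: "ip d (\<lambda>l. q l + r l) \<theta> = ip d q \<theta> + ip d r \<theta>"
  by (simp add: ip_def distrib_right sum.distrib)

lemma ip_measurable [measurable]: "ip d q \<in> borel_measurable (tor d)"
  unfolding ip_def by (intro borel_measurable_sum borel_measurable_times borel_measurable_const coord_measurable) auto

lemma cis_ip_measurable [measurable]: "(\<lambda>\<theta>. cis (ip d q \<theta>)) \<in> borel_measurable (tor d)"
proof -
  have "cis \<in> borel_measurable borel"
    by (intro borel_measurable_continuous_onI continuous_intros)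
  then show ?thesis by measurable
qed

lemma integrable_tor_bounded:
  fixes f :: "_ \<Rightarrow> 'b::{banach, second_countable_topology}"
  assumes "f \<in> borel_measurable (tor d)" "\<And>\<theta>. \<theta> \<in> torus d \<Longrightarrow> norm (f \<theta>) \<le> B"
  shows "integrable (tor d) f"
  using assms by (intro tor.integrable_const_bound[where B = B] AE_I2) (auto simp: space_tor)

lemma integrable_cis_ip: "integrable (tor d) (\<lambda>\<theta>. cis (ip d q \<theta>))"
  by (rule integrable_tor_bounded[of _ _ 1]) auto

lemma cis_sum: "finite A \<Longrightarrow> cis (\<Sum>l\<in>A. f l) = (\<Prod>l\<in>A. cis (f l))"
  by (induction A rule: finite_induct) (auto simp: cis_mult[symmetric])

lemma integral_cis_interval:
  "(LINT x|lborel. indicator {-pi..<pi} x *\<^sub>R cis (real_of_int m * x)) = (if m = 0 then of_real (2 * pi) else 0)"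
proof -
  have "(LINT x|lborel. indicator {-pi..<pi} x *\<^sub>R cis (real_of_int m * x)) =
     (LINT x|lborel. indicator {-pi..pi} x *\<^sub>R cis (real_of_int m * x))"
  proof (rule integral_cong_AE)
    have "cis \<in> borel_measurable borel"
      by (intro borel_measurable_continuous_onI continuous_intros)
    then show "(\<lambda>x. indicator {-pi..<pi} x *\<^sub>R cis (real_of_int m * x)) \<in> borel_measurable lborel"
      "(\<lambda>x. indicator {-pi..pi} x *\<^sub>R cis (real_of_int m * x)) \<in> borel_measurable lborel"
      by measurable
    show "AE x in lborel. indicator {-pi..<pi} x *\<^sub>R cis (real_of_int m * x) = indicator {-pi..pi} x *\<^sub>R cis (real_of_int m * x)"
      using AE_lborel_singleton[of pi] by eventually_elim (auto simp: indicator_def)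
  qed
  also have "\<dots> = (if m = 0 then of_real (2 * pi) else 0)"
  proof (cases "m = 0")
    case True
    then show ?thesis by (simp add: complex_eq_iff)
  next
    case False
    define F where "F = (\<lambda>x. exp (\<i> * of_int m * of_real x) / (\<i> * of_int m))"
    have "(F has_vector_derivative cis (real_of_int m * x)) (at x within {-pi..pi})" for x
    proof -
      have "((\<lambda>z. exp (\<i> * of_int m * z) / (\<i> * of_int m)) has_field_derivative exp (\<i> * of_int m * of_real x)) (at (of_real x))"
        using False by (auto intro!: derivative_eq_intros)
      from has_vector_derivative_real_field[OF this] show ?thesis
        by (simp add: F_def cis_conv_exp mult.assoc)
    qed
    then have "(LINT x|lborel. indicator {-pi..pi} x *\<^sub>R cis (real_of_int m * x)) = F pi - F (-pi)"
      by (intro integral_FTC_atLeastAtMost continuous_intros) auto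
    also have "\<dots> = 0"
    proof -
      have "cis (real_of_int m * pi) = cis (- (real_of_int m * pi)) * cis (2 * pi * real_of_int m)"
        unfolding cis_mult by (rule arg_cong[of _ _ cis]) (simp add: algebra_simps)
      moreover have "cis (2 * pi * real_of_int m) = 1" by (metis cis_multiple_2pi Ints_of_int)
      ultimately show ?thesis by (simp add: F_def cis_conv_exp mult.assoc)
    qed
    finally show ?thesis using False by simp
  qed
  finally show ?thesis .
qed

lemma integral_cis_ip:
  "(LINT \<theta>|tor d. cis (ip d z \<theta>)) = (if \<forall>l<d. z l = 0 then of_real ((2 * pi) ^ d) else 0)"
proof -
  have "(LINT \<theta>|tor d. cis (ip d z \<theta>)) =
     (LINT \<theta>|torus_measure d. (\<Prod>l<d. indicator {-pi..<pi} (\<theta> l) *\<^sub>R cis (real_of_int (z l) * \<theta> l)))"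
    unfolding integral_tor set_lebesgue_integral_def
  proof (rule Bochner_Integration.integral_cong[OF refl])
    fix \<theta> assume "\<theta> \<in> space (torus_measure d)"
    then have ext: "\<theta> \<in> extensional {..<d}" by (auto simp: torus_measure_def space_PiM PiE_def)
    have "indicator (torus d) \<theta> = (\<Prod>l<d. indicator {-pi..<pi} (\<theta> l) :: real)"
    proof (cases "\<theta> \<in> torus d")
      case True
      have "(\<Prod>l<d. indicator {-pi..<pi} (\<theta> l) :: real) = 1"
      proof (intro prod.neutral ballI)
        fix l assume "l \<in> {..<d}"
        then have "\<theta> l \<in> {-pi..<pi}" using True unfolding torus_def by (rule PiE_mem[rotated])
        then show "indicator {-pi..<pi} (\<theta> l) = (1::real)" by (rule indicator_simps(1))
      qed
      then show ?thesis using True by simp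
    next
      case False
      then obtain l where l: "l < d" "\<theta> l \<notin> {-pi..<pi}" using ext unfolding torus_def PiE_def Pi_def by blast
      then have "(\<Prod>l<d. indicator {-pi..<pi} (\<theta> l) :: real) = 0"
        by (intro prod_zero bexI[of _ l]) (simp_all only: indicator_simps lessThan_iff finite_lessThan not_False_eq_True)
      then show ?thesis using False by simp
    qed
    then show "indicator (torus d) \<theta> *\<^sub>R cis (ip d z \<theta>) = (\<Prod>l<d. indicator {-pi..<pi} (\<theta> l) *\<^sub>R cis (real_of_int (z l) * \<theta> l))"
      by (simp add: ip_def cis_sum scaleR_conv_of_real prod.distrib)
  qed
  also have "\<dots> = (\<Prod>l<d. LINT x|lborel. indicator {-pi..<pi} x *\<^sub>R cis (real_of_int (z l) * x))"
    unfolding torus_measure_def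
  proof (rule lborel_prod.product_integral_prod)
    fix l
    have "set_integrable lborel {-pi..pi} (\<lambda>x. cis (real_of_int (z l) * x))"
      unfolding set_integrable_def
      by (rule borel_integrable_compact) (auto intro!: continuous_intros)
    then have "set_integrable lborel {-pi..<pi} (\<lambda>x. cis (real_of_int (z l) * x))"
      by (rule set_integrable_subset) auto
    then show "integrable lborel (\<lambda>x. indicator {-pi..<pi} x *\<^sub>R cis (real_of_int (z l) * x))"
      by (simp add: set_integrable_def)
  qed simp
  also have "\<dots> = (if \<forall>l<d. z l = 0 then of_real ((2 * pi) ^ d) else 0)"
    unfolding integral_cis_interval by (auto intro!: prod_zero)
  finally show ?thesis .
qed

section \<open>Trigonometric polynomials as functions\<close>

definition tpf :: "nat \<Rightarrow> ((nat \<Rightarrow> real) \<Rightarrow> complex) \<Rightarrow> bool" where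
  "tpf d g \<longleftrightarrow> (\<exists>Q a. finite Q \<and> Q \<subseteq> Zd d \<and> (\<forall>\<theta>. g \<theta> = (\<Sum>q\<in>Q. a q * cis (ip d q \<theta>))))"

lemma tpf_char: "q \<in> Zd d \<Longrightarrow> tpf d (\<lambda>\<theta>. c * cis (ip d q \<theta>))"
  unfolding tpf_def by (intro exI[of _ "{q}"] exI[of _ "\<lambda>_. c"]) auto

lemma tpf_const: "tpf d (\<lambda>_. c)"
  using tpf_char[of "\<lambda>_. 0" d c] by (simp add: Zd_def ip_def)

lemma tpf_add:
  assumes "tpf d f" "tpf d g"
  shows "tpf d (\<lambda>\<theta>. f \<theta> + g \<theta>)"
proof -
  obtain Q a where Q: "finite Q" "Q \<subseteq> Zd d" "\<And>\<theta>. f \<theta> = (\<Sum>q\<in>Q. a q * cis (ip d q \<theta>))"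
    using assms(1) unfolding tpf_def by blast
  obtain R b where R: "finite R" "R \<subseteq> Zd d" "\<And>\<theta>. g \<theta> = (\<Sum>q\<in>R. b q * cis (ip d q \<theta>))"
    using assms(2) unfolding tpf_def by blast
  define e where "e q = (if q \<in> Q then a q else 0) + (if q \<in> R then b q else 0)" for q
  have "f \<theta> = (\<Sum>q\<in>Q \<union> R. (if q \<in> Q then a q else 0) * cis (ip d q \<theta>))" for \<theta>
    unfolding Q(3) using Q(1) R(1) by (intro sum.mono_neutral_cong_left) auto
  moreover have "g \<theta> = (\<Sum>q\<in>Q \<union> R. (if q \<in> R then b q else 0) * cis (ip d q \<theta>))" for \<theta>
    unfolding R(3) using Q(1) R(1) by (intro sum.mono_neutral_cong_left) auto
  ultimately have "f \<theta> + g \<theta> = (\<Sum>q\<in>Q \<union> R. e q * cis (ip d q \<theta>))" for \<theta>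
    by (simp add: e_def distrib_right sum.distrib)
  then show ?thesis unfolding tpf_def using Q R
    by (intro exI[of _ "Q \<union> R"] exI[of _ e]) auto
qed

lemma tpf_sum: "finite A \<Longrightarrow> (\<And>i. i \<in> A \<Longrightarrow> tpf d (f i)) \<Longrightarrow> tpf d (\<lambda>\<theta>. \<Sum>i\<in>A. f i \<theta>)"
  by (induction A rule: finite_induct) (auto intro: tpf_add tpf_const)

lemma tpf_mult:
  assumes "tpf d f" "tpf d g"
  shows "tpf d (\<lambda>\<theta>. f \<theta> * g \<theta>)"
proof -
  obtain Q a where Q: "finite Q" "Q \<subseteq> Zd d" "\<And>\<theta>. f \<theta> = (\<Sum>q\<in>Q. a q * cis (ip d q \<theta>))"
    using assms(1) unfolding tpf_def by blast
  obtain R b where R: "finite R" "R \<subseteq> Zd d" "\<And>\<theta>. g \<theta> = (\<Sum>q\<in>R. b q * cis (ip d q \<theta>))"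
    using assms(2) unfolding tpf_def by blast
  have "f \<theta> * g \<theta> = (\<Sum>q\<in>Q. \<Sum>r\<in>R. (a q * b r) * cis (ip d (\<lambda>l. q l + r l) \<theta>))" for \<theta>
    unfolding Q(3) R(3) sum_product
    by (intro sum.cong refl) (simp add: ip_add cis_mult[symmetric])
  moreover have "tpf d (\<lambda>\<theta>. \<Sum>q\<in>Q. \<Sum>r\<in>R. (a q * b r) * cis (ip d (\<lambda>l. q l + r l) \<theta>))"
  proof (intro tpf_sum tpf_char Q(1) R(1))
    fix q r assume "q \<in> Q" "r \<in> R"
    then have "q \<in> Zd d" "r \<in> Zd d" using Q(2) R(2) by auto
    then show "(\<lambda>l. q l + r l) \<in> Zd d" by (simp add: Zd_def)
  qed
  ultimately show ?thesis by simp
qed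

lemma tpf_measurable: "tpf d g \<Longrightarrow> g \<in> borel_measurable (tor d)"
proof -
  assume "tpf d g"
  then obtain Q a where "g = (\<lambda>\<theta>. \<Sum>q\<in>Q. a q * cis (ip d q \<theta>))" unfolding tpf_def by (auto simp: fun_eq_iff)
  then show ?thesis by simp
qed

lemma tpf_bounded: "tpf d g \<Longrightarrow> \<exists>B>0. \<forall>\<theta>. cmod (g \<theta>) \<le> B"
proof -
  assume "tpf d g"
  then obtain Q a where g: "\<And>\<theta>. g \<theta> = (\<Sum>q\<in>Q. a q * cis (ip d q \<theta>))" unfolding tpf_def by blast
  have "cmod (g \<theta>) \<le> (\<Sum>q\<in>Q. cmod (a q)) + 1" for \<theta>
  proof -
    have "cmod (g \<theta>) \<le> (\<Sum>q\<in>Q. cmod (a q))"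
      unfolding g by (intro sum_norm_le) (simp add: norm_mult)
    then show ?thesis by simp
  qed
  moreover have "0 < (\<Sum>q\<in>Q. cmod (a q)) + 1" by (simp add: add_nonneg_pos sum_nonneg)
  ultimately show ?thesis by blast
qed

lemma tpf_integrable: "tpf d g \<Longrightarrow> integrable (tor d) g"
  using tpf_bounded[of d g] tpf_measurable[of d g] by (auto intro: integrable_tor_bounded)

section \<open>The L1 closure of the trigonometric polynomials\<close>

abbreviation L1dist where
  "L1dist d f g \<equiv> LINT \<theta>|tor d. cmod (f \<theta> - g \<theta>)"

definition apx :: "nat \<Rightarrow> ((nat \<Rightarrow> real) \<Rightarrow> complex) \<Rightarrow> bool" where
  "apx d f \<longleftrightarrow> integrable (tor d) f \<and> (\<forall>\<epsilon>>0. \<exists>g. tpf d g \<and> L1dist d f g < \<epsilon>)"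

lemma apxI:
  assumes f: "integrable (tor d) f"
    and h: "\<And>\<epsilon>. 0 < \<epsilon> \<Longrightarrow> \<exists>h. apx d h \<and> L1dist d f h < \<epsilon>"
  shows "apx d f"
  unfolding apx_def
proof (intro conjI f allI impI)
  fix \<epsilon> :: real assume "0 < \<epsilon>"
  then obtain h where h: "apx d h" "L1dist d f h < \<epsilon> / 2" using h[of "\<epsilon> / 2"] by auto
  then obtain g where g: "tpf d g" "L1dist d h g < \<epsilon> / 2"
    using half_gt_zero[OF \<open>0 < \<epsilon>\<close>] unfolding apx_def by blast
  have hi: "integrable (tor d) h" using h(1) by (simp add: apx_def)
  have "L1dist d f g \<le> (LINT \<theta>|tor d. cmod (f \<theta> - h \<theta>) + cmod (h \<theta> - g \<theta>))"
  proof (rule integral_mono)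
    show "integrable (tor d) (\<lambda>\<theta>. cmod (f \<theta> - g \<theta>))"
      "integrable (tor d) (\<lambda>\<theta>. cmod (f \<theta> - h \<theta>) + cmod (h \<theta> - g \<theta>))"
      using f hi tpf_integrable[OF g(1)] by auto
    show "cmod (f \<theta> - g \<theta>) \<le> cmod (f \<theta> - h \<theta>) + cmod (h \<theta> - g \<theta>)" for \<theta>
      using norm_triangle_ineq[of "f \<theta> - h \<theta>" "h \<theta> - g \<theta>"] by simp
  qed
  also have "\<dots> = L1dist d f h + L1dist d h g"
    using f hi tpf_integrable[OF g(1)] by (intro Bochner_Integration.integral_add) auto
  finally show "\<exists>g. tpf d g \<and> L1dist d f g < \<epsilon>" using g h by (intro exI[of _ g]) auto
qed

lemma apx_tpf: "tpf d g \<Longrightarrow> apx d g"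
  unfolding apx_def
proof (intro conjI allI impI)
  fix \<epsilon> :: real assume g: "tpf d g" and "0 < \<epsilon>"
  then show "\<exists>h. tpf d h \<and> L1dist d g h < \<epsilon>"
    by (intro exI[of _ g] conjI) simp_all
qed (rule tpf_integrable)

text \<open>Dominated convergence makes the \<open>f k\<close> converge in L1, and the closure
  contains its L1 limits by \<open>apxI\<close>.\<close>

lemma apx_limit:
  assumes f: "\<And>k. apx d (f k)" and lim: "\<And>\<theta>. \<theta> \<in> torus d \<Longrightarrow> (\<lambda>k. f k \<theta>) \<longlonglongrightarrow> g \<theta>"
    and w: "integrable (tor d) w" "\<And>k \<theta>. \<theta> \<in> torus d \<Longrightarrow> cmod (f k \<theta>) \<le> w \<theta>"
  shows "apx d g"
proof -
  have fi: "integrable (tor d) (f k)" for k using f by (simp add: apx_def)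
  then have fm: "f k \<in> borel_measurable (tor d)" for k by auto
  have gm: "g \<in> borel_measurable (tor d)"
    by (rule borel_measurable_LIMSEQ_metric[where f = f]) (use fm lim in \<open>auto simp: space_tor\<close>)
  have gw: "cmod (g \<theta>) \<le> w \<theta>" if "\<theta> \<in> torus d" for \<theta>
    using tendsto_norm[OF lim[OF that]] w(2)[OF that] by (intro LIMSEQ_le_const2) auto
  have gi: "integrable (tor d) g"
    using gw by (intro Bochner_Integration.integrable_bound[OF w(1) gm] AE_I2) (force simp: space_tor)
  have "(\<lambda>k. LINT \<theta>|tor d. cmod (g \<theta> - f k \<theta>)) \<longlonglongrightarrow> (LINT \<theta>|tor d. 0)"
  proof (rule integral_dominated_convergence[where w = "\<lambda>\<theta>. 2 * w \<theta>"])
    show "AE \<theta> in tor d. (\<lambda>k. cmod (g \<theta> - f k \<theta>)) \<longlonglongrightarrow> 0"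
      using lim by (intro AE_I2) (auto simp: space_tor intro!: tendsto_eq_intros)
    show "AE \<theta> in tor d. norm (cmod (g \<theta> - f k \<theta>)) \<le> 2 * w \<theta>" for k
    proof (intro AE_I2)
      fix \<theta> assume "\<theta> \<in> space (tor d)"
      then have "\<theta> \<in> torus d" by (simp add: space_tor)
      then show "norm (cmod (g \<theta> - f k \<theta>)) \<le> 2 * w \<theta>"
        using norm_triangle_ineq4[of "g \<theta>" "f k \<theta>"] gw[of \<theta>] w(2)[of \<theta> k] by simp
    qed
  qed (use fm gm w(1) in auto)
  then have l0: "(\<lambda>k. LINT \<theta>|tor d. cmod (g \<theta> - f k \<theta>)) \<longlonglongrightarrow> 0" by simp
  show ?thesis
  proof (rule apxI[OF gi])
    fix \<epsilon> :: real assume "0 < \<epsilon>"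
    from order_tendstoD(2)[OF l0 this] obtain k where "(LINT \<theta>|tor d. cmod (g \<theta> - f k \<theta>)) < \<epsilon>"
      using eventually_happens'[OF sequentially_bot] by blast
    then show "\<exists>h. apx d h \<and> L1dist d g h < \<epsilon>" using f by blast
  qed
qed

lemma apx_add:
  assumes "apx d f" "apx d g"
  shows "apx d (\<lambda>\<theta>. f \<theta> + g \<theta>)"
  unfolding apx_def
proof (intro conjI allI impI)
  show "integrable (tor d) (\<lambda>\<theta>. f \<theta> + g \<theta>)" using assms by (auto simp: apx_def)
  fix \<epsilon> :: real assume e: "0 < \<epsilon>"
  obtain p where p: "tpf d p" "L1dist d f p < \<epsilon> / 2"
    using assms(1) half_gt_zero[OF e] unfolding apx_def by blast
  obtain q where q: "tpf d q" "L1dist d g q < \<epsilon> / 2"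
    using assms(2) half_gt_zero[OF e] unfolding apx_def by blast
  have i: "integrable (tor d) f" "integrable (tor d) g" "integrable (tor d) p" "integrable (tor d) q"
    using assms p q by (auto simp: apx_def tpf_integrable)
  have "(LINT \<theta>|tor d. cmod (f \<theta> + g \<theta> - (p \<theta> + q \<theta>))) \<le> (LINT \<theta>|tor d. cmod (f \<theta> - p \<theta>) + cmod (g \<theta> - q \<theta>))"
    using i by (intro integral_mono) (auto intro: norm_diff_triangle_ineq)
  also have "\<dots> = L1dist d f p + L1dist d g q"
    using i by (intro Bochner_Integration.integral_add) auto
  finally show "\<exists>h. tpf d h \<and> (LINT \<theta>|tor d. cmod (f \<theta> + g \<theta> - h \<theta>)) < \<epsilon>"
    using p q by (intro exI[of _ "\<lambda>\<theta>. p \<theta> + q \<theta>"]) (auto intro: tpf_add)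
qed

text \<open>The second factor is approximated after the first one, relative to the sup norm of the
  polynomial that approximates the first one.\<close>

lemma apx_mult:
  assumes f: "apx d f" and g: "apx d g" and gB: "\<And>\<theta>. cmod (g \<theta>) \<le> 1"
  shows "apx d (\<lambda>\<theta>. f \<theta> * g \<theta>)"
  unfolding apx_def
proof (intro conjI allI impI)
  have fi: "integrable (tor d) f" and gi: "integrable (tor d) g" using f g by (auto simp: apx_def)
  have bd: "integrable (tor d) (\<lambda>\<theta>. u \<theta> * v \<theta>)"
    if "integrable (tor d) u" "integrable (tor d) v" "\<And>\<theta>. cmod (v \<theta>) \<le> B" for u v :: "(nat \<Rightarrow> real) \<Rightarrow> complex" and B
  proof (rule Bochner_Integration.integrable_bound[of _ "\<lambda>\<theta>. B * cmod (u \<theta>)"])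
    show "integrable (tor d) (\<lambda>\<theta>. B * cmod (u \<theta>))" using that by auto
    show "(\<lambda>\<theta>. u \<theta> * v \<theta>) \<in> borel_measurable (tor d)" using that(1,2)[THEN borel_measurable_integrable] by simp
    have "0 \<le> B" using that(3) norm_ge_zero order_trans by blast
    then show "AE \<theta> in tor d. cmod (u \<theta> * v \<theta>) \<le> norm (B * cmod (u \<theta>))"
      using that(3) by (intro AE_I2) (simp add: norm_mult mult.commute[of B] mult_left_mono)
  qed
  show fg: "integrable (tor d) (\<lambda>\<theta>. f \<theta> * g \<theta>)" using bd[OF fi gi gB] .
  fix \<epsilon> :: real assume e: "0 < \<epsilon>"
  obtain p where p: "tpf d p" "L1dist d f p < \<epsilon> / 2"
    using f half_gt_zero[OF e] unfolding apx_def by blast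
  obtain B where B: "0 < B" "\<And>\<theta>. cmod (p \<theta>) \<le> B" using tpf_bounded[OF p(1)] by blast
  obtain q where q: "tpf d q" "L1dist d g q < \<epsilon> / (2 * B)"
  proof -
    have "0 < \<epsilon> / (2 * B)" using e B(1) by simp
    then show ?thesis using g that unfolding apx_def by blast
  qed
  have pi: "integrable (tor d) p" and qi: "integrable (tor d) q" using p q by (auto intro: tpf_integrable)
  have "(LINT \<theta>|tor d. cmod (f \<theta> * g \<theta> - p \<theta> * q \<theta>)) \<le> (LINT \<theta>|tor d. cmod (f \<theta> - p \<theta>) + B * cmod (g \<theta> - q \<theta>))"
  proof (rule integral_mono)
    show "integrable (tor d) (\<lambda>\<theta>. cmod (f \<theta> * g \<theta> - p \<theta> * q \<theta>))"
      using fg tpf_integrable[OF tpf_mult[OF p(1) q(1)]] by auto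
    show "integrable (tor d) (\<lambda>\<theta>. cmod (f \<theta> - p \<theta>) + B * cmod (g \<theta> - q \<theta>))"
      using fi gi pi qi by auto
    fix \<theta>
    have "f \<theta> * g \<theta> - p \<theta> * q \<theta> = (f \<theta> - p \<theta>) * g \<theta> + p \<theta> * (g \<theta> - q \<theta>)" by (simp add: algebra_simps)
    also have "cmod \<dots> \<le> cmod (f \<theta> - p \<theta>) * cmod (g \<theta>) + cmod (p \<theta>) * cmod (g \<theta> - q \<theta>)"
      using norm_triangle_ineq[of "(f \<theta> - p \<theta>) * g \<theta>" "p \<theta> * (g \<theta> - q \<theta>)"] by (simp add: norm_mult)
    also have "\<dots> \<le> cmod (f \<theta> - p \<theta>) * 1 + B * cmod (g \<theta> - q \<theta>)"
      using gB B(2) by (intro add_mono mult_left_mono mult_right_mono) auto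
    finally show "cmod (f \<theta> * g \<theta> - p \<theta> * q \<theta>) \<le> cmod (f \<theta> - p \<theta>) + B * cmod (g \<theta> - q \<theta>)" by simp
  qed
  also have "\<dots> = L1dist d f p + B * L1dist d g q"
    using fi gi pi qi by (subst Bochner_Integration.integral_add) auto
  also have "\<dots> < \<epsilon> / 2 + B * (\<epsilon> / (2 * B))"
    using p(2) q(2) B(1) by (intro add_strict_mono mult_strict_left_mono)
  also have "\<dots> = \<epsilon>" using B(1) by simp
  finally show "\<exists>h. tpf d h \<and> (LINT \<theta>|tor d. cmod (f \<theta> * g \<theta> - h \<theta>)) < \<epsilon>"
    using tpf_mult[OF p(1) q(1)] by (intro exI[of _ "\<lambda>\<theta>. p \<theta> * q \<theta>"]) auto
qed

text \<open>Sets whose indicator lies in the L1 closure. They are stable under complements,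
  intersections and countable unions, so it suffices to treat generators of the
  sigma-algebra.\<close>

definition aset :: "nat \<Rightarrow> (nat \<Rightarrow> real) set \<Rightarrow> bool" where
  "aset d A \<longleftrightarrow> apx d (indicator A)"

lemma apx_cong:
  assumes "apx d f" "\<And>\<theta>. \<theta> \<in> torus d \<Longrightarrow> f \<theta> = g \<theta>"
  shows "apx d g"
proof -
  have "integrable (tor d) g \<longleftrightarrow> integrable (tor d) f"
    using assms(2) by (intro Bochner_Integration.integrable_cong) (auto simp: space_tor)
  moreover have "L1dist d g h = L1dist d f h" for h
    using assms(2) by (intro Bochner_Integration.integral_cong) (auto simp: space_tor)
  ultimately show ?thesis using assms(1) unfolding apx_def by simp
qed

lemma aset_cong: "aset d A \<Longrightarrow> A \<inter> torus d = B \<inter> torus d \<Longrightarrow> aset d B"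
  unfolding aset_def by (erule apx_cong) (auto simp: indicator_def)

lemma apx_cmult: "apx d f \<Longrightarrow> apx d (\<lambda>\<theta>. c * f \<theta>)"
proof (cases "c = 0")
  case False
  assume f: "apx d f"
  show ?thesis unfolding apx_def
  proof (intro conjI allI impI)
    show "integrable (tor d) (\<lambda>\<theta>. c * f \<theta>)" using f by (simp add: apx_def)
    fix \<epsilon> :: real assume "0 < \<epsilon>"
    then have "0 < \<epsilon> / cmod c" using False by simp
    then obtain g where g: "tpf d g" "L1dist d f g < \<epsilon> / cmod c"
      using f unfolding apx_def by blast
    have "(LINT \<theta>|tor d. cmod (c * f \<theta> - c * g \<theta>)) = (LINT \<theta>|tor d. cmod c * cmod (f \<theta> - g \<theta>))"
      by (simp add: norm_mult[symmetric] right_diff_distrib)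
    also have "\<dots> = cmod c * L1dist d f g" by simp
    also have "\<dots> < \<epsilon>" using g(2) False by (simp add: field_simps)
    finally show "\<exists>g. tpf d g \<and> (LINT \<theta>|tor d. cmod (c * f \<theta> - g \<theta>)) < \<epsilon>"
      using tpf_mult[OF tpf_const[of d c] g(1)] by blast
  qed
qed (simp add: apx_tpf tpf_const)

lemma aset_UNIV: "aset d UNIV"
  unfolding aset_def by (rule apx_cong[OF apx_tpf[OF tpf_const[of d 1]]]) simp

lemma aset_Compl: "aset d A \<Longrightarrow> aset d (- A)"
proof -
  assume "aset d A"
  then have "apx d (\<lambda>\<theta>. 1 + (-1) * indicator A \<theta>)"
    unfolding aset_def by (rule apx_add[OF apx_tpf[OF tpf_const] apx_cmult])
  then show ?thesis unfolding aset_def by (rule apx_cong) (auto simp: indicator_def)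
qed

lemma aset_Int: "aset d A \<Longrightarrow> aset d B \<Longrightarrow> aset d (A \<inter> B)"
proof -
  assume "aset d A" "aset d B"
  then have "apx d (\<lambda>\<theta>. indicator A \<theta> * indicator B \<theta>)"
    unfolding aset_def by (rule apx_mult) (auto simp: indicator_def)
  then show ?thesis unfolding aset_def by (rule apx_cong) (auto simp: indicator_def)
qed

lemma aset_Un: "aset d A \<Longrightarrow> aset d B \<Longrightarrow> aset d (A \<union> B)"
  using aset_Compl[OF aset_Int[OF aset_Compl[of d A] aset_Compl[of d B]]] by simp

lemma aset_limit:
  assumes "\<And>k. aset d (A k)" "\<And>\<theta>. \<theta> \<in> torus d \<Longrightarrow> \<forall>\<^sub>F k in sequentially. \<theta> \<in> A k \<longleftrightarrow> \<theta> \<in> B"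
  shows "aset d B"
  unfolding aset_def
proof (rule apx_limit[where f = "\<lambda>k. indicator (A k)" and w = "\<lambda>_. 1"])
  fix \<theta> assume "\<theta> \<in> torus d"
  from assms(2)[OF this] have "\<forall>\<^sub>F k in sequentially. indicator (A k) \<theta> = (indicator B \<theta> :: complex)"
    by eventually_elim (auto simp: indicator_def)
  then show "(\<lambda>k. indicator (A k) \<theta>) \<longlonglongrightarrow> (indicator B \<theta> :: complex)" by (rule tendsto_eventually)
qed (use assms(1) in \<open>auto simp: aset_def indicator_def\<close>)

lemma aset_Union:
  assumes "\<And>k::nat. aset d (A k)"
  shows "aset d (\<Union>k. A k)"
proof (rule aset_limit)
  show "aset d (\<Union>i<k. A i)" for k
  proof (induction k)
    case 0
    show ?case using aset_Compl[OF aset_UNIV] by simp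
  next
    case (Suc k)
    then show ?case using aset_Un[OF Suc assms[of k]] by (simp add: lessThan_Suc Un_commute)
  qed
  fix \<theta>
  show "\<forall>\<^sub>F k in sequentially. \<theta> \<in> (\<Union>i<k. A i) \<longleftrightarrow> \<theta> \<in> (\<Union>k. A k)"
  proof (cases "\<theta> \<in> (\<Union>k. A k)")
    case True
    then obtain i where "\<theta> \<in> A i" by auto
    then show ?thesis by (intro eventually_sequentiallyI[of "Suc i"]) (auto simp: Suc_le_eq)
  qed auto
qed

lemma tpf_coordinate_cis:
  assumes "l < d"
  shows "tpf d (\<lambda>\<theta>. c * cis (real_of_int m * \<theta> l))"
proof -
  define q where "q j = (if j = l then m else 0)" for j
  have "ip d q \<theta> = real_of_int m * \<theta> l" for \<theta>
  proof -
    have "ip d q \<theta> = (\<Sum>j<d. if j = l then real_of_int m * \<theta> l else 0)"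
      unfolding ip_def q_def by (intro sum.cong) auto
    then show ?thesis using assms by simp
  qed
  then show ?thesis using tpf_char[of q d c] assms by (simp add: Zd_def q_def)
qed

text \<open>A real linear functional of \<open>cis x\<close> is a combination of
  \<open>cos x\<close> and \<open>sin x\<close>, and products of characters are characters; so every
  real polynomial on the circle becomes a trigonometric polynomial.\<close>

lemma tpf_real_polynomial_cis:
  assumes g: "real_polynomial_function g" and l: "l < d"
  shows "tpf d (\<lambda>\<theta>. of_real (g (cis (\<theta> l))))"
  using g
proof (induction g rule: real_polynomial_function.induct)
  case (linear f)
  interpret bounded_linear f by (rule linear)
  have eq: "complex_of_real (f (cis x)) = (of_real (f 1) / 2 - \<i> * of_real (f \<i>) / 2) * cis (real_of_int 1 * x)
    + (of_real (f 1) / 2 + \<i> * of_real (f \<i>) / 2) * cis (real_of_int (-1) * x)" for x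
  proof -
    have "cis x = cos x *\<^sub>R 1 + sin x *\<^sub>R \<i>" by (simp add: complex_eq_iff)
    then have "f (cis x) = cos x * f 1 + sin x * f \<i>" by (simp only: add scale real_scaleR_def)
    then show ?thesis by (simp add: complex_eq_iff algebra_simps)
  qed
  show ?case unfolding eq by (intro tpf_add tpf_coordinate_cis l)
next
  case (const c)
  show ?case by (rule tpf_const)
next
  case (add f1 f2)
  then show ?case using tpf_add by simp
next
  case (mult f1 f2)
  then show ?case using tpf_mult by simp
qed

text \<open>Stone-Weierstrass is applied on the circle instead of an interval, which builds in
  periodicity. On a space of finite measure, uniform approximation is L1 approximation.\<close>

lemma apx_continuous_cis:
  fixes h :: "complex \<Rightarrow> real"
  assumes h: "continuous_on (sphere 0 1) h" and l: "l < d"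
    and m: "(\<lambda>\<theta>. h (cis (\<theta> l))) \<in> borel_measurable (tor d)"
  shows "apx d (\<lambda>\<theta>. of_real (h (cis (\<theta> l))))"
proof (rule apxI)
  have "compact (h ` sphere 0 1)" by (intro compact_continuous_image h compact_sphere)
  then obtain B where B: "\<And>z. z \<in> sphere 0 1 \<Longrightarrow> norm (h z) \<le> B"
    using compact_imp_bounded bounded_iff by (metis imageI)
  show "integrable (tor d) (\<lambda>\<theta>. complex_of_real (h (cis (\<theta> l))))"
    using m B by (intro integrable_tor_bounded[of _ _ B]) (auto simp: norm_of_real)
  fix \<epsilon> :: real assume e: "0 < \<epsilon>"
  \<comment> \<open>\<open>(2 * pi) ^ d\<close> is the mass of the torus, and the factor 2 makes the
    final inequality strict.\<close>
  define \<eta> where "\<eta> = \<epsilon> / (2 * (2 * pi) ^ d)"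
  have \<eta>: "0 < \<eta>" using e by (simp add: \<eta>_def)
  obtain g where g: "real_polynomial_function g" "\<And>x. x \<in> sphere 0 1 \<Longrightarrow> \<bar>h x - g x\<bar> < \<eta>"
    using Stone_Weierstrass_real_polynomial_function[OF compact_sphere h \<eta>] by blast
  let ?g = "\<lambda>\<theta>. complex_of_real (g (cis (\<theta> l)))"
  have tg: "tpf d ?g" by (rule tpf_real_polynomial_cis[OF g(1) l])
  have le: "cmod (of_real (h (cis (\<theta> l))) - ?g \<theta>) \<le> \<eta>" for \<theta>
    unfolding of_real_diff[symmetric] norm_of_real using g(2)[of "cis (\<theta> l)"] by simp
  have "(LINT \<theta>|tor d. cmod (of_real (h (cis (\<theta> l))) - ?g \<theta>)) \<le> (LINT \<theta>|tor d. \<eta>)"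
  proof (rule integral_mono)
    show "integrable (tor d) (\<lambda>\<theta>. cmod (of_real (h (cis (\<theta> l))) - ?g \<theta>))"
      using \<open>integrable (tor d) (\<lambda>\<theta>. complex_of_real (h (cis (\<theta> l))))\<close> tpf_integrable[OF tg]
      by (intro integrable_norm Bochner_Integration.integrable_diff)
  qed (use le in auto)
  also have "\<dots> = \<epsilon> / 2" by (simp add: measure_tor \<eta>_def)
  also have "\<dots> < \<epsilon>" using e by simp
  finally show "\<exists>g. apx d g \<and> (LINT \<theta>|tor d. cmod (of_real (h (cis (\<theta> l))) - g \<theta>)) < \<epsilon>"
    using apx_tpf[OF tg] by blast
qed

lemma torusD: "\<theta> \<in> torus d \<Longrightarrow> l < d \<Longrightarrow> - pi \<le> \<theta> l \<and> \<theta> l < pi"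
  unfolding torus_def by (drule PiE_mem[of _ _ _ l]) auto

text \<open>For \<open>a\<close> inside the interval the half-space corresponds to the closed arc
  from \<open>-pi\<close> to \<open>a\<close>, because \<open>cis\<close> is injective on the
  half-open interval. Continuous functions of the distance to the arc decrease to its
  indicator.\<close>

lemma aset_halfspace:
  assumes l: "l < d"
  shows "aset d {\<theta>. \<theta> l \<le> a}"
proof -
  consider "a < - pi" | "pi \<le> a" | "- pi \<le> a" "a < pi" by linarith
  then show ?thesis
  proof cases
    case 1
    then have "{} \<inter> torus d = {\<theta>. \<theta> l \<le> a} \<inter> torus d" using torusD[OF _ l] by fastforce
    then show ?thesis using aset_cong[OF aset_Compl[OF aset_UNIV]] by simp
  next
    case 2
    then have "UNIV \<inter> torus d = {\<theta>. \<theta> l \<le> a} \<inter> torus d" using torusD[OF _ l] by fastforce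
    then show ?thesis by (rule aset_cong[OF aset_UNIV])
  next
    case 3
    define A where "A = cis ` {-pi..a}"
    have A: "closed A" "A \<noteq> {}"
      using 3 by (auto simp: A_def intro!: compact_imp_closed compact_continuous_image continuous_intros)
    have inA: "cis x \<in> A \<longleftrightarrow> x \<le> a" if x: "- pi \<le> x" "x < pi" for x
    proof
      assume "cis x \<in> A"
      then obtain y where y: "- pi \<le> y" "y \<le> a" "cis x = cis y" by (auto simp: A_def)
      have "cis (x - y) = 1" using y(3) by (simp add: cis_divide[symmetric])
      then obtain k :: int where k: "x - y = of_int (2 * k) * pi" unfolding cis_conv_exp exp_eq_1 by auto
      have "\<bar>x - y\<bar> < 2 * pi" using x y 3 by linarith
      then have "\<bar>real_of_int k\<bar> * (2 * pi) < 1 * (2 * pi)" unfolding k by (simp add: abs_mult mult_ac)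
      then have "\<bar>real_of_int k\<bar> < 1" by (rule mult_right_less_imp_less) simp
      then have "k = 0" by linarith
      then show "x \<le> a" using k y(2) by simp
    qed (use x in \<open>auto simp: A_def\<close>)
    define h where "h k z = max 0 (1 - real k * infdist z A)" for k z
    have "apx d (indicator {\<theta>. \<theta> l \<le> a})"
    proof (rule apx_limit[where f = "\<lambda>k \<theta>. of_real (h k (cis (\<theta> l)))" and w = "\<lambda>_. 1"])
      show "apx d (\<lambda>\<theta>. complex_of_real (h k (cis (\<theta> l))))" for k
      proof (rule apx_continuous_cis[OF _ l])
        show "continuous_on (sphere 0 1) (h k)" unfolding h_def by (intro continuous_intros)
        have "(\<lambda>x. h k (cis x)) \<in> borel_measurable borel"
          unfolding h_def by (intro borel_measurable_continuous_onI continuous_intros)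
        then show "(\<lambda>\<theta>. h k (cis (\<theta> l))) \<in> borel_measurable (tor d)"
          by (rule measurable_compose[OF coord_measurable[OF l]])
      qed
      fix \<theta> assume th: "\<theta> \<in> torus d"
      have iff: "cis (\<theta> l) \<in> A \<longleftrightarrow> \<theta> l \<le> a" using inA torusD[OF th l] by simp
      have "(\<lambda>k. h k (cis (\<theta> l))) \<longlonglongrightarrow> indicator {\<theta>. \<theta> l \<le> a} \<theta>"
      proof (cases "\<theta> l \<le> a")
        case True
        then have "infdist (cis (\<theta> l)) A = 0" using iff by (simp add: infdist_zero)
        then show ?thesis using True by (simp add: h_def)
      next
        case False
        then have "0 < infdist (cis (\<theta> l)) A"
          using iff A in_closed_iff_infdist_zero[of A "cis (\<theta> l)"] infdist_nonneg[of "cis (\<theta> l)" A] by fastforce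
        then obtain k0 :: nat where k0: "1 < real k0 * infdist (cis (\<theta> l)) A"
          using ex_less_of_nat_mult by blast
        have "h k (cis (\<theta> l)) = 0" if "k0 \<le> k" for k
        proof -
          have "real k0 * infdist (cis (\<theta> l)) A \<le> real k * infdist (cis (\<theta> l)) A"
            using that by (intro mult_right_mono) (auto simp: infdist_nonneg)
          then show ?thesis using k0 by (simp add: h_def)
        qed
        then show ?thesis using False by (intro tendsto_eventually eventually_sequentiallyI[of k0]) auto
      qed
      then have "(\<lambda>k. complex_of_real (h k (cis (\<theta> l)))) \<longlonglongrightarrow> of_real (indicator {\<theta>. \<theta> l \<le> a} \<theta>)"
        by (rule tendsto_of_real)
      then show "(\<lambda>k. complex_of_real (h k (cis (\<theta> l)))) \<longlonglongrightarrow> indicator {\<theta>. \<theta> l \<le> a} \<theta>"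
        by (simp add: indicator_def of_bool_def split: if_splits)
      show "cmod (complex_of_real (h k (cis (\<theta> l)))) \<le> 1" for k
        unfolding norm_of_real h_def using infdist_nonneg[of "cis (\<theta> l)" A] by simp
    qed simp
    then show ?thesis by (simp add: aset_def)
  qed
qed

lemma aset_coordinate:
  assumes l: "l < d" and B: "B \<in> sets borel"
  shows "aset d {\<theta>. \<theta> l \<in> B}"
proof -
  have "B \<in> sigma_sets UNIV (range (\<lambda>a::real. {..a}))"
    using B unfolding borel_eq_atMost by (simp add: sets_measure_of)
  then show ?thesis
  proof (induction rule: sigma_sets.induct)
    case (Basic B)
    then show ?case using aset_halfspace[OF l] by auto
  next
    case Empty
    show ?case using aset_Compl[OF aset_UNIV] by simp
  next
    case (Compl B)
    then show ?case using aset_Compl[OF Compl.IH] by (simp add: Compl_eq Collect_neg_eq[symmetric])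
  next
    case (Union B)
    have "{\<theta>. \<theta> l \<in> \<Union> (range B)} = (\<Union>i. {\<theta>. \<theta> l \<in> B i})" by auto
    then show ?case using aset_Union[OF Union.IH] by simp
  qed
qed

lemma aset_measurable:
  assumes "A \<in> sets (torus_measure d)"
  shows "aset d A"
proof -
  let ?S = "PiE {..<d} (\<lambda>_. UNIV :: real set)"
  have sub: "torus d \<subseteq> ?S" unfolding torus_def by (intro PiE_mono) auto
  have "A \<in> sigma_sets ?S {{f \<in> ?S. f i \<in> B} |i B. i \<in> {..<d} \<and> B \<in> sets borel}"
    using assms unfolding torus_measure_def sets_PiM_single by simp
  then show ?thesis
  proof (induction rule: sigma_sets.induct)
    case (Basic A)
    then obtain i B where A: "A = {f \<in> ?S. f i \<in> B}" "i < d" "B \<in> sets borel" by auto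
    show ?case by (rule aset_cong[OF aset_coordinate[OF A(2,3)]]) (use sub A(1) in auto)
  next
    case Empty
    show ?case using aset_Compl[OF aset_UNIV] by simp
  next
    case (Compl A)
    show ?case by (rule aset_cong[OF aset_Compl[OF Compl.IH]]) (use sub in auto)
  next
    case (Union A)
    show ?case by (rule aset_Union[OF Union.IH])
  qed
qed

lemma integrable_imp_apx:
  assumes "integrable (tor d) f"
  shows "apx d f"
  using assms
proof (induction rule: integrable_induct)
  case (base A c)
  then obtain A' where "A = torus d \<inter> A'" "A' \<in> sets (torus_measure d)"
    unfolding tor_def sets_restrict_space by auto
  then have "A \<in> sets (torus_measure d)" by (simp add: sets.Int torus_sets)
  then have "apx d (\<lambda>\<theta>. c * indicator A \<theta>)" using aset_measurable unfolding aset_def by (intro apx_cmult)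
  then show ?case by (rule apx_cong) (auto simp: indicator_def)
next
  case (add f g)
  then show ?case by (intro apx_add)
next
  case (lim f s)
  show ?case
  proof (rule apx_limit[where f = s and w = "\<lambda>\<theta>. 2 * norm (f \<theta>)"])
    show "integrable (tor d) (\<lambda>\<theta>. 2 * cmod (f \<theta>))" using lim by auto
  qed (use lim in \<open>auto simp: space_tor\<close>)
qed

section \<open>Fourier coefficients of integrable functions\<close>

text \<open>The Fourier coefficient at the frequency with coordinates
  \<open>\<sigma> l * q l\<close>. Sign patterns other than 1 arise from the \<open>q2\<close> part,
  see \<open>fourier_coeff_components\<close>.\<close>

definition fcoeff :: "nat \<Rightarrow> (nat \<Rightarrow> int) \<Rightarrow> ((nat \<Rightarrow> real) \<Rightarrow> complex) \<Rightarrow> (nat \<Rightarrow> int) \<Rightarrow> complex" where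
  "fcoeff d \<sigma> f q = (LINT \<theta>|tor d. cis (- ip d (\<lambda>l. \<sigma> l * q l) \<theta>) * f \<theta>) / of_real ((2 * pi) ^ d)"

lemma ip_uminus: "- ip d q \<theta> = ip d (\<lambda>l. - q l) \<theta>"
  by (simp add: ip_def sum_negf)

lemma integrable_cis_mult:
  assumes f: "integrable (tor d) f"
  shows "integrable (tor d) (\<lambda>\<theta>. cis (- ip d q \<theta>) * f \<theta>)"
proof (rule Bochner_Integration.integrable_bound[OF f])
  have "(\<lambda>\<theta>. cis (- ip d q \<theta>)) \<in> borel_measurable (tor d)"
    unfolding ip_uminus by (rule cis_ip_measurable)
  then show "(\<lambda>\<theta>. cis (- ip d q \<theta>) * f \<theta>) \<in> borel_measurable (tor d)"
    using borel_measurable_integrable[OF f] by (rule borel_measurable_times)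
qed (simp add: norm_mult)

lemma fcoeff_diff:
  assumes "integrable (tor d) f" "integrable (tor d) g"
  shows "fcoeff d \<sigma> (\<lambda>\<theta>. f \<theta> - g \<theta>) q = fcoeff d \<sigma> f q - fcoeff d \<sigma> g q"
  unfolding fcoeff_def right_diff_distrib
  by (subst Bochner_Integration.integral_diff)
    (auto intro: integrable_cis_mult assms simp: diff_divide_distrib)

text \<open>Smoothing the coefficients means integrating \<open>f\<close> against
  \<open>G k\<close>, a product of one-dimensional kernels translated to the grid point
  \<open>k\<close>. After the grid mean is interchanged with the integral, the mean of
  \<open>cmod (G k \<theta>)\<close> over \<open>k\<close> factorizes, and \<open>kbound\<close>
  controls each factor uniformly in \<open>\<theta>\<close>.\<close>

lemma L1le_fcoeff:
  assumes f: "integrable (tor d) f"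
  shows "L1le d (fcoeff d \<sigma> f) ((LINT \<theta>|tor d. cmod (f \<theta>)) / (2 * pi) ^ d)"
  unfolding L1le_def
proof (intro allI impI)
  fix n D \<kappa> b assume h: "\<forall>l<d. 0 < n l \<and> kbound (n l) (D l) (\<kappa> l) (b l)"
  define T :: real where "T = (2 * pi) ^ d"
  have T: "0 < T" by (simp add: T_def)
  define A where "A q k = (\<Prod>l<d. \<kappa> l (q l)) * zchr d n q k" for q k
  define G where "G k \<theta> = (\<Sum>q\<in>fbox d D. A q k * cis (- ip d (\<lambda>l. \<sigma> l * q l) \<theta>))" for k \<theta>
  define K where "K l j \<theta> = (\<Sum>q=-int (D l)..int (D l). \<kappa> l q * cis (real_of_int q * (2 * pi * real j / real (n l) - real_of_int (\<sigma> l) * \<theta> l)))"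
    for l j \<theta>
  have Gi: "integrable (tor d) (\<lambda>\<theta>. G k \<theta> * f \<theta>)" for k
    unfolding G_def sum_distrib_right mult.assoc
    by (intro Bochner_Integration.integrable_sum integrable_mult_right integrable_cis_mult f)
  have sm: "smooth d n D \<kappa> (fcoeff d \<sigma> f) k = (LINT \<theta>|tor d. G k \<theta> * f \<theta>) / of_real T" for k
  proof -
    have "(LINT \<theta>|tor d. G k \<theta> * f \<theta>) = (\<Sum>q\<in>fbox d D. A q k * (LINT \<theta>|tor d. cis (- ip d (\<lambda>l. \<sigma> l * q l) \<theta>) * f \<theta>))"
      unfolding G_def sum_distrib_right mult.assoc
      by (subst Bochner_Integration.integral_sum) (auto intro!: integrable_cis_mult f)
    then show ?thesis
      unfolding smooth_def fcoeff_def A_def T_def sum_divide_distrib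
      by (simp add: sum_divide_distrib mult_ac)
  qed
  have GK: "G k \<theta> = (\<Prod>l<d. K l (k l) \<theta>)" for k \<theta>
  proof -
    have "G k \<theta> = (\<Sum>q\<in>fbox d D. \<Prod>l<d. \<kappa> l (q l) * cis (real_of_int (q l) * (2 * pi * real (k l) / real (n l) - real_of_int (\<sigma> l) * \<theta> l)))"
      unfolding G_def
    proof (intro sum.cong refl)
      fix q
      have "cis (- ip d (\<lambda>l. \<sigma> l * q l) \<theta>) = (\<Prod>l<d. cis (- (real_of_int (\<sigma> l * q l) * \<theta> l)))"
        unfolding ip_def sum_negf[symmetric] by (rule cis_sum) simp
      then have "A q k * cis (- ip d (\<lambda>l. \<sigma> l * q l) \<theta>)
        = (\<Prod>l<d. \<kappa> l (q l) * (zc (n l) (q l) (k l) * cis (- (real_of_int (\<sigma> l * q l) * \<theta> l))))"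
        by (simp add: A_def zchr_def prod.distrib mult.assoc)
      also have "\<dots> = (\<Prod>l<d. \<kappa> l (q l) * cis (real_of_int (q l) * (2 * pi * real (k l) / real (n l) - real_of_int (\<sigma> l) * \<theta> l)))"
        unfolding zc_def cis_mult by (intro prod.cong refl) (simp add: algebra_simps)
      finally show "A q k * cis (- ip d (\<lambda>l. \<sigma> l * q l) \<theta>) = \<dots>" .
    qed
    also have "\<dots> = (\<Prod>l<d. K l (k l) \<theta>)" unfolding K_def by (rule sum_fbox_prod)
    finally show ?thesis .
  qed
  have avgG: "gavg d n (\<lambda>k. cmod (G k \<theta>)) \<le> (\<Prod>l<d. b l)" for \<theta>
  proof -
    have "gavg d n (\<lambda>k. cmod (G k \<theta>)) = (\<Sum>k\<in>lam d n. \<Prod>l<d. cmod (K l (k l) \<theta>)) / real (Nsize d n)"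
      by (simp add: gavg_def GK prod_norm)
    also have "(\<Sum>k\<in>lam d n. \<Prod>l<d. cmod (K l (k l) \<theta>)) = (\<Prod>l<d. \<Sum>j<n l. cmod (K l j \<theta>))"
      unfolding lam_def by (rule prod_sum_PiE[symmetric]) auto
    also have "\<dots> / real (Nsize d n) = (\<Prod>l<d. (\<Sum>j<n l. cmod (K l j \<theta>)) / real (n l))"
      by (simp add: Nsize_def prod_dividef)
    also have "\<dots> \<le> (\<Prod>l<d. b l)"
    proof (intro prod_mono conjI)
      fix l assume l: "l \<in> {..<d}"
      show "0 \<le> (\<Sum>j<n l. cmod (K l j \<theta>)) / real (n l)" by (simp add: sum_nonneg)
      have "kbound (n l) (D l) (\<kappa> l) (b l)" using h l by simp
      then show "(\<Sum>j<n l. cmod (K l j \<theta>)) / real (n l) \<le> b l"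
        unfolding kbound_def K_def by blast
    qed
    finally show ?thesis .
  qed
  have "gavg d n (\<lambda>k. cmod (smooth d n D \<kappa> (fcoeff d \<sigma> f) k)) \<le> gavg d n (\<lambda>k. (1 / T) * (LINT \<theta>|tor d. cmod (G k \<theta>) * cmod (f \<theta>)))"
  proof (rule gavg_mono)
    fix k
    have "cmod (LINT \<theta>|tor d. G k \<theta> * f \<theta>) \<le> (LINT \<theta>|tor d. cmod (G k \<theta> * f \<theta>))" by (rule integral_norm_bound)
    then show "cmod (smooth d n D \<kappa> (fcoeff d \<sigma> f) k) \<le> (1 / T) * (LINT \<theta>|tor d. cmod (G k \<theta>) * cmod (f \<theta>))"
      unfolding sm norm_divide norm_of_real using T by (simp add: norm_mult divide_right_mono)
  qed
  also have "\<dots> = (1 / T) * gavg d n (\<lambda>k. LINT \<theta>|tor d. cmod (G k \<theta>) * cmod (f \<theta>))"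
    by (rule gavg_cmult)
  also have "gavg d n (\<lambda>k. LINT \<theta>|tor d. cmod (G k \<theta>) * cmod (f \<theta>)) = (LINT \<theta>|tor d. gavg d n (\<lambda>k. cmod (G k \<theta>)) * cmod (f \<theta>))"
  proof -
    have i: "integrable (tor d) (\<lambda>\<theta>. cmod (G k \<theta>) * cmod (f \<theta>))" for k
      using integrable_norm[OF Gi[of k]] by (simp add: norm_mult)
    have "(\<Sum>k\<in>lam d n. LINT \<theta>|tor d. cmod (G k \<theta>) * cmod (f \<theta>)) = (LINT \<theta>|tor d. (\<Sum>k\<in>lam d n. cmod (G k \<theta>) * cmod (f \<theta>)))"
      by (rule Bochner_Integration.integral_sum[symmetric]) (rule i)
    then show ?thesis by (simp add: gavg_def sum_distrib_right[symmetric])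
  qed
  also have "(1 / T) * \<dots> \<le> (1 / T) * (LINT \<theta>|tor d. (\<Prod>l<d. b l) * cmod (f \<theta>))"
  proof (intro mult_left_mono integral_mono)
    have "integrable (tor d) (\<lambda>\<theta>. \<Sum>k\<in>lam d n. cmod (G k \<theta>) * cmod (f \<theta>))"
      using integrable_norm[OF Gi] by (intro Bochner_Integration.integrable_sum) (simp add: norm_mult)
    then have "integrable (tor d) (\<lambda>\<theta>. (\<Sum>k\<in>lam d n. cmod (G k \<theta>) * cmod (f \<theta>)) / real (Nsize d n))" by simp
    then show "integrable (tor d) (\<lambda>\<theta>. gavg d n (\<lambda>k. cmod (G k \<theta>)) * cmod (f \<theta>))"
      by (simp add: gavg_def sum_distrib_right[symmetric])
    show "integrable (tor d) (\<lambda>\<theta>. (\<Prod>l<d. b l) * cmod (f \<theta>))" using f by simp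
    show "gavg d n (\<lambda>k. cmod (G k \<theta>)) * cmod (f \<theta>) \<le> (\<Prod>l<d. b l) * cmod (f \<theta>)" for \<theta>
      using avgG by (rule mult_right_mono) simp
  qed (use T in simp)
  also have "\<dots> = (LINT \<theta>|tor d. cmod (f \<theta>)) / (2 * pi) ^ d * (\<Prod>l<d. b l)" by (simp add: T_def)
  finally show "gavg d n (\<lambda>k. cmod (smooth d n D \<kappa> (fcoeff d \<sigma> f) k)) \<le> (LINT \<theta>|tor d. cmod (f \<theta>)) / (2 * pi) ^ d * (\<Prod>l<d. b l)" .
qed

text \<open>\<open>smooth\<close> reads coefficients on \<open>Zd d\<close> only, and
  \<open>fcoeff_trig_poly\<close> determines them there.\<close>

lemma L1le_cong:
  assumes "L1le d c B" "\<And>q. q \<in> Zd d \<Longrightarrow> c q = c' q"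
  shows "L1le d c' B"
proof -
  have "smooth d n D \<kappa> c k = smooth d n D \<kappa> c' k" for n D \<kappa> k
    unfolding smooth_def using assms(2) by (intro sum.cong) (auto simp: fbox_def)
  then show ?thesis using assms(1) unfolding L1le_def by simp
qed

lemma fcoeff_trig_poly:
  assumes Q: "finite Q" "Q \<subseteq> Zd d" and q: "q \<in> Zd d"
  shows "fcoeff d \<sigma> (\<lambda>\<theta>. \<Sum>r\<in>Q. a r * cis (ip d r \<theta>)) q =
    (if (\<lambda>l. \<sigma> l * q l) \<in> Q then a (\<lambda>l. \<sigma> l * q l) else 0)"
proof -
  define s where "s = (\<lambda>l. \<sigma> l * q l)"
  have s: "s \<in> Zd d" using q by (simp add: s_def Zd_def)
  have "(LINT \<theta>|tor d. cis (- ip d s \<theta>) * (\<Sum>r\<in>Q. a r * cis (ip d r \<theta>)))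
     = (LINT \<theta>|tor d. (\<Sum>r\<in>Q. a r * cis (ip d (\<lambda>l. r l + - s l) \<theta>)))"
    unfolding ip_add sum_distrib_left cis_mult[symmetric] ip_uminus[symmetric] by (simp add: mult_ac)
  also have "\<dots> = (\<Sum>r\<in>Q. a r * (LINT \<theta>|tor d. cis (ip d (\<lambda>l. r l + - s l) \<theta>)))"
    by (subst Bochner_Integration.integral_sum) (auto intro: integrable_cis_ip)
  also have "\<dots> = (\<Sum>r\<in>Q. if r = s then a r * of_real ((2 * pi) ^ d) else 0)"
  proof (intro sum.cong refl)
    fix r assume "r \<in> Q"
    then have r: "r \<in> Zd d" using Q by auto
    have "(\<forall>l<d. r l + - s l = 0) \<longleftrightarrow> r = s"
    proof
      assume *: "\<forall>l<d. r l + - s l = 0"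
      have "r l = s l" for l using * r s by (cases "l < d") (auto simp: Zd_def)
      then show "r = s" by auto
    qed simp
    then show "a r * (LINT \<theta>|tor d. cis (ip d (\<lambda>l. r l + - s l) \<theta>)) = (if r = s then a r * of_real ((2 * pi) ^ d) else 0)"
      unfolding integral_cis_ip by simp
  qed
  also have "\<dots> = (if s \<in> Q then a s * of_real ((2 * pi) ^ d) else 0)" using Q(1) by (simp add: sum.delta)
  finally show ?thesis unfolding fcoeff_def s_def[symmetric] by simp
qed

text \<open>Density gives a trigonometric polynomial close to \<open>f\<close> in L1. Multiplying
  frequencies by \<open>\<sigma>\<close> is an involution, so the polynomial still yields a
  coefficient function \<open>p\<close> of finite support.\<close>

lemma L1type_fcoeff:
  assumes f: "integrable (tor d) f" and \<sigma>: "\<And>l. \<sigma> l * \<sigma> l = 1"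
  shows "L1type d (fcoeff d \<sigma> f)"
  unfolding L1type_def
proof (intro allI impI)
  fix \<eta> :: real assume "0 < \<eta>"
  then have "0 < \<eta> * (2 * pi) ^ d" by simp
  then obtain g where g: "tpf d g" "L1dist d f g < \<eta> * (2 * pi) ^ d"
    using integrable_imp_apx[OF f] unfolding apx_def by blast
  have gi: "integrable (tor d) g" by (rule tpf_integrable[OF g(1)])
  obtain Q a where Q: "finite Q" "Q \<subseteq> Zd d" "g = (\<lambda>\<theta>. \<Sum>q\<in>Q. a q * cis (ip d q \<theta>))"
    using g(1) unfolding tpf_def by (auto simp: fun_eq_iff)
  define p where "p q = (if (\<lambda>l. \<sigma> l * q l) \<in> Q then a (\<lambda>l. \<sigma> l * q l) else 0)" for q
  have inv: "(\<lambda>l. \<sigma> l * (\<sigma> l * q l)) = q" for q using \<sigma> by (simp add: mult.assoc[symmetric])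
  have "{q. p q \<noteq> 0} \<subseteq> (\<lambda>q l. \<sigma> l * q l) ` Q"
  proof
    fix q assume "q \<in> {q. p q \<noteq> 0}"
    then have "(\<lambda>l. \<sigma> l * q l) \<in> Q" by (auto simp: p_def split: if_splits)
    then show "q \<in> (\<lambda>q l. \<sigma> l * q l) ` Q" using inv[of q] by (intro image_eqI[of _ _ "\<lambda>l. \<sigma> l * q l"]) auto
  qed
  moreover have "(\<lambda>q l. \<sigma> l * q l) ` Q \<subseteq> Zd d" using Q(2) by (auto simp: Zd_def)
  ultimately have p: "trigpoly d p" unfolding trigpoly_def using Q(1) finite_subset by blast
  have "L1le d (fcoeff d \<sigma> (\<lambda>\<theta>. f \<theta> - g \<theta>)) \<eta>"
    by (rule L1le_mono[OF L1le_fcoeff]) (use f gi g(2) in \<open>auto simp: divide_simps\<close>)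
  then have "L1le d (\<lambda>q. fcoeff d \<sigma> f q - p q) \<eta>"
  proof (rule L1le_cong)
    fix q assume "q \<in> Zd d"
    then show "fcoeff d \<sigma> (\<lambda>\<theta>. f \<theta> - g \<theta>) q = fcoeff d \<sigma> f q - p q"
      unfolding fcoeff_diff[OF f gi] unfolding Q(3) p_def by (simp add: fcoeff_trig_poly[OF Q(1,2)])
  qed
  then show "\<exists>p. trigpoly d p \<and> L1le d (\<lambda>q. fcoeff d \<sigma> f q - p q) \<eta>" using p by blast
qed

text \<open>Moving the right exponential past j reverses the sign of its frequencies.\<close>

lemma qexpi_conjugate:
  "qmul (qexpi x) (qmul w (qexpi y)) = qc (cis (x + y) * q1 w) + qmul (qc (cis (x - y) * q2 w)) qj"
  by (simp add: quat_eq_iff qexpi_def q1_def q2_def cos_add sin_add cos_diff sin_diff algebra_simps)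

lemma bounded_linear_qc: "bounded_linear qc"
  unfolding linear_conv_bounded_linear[symmetric] by (rule linearI) (auto simp: quat_eq_iff)

lemma bounded_linear_qc_qj: "bounded_linear (\<lambda>z. qmul (qc z) qj)"
  unfolding linear_conv_bounded_linear[symmetric] by (rule linearI) (auto simp: quat_eq_iff)

lemma bounded_linear_q1: "bounded_linear q1"
  unfolding linear_conv_bounded_linear[symmetric] by (rule linearI) (auto simp: q1_def complex_eq_iff)

lemma bounded_linear_q2: "bounded_linear q2"
  unfolding linear_conv_bounded_linear[symmetric] by (rule linearI) (auto simp: q2_def complex_eq_iff)

text \<open>The values are 1 and -1 at every \<open>l\<close>, also beyond \<open>d\<close>, since
  \<open>L1type_fcoeff\<close> asks for squares equal to 1 everywhere.\<close>

definition sgnSL :: "nat set \<Rightarrow> nat \<Rightarrow> int" where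
  "sgnSL SL l = (if l \<in> SL then 1 else -1)"

text \<open>By \<open>qexpi_conjugate\<close> the phases of the two exponentials add in the
  \<open>q1\<close> part and subtract in the \<open>q2\<close> part. The sum is the full inner
  product; the difference reverses the coordinates outside \<open>SL\<close>.\<close>

lemma fourier_coeff_components:
  assumes SL: "SL \<subseteq> {..<d}" and F: "integrable (tor d) (\<lambda>\<theta>. F \<theta> a b)"
  shows "q1 (fourier_coeff d SL F q a b) = fcoeff d (\<lambda>_. 1) (\<lambda>\<theta>. q1 (F \<theta> a b)) q"
    and "q2 (fourier_coeff d SL F q a b) = fcoeff d (sgnSL SL) (\<lambda>\<theta>. q2 (F \<theta> a b)) q"
proof -
  have split: "(\<Sum>l<d. f l) = (\<Sum>l\<in>SL. f l) + (\<Sum>l\<in>{..<d} - SL. f l)" for f :: "nat \<Rightarrow> real"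
    using sum.subset_diff[OF SL, of f] by simp
  have s1: "- ipS SL q \<theta> + - ipS ({..<d} - SL) q \<theta> = - ip d (\<lambda>l. 1 * q l) \<theta>" for \<theta>
    unfolding ip_def ipS_def split by simp
  have s2: "- ipS SL q \<theta> - - ipS ({..<d} - SL) q \<theta> = - ip d (\<lambda>l. sgnSL SL l * q l) \<theta>" for \<theta>
  proof -
    have "(\<Sum>l\<in>SL. real_of_int (sgnSL SL l * q l) * \<theta> l) = (\<Sum>l\<in>SL. real_of_int (q l) * \<theta> l)"
      by (intro sum.cong) (auto simp: sgnSL_def)
    moreover have "(\<Sum>l\<in>{..<d} - SL. real_of_int (sgnSL SL l * q l) * \<theta> l) = - (\<Sum>l\<in>{..<d} - SL. real_of_int (q l) * \<theta> l)"
      unfolding sum_negf[symmetric] by (intro sum.cong) (auto simp: sgnSL_def)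
    ultimately show ?thesis unfolding ip_def ipS_def split by simp
  qed
  define u where "u \<theta> = cis (- ip d (\<lambda>l. 1 * q l) \<theta>) * q1 (F \<theta> a b)" for \<theta>
  define v where "v \<theta> = cis (- ip d (\<lambda>l. sgnSL SL l * q l) \<theta>) * q2 (F \<theta> a b)" for \<theta>
  have ui: "integrable (tor d) u" unfolding u_def
    by (intro integrable_cis_mult integrable_bounded_linear[OF bounded_linear_q1] F)
  have vi: "integrable (tor d) v" unfolding v_def
    by (intro integrable_cis_mult integrable_bounded_linear[OF bounded_linear_q2] F)
  have "fourier_coeff d SL F q a b = (1 / (2 * pi) ^ d) *\<^sub>R (LINT \<theta>|tor d. qc (u \<theta>) + qmul (qc (v \<theta>)) qj)"
    unfolding fourier_coeff_def integral_tor[symmetric] qexpi_conjugate s1 s2 u_def v_def ..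
  also have "(LINT \<theta>|tor d. qc (u \<theta>) + qmul (qc (v \<theta>)) qj) = (LINT \<theta>|tor d. qc (u \<theta>)) + (LINT \<theta>|tor d. qmul (qc (v \<theta>)) qj)"
    by (intro Bochner_Integration.integral_add integrable_bounded_linear[OF bounded_linear_qc]
        integrable_bounded_linear[OF bounded_linear_qc_qj] ui vi)
  also have "(LINT \<theta>|tor d. qc (u \<theta>)) = qc (LINT \<theta>|tor d. u \<theta>)"
    by (rule integral_bounded_linear[OF bounded_linear_qc ui])
  also have "(LINT \<theta>|tor d. qmul (qc (v \<theta>)) qj) = qmul (qc (LINT \<theta>|tor d. v \<theta>)) qj"
    by (rule integral_bounded_linear[OF bounded_linear_qc_qj vi])
  finally have eq: "fourier_coeff d SL F q a b = (1 / (2 * pi) ^ d) *\<^sub>R (qc (LINT \<theta>|tor d. u \<theta>) + qmul (qc (LINT \<theta>|tor d. v \<theta>)) qj)" .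
  have "q1 (r *\<^sub>R (qc x + qmul (qc y) qj)) = of_real r * x" "q2 (r *\<^sub>R (qc x + qmul (qc y) qj)) = of_real r * y" for r x y
    by (simp_all add: q1_def q2_def complex_eq_iff)
  then show "q1 (fourier_coeff d SL F q a b) = fcoeff d (\<lambda>_. 1) (\<lambda>\<theta>. q1 (F \<theta> a b)) q"
    "q2 (fourier_coeff d SL F q a b) = fcoeff d (sgnSL SL) (\<lambda>\<theta>. q2 (F \<theta> a b)) q"
    unfolding eq fcoeff_def u_def v_def by (simp_all add: divide_simps)
qed

lemma grid_ev_ball:
  assumes "finite I" "\<And>i. i \<in> I \<Longrightarrow> grid_ev d (P i)"
  shows "grid_ev d (\<lambda>n. \<forall>i\<in>I. P i n)"
  using assms
proof (induction I rule: finite_induct)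
  case empty
  then show ?case by (simp add: grid_ev_def)
next
  case (insert i I)
  then have "grid_ev d (\<lambda>n. P i n \<and> (\<forall>i\<in>I. P i n))" by (intro grid_ev_conj) auto
  then show ?case by (rule grid_ev_mono) auto
qed

section \<open>Assembling the quaternion matrices from scalar ones\<close>

lemma q1_scaleR: "q1 (r *\<^sub>R x) = of_real r * q1 x" by (simp add: q1_def complex_eq_iff)
lemma q2_scaleR: "q2 (r *\<^sub>R x) = of_real r * q2 x" by (simp add: q2_def complex_eq_iff)
lemma q1_diff: "q1 (x - y) = q1 x - q1 y" by (simp add: q1_def complex_eq_iff)
lemma q2_diff: "q2 (x - y) = q2 x - q2 y" by (simp add: q2_def complex_eq_iff)

text \<open>A boolean selects the component, so that entries and components form one finite index
  set with a common box.\<close>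

definition qcomp :: "bool \<Rightarrow> quat \<Rightarrow> complex" where
  "qcomp h x = (if h then q1 x else q2 x)"

definition qunit :: "bool \<Rightarrow> quat" where
  "qunit h = (if h then qc 1 else qj)"

lemma norm_qunit: "norm (qunit h) = 1"
  by (simp add: qunit_def norm_qj norm_qc)

lemma qcomp_sum: "qcomp h (\<Sum>i\<in>A. f i) = (\<Sum>i\<in>A. qcomp h (f i))"
  by (simp add: qcomp_def q1_sum q2_sum)

lemma qcomp_diff: "qcomp h (x - y) = qcomp h x - qcomp h y"
  by (simp add: qcomp_def q1_diff q2_diff)

lemma qcomp_scaleR: "qcomp h (r *\<^sub>R x) = of_real r * qcomp h x"
  by (simp add: qcomp_def q1_scaleR q2_scaleR)

lemma quat_eq_sum_qcomp: "(\<Sum>h\<in>UNIV. qmul (qc (qcomp h x)) (qunit h)) = x"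
  using quat_decomp[of x] by (simp add: UNIV_bool qcomp_def qunit_def add.commute)

lemma qcomp_toeplitz_minus_circulant:
  assumes s: "0 < s" and t: "0 < t"
  shows "qcomp h (toeplitz d n s t Fh i j - (\<Sum>q\<in>S. kron_rq s t (mshift n q d) (Fh q) i j))
    = qcomp h (Fh (mdiff d (mi d n (i div s)) (mi d n (j div t))) (i mod s) (j mod t))
      - circ d n S (\<lambda>q. qcomp h (Fh q (i mod s) (j mod t))) (mi d n (i div s)) (mi d n (j div t))"
proof -
  have 1: "mdiff d (mi d n (i div s)) (mi d n (j div t))
     = (\<lambda>l. if l < d then int (midx d n (i div s) l) - int (midx d n (j div t) l) else 0)"
    by (auto simp: mdiff_def mi_def)
  have 2: "qcomp h (kron_rq s t (mshift n q d) (Fh q) i j) =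
     (if \<forall>l<d. int (n l) dvd int (mi d n (i div s) l) - int (mi d n (j div t) l) - q l
      then qcomp h (Fh q (i mod s) (j mod t)) else 0)" for q
  proof -
    have "(\<forall>l<d. int (n l) dvd int (mi d n (i div s) l) - int (mi d n (j div t) l) - q l) \<longleftrightarrow>
      (\<forall>l<d. int (n l) dvd int (midx d n (i div s) l) - int (midx d n (j div t) l) - q l)"
      by (simp add: mi_def)
    then show ?thesis unfolding kron_rq_def qcomp_scaleR mshift_eq by auto
  qed
  show ?thesis unfolding qcomp_diff qcomp_sum toeplitz_def 1 circ_def 2 ..
qed

text \<open>The matrix is a sum of \<open>2 * (s * t)\<close> pieces, one for each position in a
  block and each complex component, and every piece comes from one scalar splitting. Rank and norm
  bounds add up.\<close>

lemma quat_matrix_splits: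
  assumes n: "\<And>l. l < d \<Longrightarrow> 0 < n l" and st: "0 < s" "0 < t" and \<delta>: "0 \<le> \<delta>"
    and X: "\<And>a b h. a < s \<Longrightarrow> b < t \<Longrightarrow> csplits (lam d n) (\<lambda>\<alpha> \<beta>. qcomp h (Fh (mdiff d \<alpha> \<beta>) a b)
        - circ d n S (\<lambda>q. qcomp h (Fh q a b)) \<alpha> \<beta>) r \<delta>"
  shows "qsplits (Nsize d n * s) (Nsize d n * t)
    (\<lambda>i j. toeplitz d n s t Fh i j - (\<Sum>q\<in>S. kron_rq s t (mshift n q d) (Fh q) i j))
    (2 * real (s * t) * r) (2 * real (s * t) * \<delta>)"
proof -
  define I where "I = {..<s} \<times> {..<t} \<times> (UNIV :: bool set)"
  define X where "X a b h \<alpha> \<beta> = qcomp h (Fh (mdiff d \<alpha> \<beta>) a b) - circ d n S (\<lambda>q. qcomp h (Fh q a b)) \<alpha> \<beta>"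
    for a b h \<alpha> \<beta>
  define Y where "Y z i j = (case z of (a, b, h) \<Rightarrow> if i mod s = a \<and> j mod t = b
      then qmul (qc (X a b h (mi d n (i div s)) (mi d n (j div t)))) (qunit h) else 0)" for z i j
  have cardI: "card I = 2 * (s * t)" by (simp add: I_def card_cartesian_product UNIV_bool)
  have "qsplits (Nsize d n * s) (Nsize d n * t) (Y z) r \<delta>" if zI: "z \<in> I" for z
  proof -
    obtain a b h where z: "z = (a, b, h)" "a < s" "b < t" using zI by (auto simp: I_def)
    have "csplits (lam d n) (X a b h) r \<delta>" unfolding X_def by (rule assms(5)[OF z(2,3)])
    from csplits_imp_qsplits[OF this bij_betw_mi[OF n] z(2,3) norm_qunit \<delta>]
    show ?thesis unfolding z(1) Y_def by simp
  qed
  then have "qsplits (Nsize d n * s) (Nsize d n * t) (\<lambda>i j. \<Sum>z\<in>I. Y z i j) (real (card I) * r) (real (card I) * \<delta>)"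
    by (rule qsplits_sum)
  moreover have "(\<Sum>z\<in>I. Y z i j) = toeplitz d n s t Fh i j - (\<Sum>q\<in>S. kron_rq s t (mshift n q d) (Fh q) i j)" for i j
  proof -
    let ?D = "toeplitz d n s t Fh i j - (\<Sum>q\<in>S. kron_rq s t (mshift n q d) (Fh q) i j)"
    \<comment> \<open>Only the pieces at the position of \<open>(i, j)\<close> in its block
      contribute, which leaves the sum over the two components.\<close>
    have "(\<Sum>z\<in>I. Y z i j) = (\<Sum>z\<in>{i mod s} \<times> {j mod t} \<times> UNIV. Y z i j)"
      using st by (intro sum.mono_neutral_right) (auto simp: I_def Y_def split: if_splits)
    also have "\<dots> = (\<Sum>h\<in>UNIV. Y (i mod s, j mod t, h) i j)"
      by (rule sum.reindex_bij_witness[of _ "\<lambda>h. (i mod s, j mod t, h)" "\<lambda>(a,b,h). h"]) auto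
    also have "\<dots> = (\<Sum>h\<in>UNIV. qmul (qc (qcomp h ?D)) (qunit h))"
      unfolding Y_def X_def qcomp_toeplitz_minus_circulant[OF st] by simp
    also have "\<dots> = ?D" by (rule quat_eq_sum_qcomp)
    finally show ?thesis .
  qed
  ultimately show ?thesis by (simp add: cardI mult.assoc)
qed

section \<open>Nested boxes and the approximating class\<close>

theorem mainTheorem18:
  fixes d s t :: nat and F :: "(nat \<Rightarrow> real) \<Rightarrow> qmat" and SL :: "nat set"
  assumes "1 \<le> d" and "1 \<le> s" and "1 \<le> t"
    and "SL \<subseteq> {..<d}"
    and "qL1 d s t F"
  shows "\<exists>S :: nat \<Rightarrow> (nat \<Rightarrow> int) set.
           (\<forall>m. finite (S m) \<and> S m \<subseteq> Zd d) \<and> mono S \<and> (\<Union>m. S m) = Zd d \<and>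
           is_acs d s t
             (\<lambda>n. toeplitz d n s t (fourier_coeff d SL F))
             (\<lambda>m n. \<lambda>i j. \<Sum>q\<in>S m. kron_rq s t (mshift n q d) (fourier_coeff d SL F q) i j)"
proof -
  define I where "I = {..<s} \<times> {..<t} \<times> (UNIV :: bool set)"
  define c where "c z q = (case z of (a, b, h) \<Rightarrow> qcomp h (fourier_coeff d SL F q a b))" for z q
  define \<epsilon> where "\<epsilon> m = inverse (real (Suc m))" for m
  have \<epsilon>: "0 < \<epsilon> m" for m by (simp add: \<epsilon>_def)
  have finI: "finite I" by (simp add: I_def)
  have c: "L1type d (c z)" if zI: "z \<in> I" for z
  proof -
    obtain a b h where z: "z = (a, b, h)" "a < s" "b < t" using zI by (auto simp: I_def)
    have F: "integrable (tor d) (\<lambda>\<theta>. F \<theta> a b)"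
      using assms(5) z unfolding qL1_def integrable_tor by blast
    have "L1type d (fcoeff d (\<lambda>_. 1) (\<lambda>\<theta>. q1 (F \<theta> a b)))" "L1type d (fcoeff d (sgnSL SL) (\<lambda>\<theta>. q2 (F \<theta> a b)))"
      using F by (intro L1type_fcoeff integrable_bounded_linear[OF bounded_linear_q1]
          integrable_bounded_linear[OF bounded_linear_q2]; simp add: sgnSL_def)+
    moreover have "c z = (if h then fcoeff d (\<lambda>_. 1) (\<lambda>\<theta>. q1 (F \<theta> a b)) else fcoeff d (sgnSL SL) (\<lambda>\<theta>. q2 (F \<theta> a b)))"
      using fourier_coeff_components[where F = F and a = a and b = b, OF assms(4) F]
      by (auto simp: c_def z(1) qcomp_def fun_eq_iff)
    ultimately show ?thesis by simp
  qed
  \<comment> \<open>The condition \<open>m \<le> M j\<close> makes the boxes exhaust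
    \<open>Zd d\<close>; the rest is what \<open>toeplitz_circulant_splits\<close> needs for the
    accuracy \<open>\<epsilon> m\<close>.\<close>
  define good where "good m M \<longleftrightarrow> (\<forall>j<d. m \<le> M j) \<and> (\<forall>z\<in>I. \<exists>p. trigpoly d p \<and> L1le d (\<lambda>q. c z q - p q) (\<epsilon> m) \<and>
    grid_ev d (\<lambda>n. gavg d n (\<lambda>k. sqrt (cmod ((\<Sum>q | p q \<noteq> 0. p q * zchr d n q k) - (\<Sum>q\<in>fbox d M. c z q * zchr d n q k)))) \<le> \<epsilon> m))"
    for m :: nat and M
  have ex: "\<exists>M. good m M \<and> (\<forall>j<d. K \<le> M j)" for m K
  proof -
    have "\<exists>M. (\<forall>j<d. max m K \<le> M j) \<and> (\<forall>z\<in>I. \<exists>p. trigpoly d p \<and> L1le d (\<lambda>q. c z q - p q) (\<epsilon> m) \<and>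
      grid_ev d (\<lambda>n. gavg d n (\<lambda>k. sqrt (cmod ((\<Sum>q | p q \<noteq> 0. p q * zchr d n q k) - (\<Sum>q\<in>fbox d M. c z q * zchr d n q k)))) \<le> \<epsilon> m))"
      by (rule partial_sums_converge[OF finI c \<epsilon>])
    then show ?thesis unfolding good_def max.bounded_iff by blast
  qed
  have "\<exists>M. \<forall>m. good m (M m) \<and> (\<forall>j<d. M m j \<le> M (Suc m) j)"
  proof (rule dependent_nat_choice)
    show "\<exists>M. good 0 M" using ex[of 0 0] by blast
    fix M :: "nat \<Rightarrow> nat" and m
    \<comment> \<open>The sum of the side lengths of \<open>M\<close> dominates each of them, so it
      is a single lower bound under which the next box contains the present one.\<close>
    obtain M' where M': "good (Suc m) M'" "\<forall>j<d. (\<Sum>j<d. M j) \<le> M' j" using ex by blast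
    have "M j \<le> M' j" if "j < d" for j
      using M'(2) that member_le_sum[where i = j and A = "{..<d}" and f = M] by fastforce
    then show "\<exists>M'. good (Suc m) M' \<and> (\<forall>j<d. M j \<le> M' j)" using M'(1) by blast
  qed
  then obtain M where good: "\<And>m. good m (M m)" and inc: "\<And>m j. j < d \<Longrightarrow> M m j \<le> M (Suc m) j" by blast
  define S where "S m = fbox d (M m)" for m
  define r where "r m = 9 ^ d * sqrt (\<epsilon> m) + \<epsilon> m + sqrt (\<epsilon> m)" for m
  define w where "w m = sqrt (\<epsilon> m) + \<epsilon> m" for m
  have "\<epsilon> \<longlonglongrightarrow> 0" unfolding \<epsilon>_def by (rule LIMSEQ_inverse_real_of_nat)
  then have sq: "(\<lambda>m. sqrt (\<epsilon> m)) \<longlonglongrightarrow> 0" using tendsto_real_sqrt by fastforce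
  have r0: "(\<lambda>m. 2 * real (s * t) * r m) \<longlonglongrightarrow> 0"
    unfolding r_def using \<open>\<epsilon> \<longlonglongrightarrow> 0\<close> sq by (auto intro!: tendsto_eq_intros)
  have w0: "(\<lambda>m. 2 * real (s * t) * w m) \<longlonglongrightarrow> 0"
    unfolding w_def using \<open>\<epsilon> \<longlonglongrightarrow> 0\<close> sq by (auto intro!: tendsto_eq_intros)
  have acs: "\<exists>K. \<forall>n. (\<forall>j<d. K \<le> n j) \<longrightarrow>
      (\<exists>R N. (\<forall>i < Nsize d n * s. \<forall>j < Nsize d n * t. toeplitz d n s t (fourier_coeff d SL F) i j
             = (\<Sum>q\<in>S m. kron_rq s t (mshift n q d) (fourier_coeff d SL F q) i j) + R i j + N i j)
           \<and> real (qrank (Nsize d n * s) (Nsize d n * t) R) \<le> 2 * real (s * t) * r m * real (Nsize d n * min s t)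
           \<and> qopnorm (Nsize d n * s) (Nsize d n * t) N \<le> 2 * real (s * t) * w m)" for m
  proof -
    have "grid_ev d (\<lambda>n. \<forall>z\<in>I. (\<forall>l<d. 0 < n l) \<and> csplits (lam d n) (\<lambda>\<alpha> \<beta>. c z (mdiff d \<alpha> \<beta>) - circ d n (S m) (c z) \<alpha> \<beta>)
       (r m * real (Nsize d n)) (w m))"
    proof (rule grid_ev_ball[OF finI])
      fix z assume "z \<in> I"
      then obtain p where "trigpoly d p" "L1le d (\<lambda>q. c z q - p q) (\<epsilon> m)"
        "grid_ev d (\<lambda>n. gavg d n (\<lambda>k. sqrt (cmod ((\<Sum>q | p q \<noteq> 0. p q * zchr d n q k) - (\<Sum>q\<in>S m. c z q * zchr d n q k)))) \<le> \<epsilon> m)"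
        using good[of m] unfolding good_def S_def by blast
      from toeplitz_circulant_splits[OF this(1,2) \<epsilon> this(3)]
      show "grid_ev d (\<lambda>n. (\<forall>l<d. 0 < n l) \<and> csplits (lam d n) (\<lambda>\<alpha> \<beta>. c z (mdiff d \<alpha> \<beta>) - circ d n (S m) (c z) \<alpha> \<beta>)
         (r m * real (Nsize d n)) (w m))" unfolding r_def w_def .
    qed
    then obtain K where K: "\<And>n. (\<forall>j<d. K \<le> n j) \<Longrightarrow> \<forall>z\<in>I. (\<forall>l<d. 0 < n l) \<and>
        csplits (lam d n) (\<lambda>\<alpha> \<beta>. c z (mdiff d \<alpha> \<beta>) - circ d n (S m) (c z) \<alpha> \<beta>) (r m * real (Nsize d n)) (w m)"
      unfolding grid_ev_def by blast
    show ?thesis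
    proof (intro exI[of _ K] allI impI)
      fix n assume n: "\<forall>j<d. K \<le> n j"
      \<comment> \<open>\<open>I\<close> is nonempty as \<open>s\<close> and \<open>t\<close> are
        positive, and any of its elements yields the positivity of the \<open>n l\<close>.\<close>
      have "(0, 0, True) \<in> I" using assms by (simp add: I_def)
      then have n0: "0 < n l" if "l < d" for l using K[OF n] that by blast
      have wr: "0 \<le> w m" "0 \<le> r m" using \<epsilon>[of m] by (simp_all add: w_def r_def)
      have "qsplits (Nsize d n * s) (Nsize d n * t)
        (\<lambda>i j. toeplitz d n s t (fourier_coeff d SL F) i j - (\<Sum>q\<in>S m. kron_rq s t (mshift n q d) (fourier_coeff d SL F q) i j))
        (2 * real (s * t) * (r m * real (Nsize d n))) (2 * real (s * t) * w m)"
      proof (rule quat_matrix_splits[OF n0])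
        fix a b h assume "a < s" "b < t"
        then have "(a, b, h) \<in> I" by (simp add: I_def)
        then show "csplits (lam d n) (\<lambda>\<alpha> \<beta>. qcomp h (fourier_coeff d SL F (mdiff d \<alpha> \<beta>) a b)
           - circ d n (S m) (\<lambda>q. qcomp h (fourier_coeff d SL F q a b)) \<alpha> \<beta>) (r m * real (Nsize d n)) (w m)"
          using K[OF n] unfolding c_def by fastforce
      qed (use assms wr in auto)
      from qsplits_imp_rank_norm[OF this] wr obtain R N where
        RN: "\<forall>i<Nsize d n * s. \<forall>j<Nsize d n * t. toeplitz d n s t (fourier_coeff d SL F) i j
           - (\<Sum>q\<in>S m. kron_rq s t (mshift n q d) (fourier_coeff d SL F q) i j) = R i j + N i j"
        and rk: "real (qrank (Nsize d n * s) (Nsize d n * t) R) \<le> 2 * real (s * t) * (r m * real (Nsize d n))"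
        and nm: "qopnorm (Nsize d n * s) (Nsize d n * t) N \<le> 2 * real (s * t) * w m"
        by auto
      \<comment> \<open>The rank bound is relative to \<open>Nsize d n\<close>; since
        \<open>min s t\<close> is at least 1, it is also one relative to the normalization in
        \<open>is_acs\<close>.\<close>
      have "2 * real (s * t) * (r m * real (Nsize d n)) \<le> 2 * real (s * t) * r m * real (Nsize d n * min s t)"
      proof -
        have "Nsize d n * 1 \<le> Nsize d n * min s t" using assms by (intro mult_left_mono) auto
        then have "real (Nsize d n) \<le> real (Nsize d n * min s t)" by (simp only: of_nat_le_iff mult_1_right)
        then have "2 * real (s * t) * r m * real (Nsize d n) \<le> 2 * real (s * t) * r m * real (Nsize d n * min s t)"
          using wr by (intro mult_left_mono) auto
        then show ?thesis by (simp only: mult.assoc)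
      qed
      with rk nm RN show "\<exists>R N. (\<forall>i < Nsize d n * s. \<forall>j < Nsize d n * t. toeplitz d n s t (fourier_coeff d SL F) i j
             = (\<Sum>q\<in>S m. kron_rq s t (mshift n q d) (fourier_coeff d SL F q) i j) + R i j + N i j)
           \<and> real (qrank (Nsize d n * s) (Nsize d n * t) R) \<le> 2 * real (s * t) * r m * real (Nsize d n * min s t)
           \<and> qopnorm (Nsize d n * s) (Nsize d n * t) N \<le> 2 * real (s * t) * w m"
        by (intro exI[of _ R] exI[of _ N]) (auto simp: algebra_simps)
    qed
  qed
  show ?thesis
  proof (intro exI[of _ S] conjI allI)
    show "finite (S m)" "S m \<subseteq> Zd d" for m by (simp_all add: S_def) (simp add: fbox_def)
    show "mono S"
      unfolding mono_iff_le_Suc S_def using inc by (auto intro!: fbox_mono)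
    show "(\<Union>m. S m) = Zd d"
    proof
      show "(\<Union>m. S m) \<subseteq> Zd d" by (auto simp: S_def fbox_def)
      show "Zd d \<subseteq> (\<Union>m. S m)"
      proof
        fix q assume q: "q \<in> Zd d"
        \<comment> \<open>This \<open>m\<close> dominates every \<open>\<bar>q l\<bar>\<close>, and
          \<open>good\<close> gives \<open>m \<le> M m l\<close>, so the m-th box contains
          \<open>q\<close>.\<close>
        define m where "m = (\<Sum>l<d. nat \<bar>q l\<bar>)"
        have "\<bar>q l\<bar> \<le> int (M m l)" if "l < d" for l
        proof -
          have "nat \<bar>q l\<bar> \<le> m" unfolding m_def
            using that member_le_sum[where i = l and A = "{..<d}" and f = "\<lambda>l. nat \<bar>q l\<bar>"] by simp
          also have "m \<le> M m l" using good[of m] that unfolding good_def by blast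
          finally show ?thesis by linarith
        qed
        then have "q \<in> S m" using q by (simp add: S_def fbox_def)
        then show "q \<in> (\<Union>m. S m)" by blast
      qed
    qed
    show "is_acs d s t (\<lambda>n. toeplitz d n s t (fourier_coeff d SL F))
             (\<lambda>m n. \<lambda>i j. \<Sum>q\<in>S m. kron_rq s t (mshift n q d) (fourier_coeff d SL F q) i j)"
      unfolding is_acs_def
      by (rule exI[of _ "\<lambda>m. 2 * real (s * t) * r m"], rule exI[of _ "\<lambda>m. 2 * real (s * t) * w m"])
        (use r0 w0 acs in blast)
  qed
qed

end
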